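(* Let $\Omega$ be an arbitrary index set and $B=B_\Omega$. There is a canonical one-to-one correspondence $L \leftrightarrow \nu$, given by $L(f) = \int \hat{f}_B\, d\nu$ for all $f\in B$, between PSD linear functionals $L : B\to\mathbb{R}$ and constructibly Radon measures $\nu$ on $X(B)$ with the property that $\hat{f}_B$ is $\nu$-integrable for all $f\in B$.
   Context: $B_\Omega=\mathbb{R}[x_i,\frac{1}{1+x_i^2}\mid i\in\Omega]$ is the localization of the polynomial algebra $\mathbb{R}[x_i\mid i\in\Omega]$ at the multiplicative set generated by the $1+x_i^2$, $i\in\Omega$. A linear functional $L:B\to\mathbb{R}$ is PSD if $L(b)\ge0$ for every finite sum of squares $b$ of elements of $B$. For a commutative $\mathbb{R}$-algebra $D$ with $1$, $X(D)$ is the set of all unital ring homomorphisms $\alpha:D\to\mathbb{R}$; for $a\in D$, $\hat a_D:X(D)\to\mathbb{R}$ is $\hat a_D(\alpha)=\alpha(a)$; $X(D)$ has the weakest topology making all $\hat a_D$ continuous. $X(B_\Omega)$ is identified, as a topological space, with $\mathbb{R}^\Omega$ (product topology) via point evaluations. A subset of $X(D)$ is constructibly Borel if it lies in the $\sigma$-algebra generated by the sets $U_D(a)=\{\alpha\in X(D)\mid \hat a_D(\alpha)>0\}$, $a\in D$. A Radon measure is a positive measure on the Borel $\sigma$-algebra that is locally finite (every point has a neighbourhood of finite measure) and inner regular (each Borel set can be approximated from within by compact sets). A constructibly Radon measure on $X(D)$ is a positive measure on the $\sigma$-algebra of constructibly Borel sets of $X(D)$ such that, for each countably generated subalgebra $D'$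 of $D$, its pushforward to $X(D')$ via the restriction map $\alpha\mapsto\alpha|_{D'}$ is a Radon measure on $X(D')$. A function is $\nu$-integrable if its integral is well-defined and finite. *)

theory Defs
  imports "HOL-Analysis.Analysis" "HOL-Library.Poly_Mapping"
begin

section \<open>The localized polynomial algebra\<close>

text \<open>
  Polynomials over \<open>\<real>\<close> in variables of type \<open>'i\<close>: a monomial is a finitely supported exponent
  function, a polynomial a finitely supported coefficient function on the monomials.
\<close>

type_synonym 'i rpoly = "('i \<Rightarrow>\<^sub>0 nat) \<Rightarrow>\<^sub>0 real"

definition pconst :: "real \<Rightarrow> 'i rpoly" where
  "pconst c = Poly_Mapping.single 0 c"

definition pvar :: "'i \<Rightarrow> 'i rpoly" where
  "pvar i = Poly_Mapping.single (Poly_Mapping.single i 1) 1"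

definition polys_on :: "'i set \<Rightarrow> 'i rpoly set" where
  "polys_on \<Omega> = {p. \<forall>m\<in>Poly_Mapping.keys p. Poly_Mapping.keys m \<subseteq> \<Omega>}"

inductive_set denoms :: "'i set \<Rightarrow> 'i rpoly set" for \<Omega> :: "'i set" where
  one: "1 \<in> denoms \<Omega>"
| generator: "i \<in> \<Omega> \<Longrightarrow> 1 + (pvar i)\<^sup>2 \<in> denoms \<Omega>"
| mult: "s \<in> denoms \<Omega> \<Longrightarrow> t \<in> denoms \<Omega> \<Longrightarrow> s * t \<in> denoms \<Omega>"

lemma denoms_mono:
  assumes "s \<in> denoms \<Omega>" "\<Omega> \<subseteq> \<Omega>'"
  shows "s \<in> denoms \<Omega>'"
  using assms by induction (auto intro: denoms.intros)

lemma lookup_single_times_eq_0: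
  fixes q :: "'i rpoly"
  assumes "\<And>k. m = e + k \<Longrightarrow> Poly_Mapping.lookup q k = 0"
  shows "Poly_Mapping.lookup (Poly_Mapping.single e c * q) m = 0"
proof -
  have "(\<Sum>k. Poly_Mapping.lookup q k when m = l + k) = 0" if "l = e" for l
  proof -
    have "(Poly_Mapping.lookup q k when m = l + k) = 0" for k
      using assms that by (auto simp: when_def)
    then show ?thesis
      by simp
  qed
  then have "Poly_Mapping.lookup (Poly_Mapping.single e c) l *
      (\<Sum>k. Poly_Mapping.lookup q k when m = l + k) = 0" for l
    by (cases "l = e") (simp_all add: lookup_single when_def)
  then show ?thesis
    unfolding lookup_mult by (simp only: Sum_any.neutral)
qed

lemma pvar_square: "(pvar i)\<^sup>2 = Poly_Mapping.single (Poly_Mapping.single i 2) 1"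
  by (simp add: pvar_def power2_eq_square mult_single single_add[symmetric] numeral_2_eq_2)

lemma generator_cancel:
  fixes q :: "'i rpoly"
  assumes "(1 + (pvar i)\<^sup>2) * q = 0"
  shows "q = 0"
proof -
  have eq: "q = - ((pvar i)\<^sup>2 * q)"
    using assms by (simp add: algebra_simps eq_neg_iff_add_eq_0)
  have "Poly_Mapping.lookup q m = 0" for m
  proof (induction "Poly_Mapping.lookup m i" arbitrary: m rule: less_induct)
    case less
    have "Poly_Mapping.lookup ((pvar i)\<^sup>2 * q) m = 0"
      unfolding pvar_square
      by (rule lookup_single_times_eq_0) (auto intro!: less simp: lookup_add lookup_single)
    then show ?case
      by (subst eq) simp
  qed
  then show ?thesis
    by (intro poly_mapping_eqI) simp
qed

lemma denoms_cancel:
  assumes "s \<in> denoms \<Omega>" "s * q = 0"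
  shows "q = 0"
  using assms
proof (induction arbitrary: q)
  case one
  then show ?case by (simp only: mult_1_left)
next
  case (generator i)
  then show ?case by (blast intro: generator_cancel)
next
  case (mult s t)
  then show ?case by (metis mult.assoc)
qed

text \<open>
  The localization of the polynomial ring in all variables of type \<open>'i\<close> at \<open>denoms UNIV\<close>.
  For \<open>\<Omega> :: 'i set\<close>, the localization of \<open>polys_on \<Omega>\<close> at \<open>denoms \<Omega>\<close> is its
  subalgebra \<open>B_loc \<Omega>\<close> below: in both rings two fractions are equal iff they agree after cross
  multiplication (\<open>fraction_eq_iff\<close>), because the denominators are not zero divisors
  (\<open>denoms_cancel\<close>).
\<close>

definition locrel :: "'i rpoly \<times> 'i rpoly \<Rightarrow> 'i rpoly \<times> 'i rpoly \<Rightarrow> bool" where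
  "locrel x y \<longleftrightarrow> snd x \<in> denoms UNIV \<and> snd y \<in> denoms UNIV \<and>
     (\<exists>u\<in>denoms UNIV. u * (fst x * snd y - fst y * snd x) = 0)"

lemma locrel_iff:
  "locrel x y \<longleftrightarrow> snd x \<in> denoms UNIV \<and> snd y \<in> denoms UNIV \<and> fst x * snd y = fst y * snd x"
proof -
  have "(\<exists>u\<in>denoms UNIV. u * q = 0) \<longleftrightarrow> q = 0" for q :: "'a rpoly"
    using denoms_cancel[where q = q] denoms.one[of UNIV] by (metis mult_zero_right)
  then show ?thesis
    by (simp only: locrel_def right_minus_eq)
qed

lemma part_equivp_locrel: "part_equivp (locrel :: 'a rpoly \<times> 'a rpoly \<Rightarrow> _)"
proof (rule part_equivpI)
  show "\<exists>x. locrel x x"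
    by (rule exI[of _ "(0, 1)"]) (simp add: locrel_iff denoms.one)
  show "symp locrel"
    by (simp add: symp_def locrel_iff)
  show "transp (locrel :: 'a rpoly \<times> 'a rpoly \<Rightarrow> _)"
  proof (rule transpI)
    fix x y z :: "'a rpoly \<times> 'a rpoly"
    assume "locrel x y" "locrel y z"
    then have den: "snd x \<in> denoms UNIV" "snd y \<in> denoms UNIV" "snd z \<in> denoms UNIV"
      and 1: "fst x * snd y = fst y * snd x" and 2: "fst y * snd z = fst z * snd y"
      by (simp_all only: locrel_iff)
    have "snd y * (fst x * snd z - fst z * snd x)
        = (fst x * snd y) * snd z - (fst z * snd y) * snd x"
      by (simp add: algebra_simps)
    also have "\<dots> = 0"
      unfolding 1 2[symmetric] by (simp add: algebra_simps)
    finally have "fst x * snd z - fst z * snd x = 0"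
      by (rule denoms_cancel[OF den(2)])
    then show "locrel x z"
      using den by (simp add: locrel_iff)
  qed
qed

quotient_type 'i loc = "'i rpoly \<times> 'i rpoly" / partial: locrel
  by (rule part_equivp_locrel)

lifting_forget poly_mapping.lifting

text \<open>The fraction \<open>p / s\<close>; by convention it is 0 if \<open>s \<notin> denoms UNIV\<close>.\<close>

lift_definition fraction :: "'i rpoly \<Rightarrow> 'i rpoly \<Rightarrow> 'i loc"
  is "\<lambda>p s. if s \<in> denoms UNIV then (p, s) else (0, 1)"
  by (simp add: locrel_iff denoms.one)

lemma frac_cases:
  obtains p s where "x = fraction p s" "s \<in> denoms UNIV"
  by transfer (auto simp: locrel_iff)

lemma fraction_eq_iff:
  "s \<in> denoms UNIV \<Longrightarrow> t \<in> denoms UNIV \<Longrightarrow> fraction p s = fraction q t \<longleftrightarrow> p * t = q * s"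
  by transfer (simp add: locrel_iff)

lemma add_cross:
  fixes a :: "'a::comm_ring_1"
  assumes 1: "a * b' = a' * b" and 2: "c * d' = c' * d"
  shows "(a * d + c * b) * (b' * d') = (a' * d' + c' * b') * (b * d)"
proof -
  have "(a * d + c * b) * (b' * d') = (a * b') * (d * d') + (c * d') * (b * b')"
    by (simp add: algebra_simps)
  also have "\<dots> = (a' * b) * (d * d') + (c' * d) * (b * b')"
    by (simp only: 1 2)
  also have "\<dots> = (a' * d' + c' * b') * (b * d)"
    by (simp add: algebra_simps)
  finally show ?thesis .
qed

lemma mult_cross:
  fixes a :: "'a::comm_ring_1"
  assumes 1: "a * b' = a' * b" and 2: "c * d' = c' * d"
  shows "(a * c) * (b' * d') = (a' * c') * (b * d)"
proof -
  have "(a * c) * (b' * d') = (a * b') * (c * d')"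
    by (simp add: algebra_simps)
  also have "\<dots> = (a' * b) * (c' * d)"
    by (simp only: 1 2)
  also have "\<dots> = (a' * c') * (b * d)"
    by (simp add: algebra_simps)
  finally show ?thesis .
qed

instantiation loc :: (type) "{comm_ring_1, real_algebra_1}"
begin

lift_definition zero_loc :: "'a loc" is "(0, 1)"
  by (simp add: locrel_iff denoms.one)

lift_definition one_loc :: "'a loc" is "(1, 1)"
  by (simp add: locrel_iff denoms.one)

lift_definition plus_loc :: "'a loc \<Rightarrow> 'a loc \<Rightarrow> 'a loc"
  is "\<lambda>x y. (fst x * snd y + fst y * snd x, snd x * snd y)"
  unfolding locrel_iff fst_conv snd_conv by (intro conjI denoms.mult add_cross) (elim conjE; assumption)+

lift_definition uminus_loc :: "'a loc \<Rightarrow> 'a loc" is "\<lambda>x. (- fst x, snd x)"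
  by (simp only: locrel_iff fst_conv snd_conv mult_minus_left)

definition minus_loc :: "'a loc \<Rightarrow> 'a loc \<Rightarrow> 'a loc" where
  "minus_loc x y = x + (- y)"

lift_definition times_loc :: "'a loc \<Rightarrow> 'a loc \<Rightarrow> 'a loc"
  is "\<lambda>x y. (fst x * fst y, snd x * snd y)"
  unfolding locrel_iff fst_conv snd_conv by (intro conjI denoms.mult mult_cross) (elim conjE; assumption)+

lift_definition scaleR_loc :: "real \<Rightarrow> 'a loc \<Rightarrow> 'a loc"
  is "\<lambda>c x. (pconst c * fst x, snd x)"
  by (simp only: locrel_iff fst_conv snd_conv mult.assoc)

lemma fraction_abs: "s \<in> denoms UNIV \<Longrightarrow> fraction p s = abs_loc (p, s)"
  by (simp add: fraction_def)

lemma locrel_refl: "s \<in> denoms UNIV \<Longrightarrow> locrel (p, s) (p, s)"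
  by (simp add: locrel_iff)

lemma zero_frac: "0 = fraction 0 1"
  by (simp only: zero_loc_def fraction_abs denoms.one)

lemma one_frac: "1 = fraction 1 1"
  by (simp only: one_loc_def fraction_abs denoms.one)

lemma add_frac:
  "s \<in> denoms UNIV \<Longrightarrow> t \<in> denoms UNIV \<Longrightarrow> fraction p s + fraction q t = fraction (p * t + q * s) (s * t)"
  by (simp only: fraction_abs denoms.mult plus_loc.abs_eq locrel_refl fst_conv snd_conv)

lemma uminus_frac: "s \<in> denoms UNIV \<Longrightarrow> - fraction p s = fraction (- p) s"
  by (simp only: fraction_abs uminus_loc.abs_eq locrel_refl fst_conv snd_conv)

lemma mult_frac:
  "s \<in> denoms UNIV \<Longrightarrow> t \<in> denoms UNIV \<Longrightarrow> fraction p s * fraction q t = fraction (p * q) (s * t)"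
  by (simp only: fraction_abs denoms.mult times_loc.abs_eq locrel_refl fst_conv snd_conv)

lemma scaleR_frac: "s \<in> denoms UNIV \<Longrightarrow> c *\<^sub>R fraction p s = fraction (pconst c * p) s"
  by (simp only: fraction_abs scaleR_loc.abs_eq locrel_refl fst_conv snd_conv)

lemma pconst_simps:
  "pconst (a + b) = pconst a + pconst b" "pconst (a * b) = pconst a * pconst b" "pconst 1 = 1"
  by (simp_all add: pconst_def single_add mult_single)

instance
proof
  fix x y z :: "'a loc" and a b :: real
  obtain p s where x: "x = fraction p s" "s \<in> denoms UNIV" by (rule frac_cases)
  obtain q t where y: "y = fraction q t" "t \<in> denoms UNIV" by (rule frac_cases)
  obtain r u where z: "z = fraction r u" "u \<in> denoms UNIV" by (rule frac_cases)
  note rules = zero_frac one_frac add_frac uminus_frac mult_frac scaleR_frac fraction_eq_iff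
    denoms.one denoms.mult x y z pconst_simps minus_loc_def
  show "x + y + z = x + (y + z)" by (simp add: rules algebra_simps)
  show "x + y = y + x" by (simp add: rules algebra_simps)
  show "0 + x = x" by (simp add: rules algebra_simps)
  show "- x + x = 0" by (simp add: rules algebra_simps)
  show "x - y = x + - y" by (simp add: minus_loc_def)
  show "x * y * z = x * (y * z)" by (simp add: rules algebra_simps)
  show "x * y = y * x" by (simp add: rules algebra_simps)
  show "1 * x = x" by (simp add: rules algebra_simps)
  show "(x + y) * z = x * z + y * z" by (simp add: rules algebra_simps)
  show "x * (y + z) = x * y + x * z" by (simp add: rules algebra_simps)
  show "x * 1 = x" by (simp add: rules algebra_simps)
  show "(0 :: 'a loc) \<noteq> 1" by (simp add: rules)
  show "a *\<^sub>R (x + y) = a *\<^sub>R x + a *\<^sub>R y" by (simp add: rules algebra_simps)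
  show "(a + b) *\<^sub>R x = a *\<^sub>R x + b *\<^sub>R x" by (simp add: rules algebra_simps)
  show "a *\<^sub>R b *\<^sub>R x = (a * b) *\<^sub>R x" by (simp add: rules algebra_simps)
  show "1 *\<^sub>R x = x" by (simp add: rules algebra_simps)
  show "a *\<^sub>R x * y = a *\<^sub>R (x * y)" by (simp add: rules algebra_simps)
  show "x * a *\<^sub>R y = a *\<^sub>R (x * y)" by (simp add: rules algebra_simps)
qed

end

definition B_loc :: "'i set \<Rightarrow> 'i loc set" where
  "B_loc \<Omega> = {fraction p s | p s. p \<in> polys_on \<Omega> \<and> s \<in> denoms \<Omega>}"


section \<open>Subalgebras, positive semidefinite functionals\<close>

text \<open>
  A commutative \<open>\<real>\<close>-algebra with 1 is represented as a unital subalgebra of an ambient type.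
\<close>

definition subalgebra :: "'a::{comm_ring_1, real_algebra_1} set \<Rightarrow> bool" where
  "subalgebra D \<longleftrightarrow> 1 \<in> D \<and> (\<forall>a\<in>D. \<forall>b\<in>D. a + b \<in> D \<and> a * b \<in> D) \<and> (\<forall>c. \<forall>a\<in>D. c *\<^sub>R a \<in> D)"

definition countably_generated_subalgebra ::
    "'a::{comm_ring_1, real_algebra_1} set \<Rightarrow> 'a set \<Rightarrow> bool" where
  "countably_generated_subalgebra D D' \<longleftrightarrow>
     (\<exists>C. countable C \<and> C \<subseteq> D \<and> D' = subalgebra hull C)"

lemma polys_on_add: "p \<in> polys_on \<Omega> \<Longrightarrow> q \<in> polys_on \<Omega> \<Longrightarrow> p + q \<in> polys_on \<Omega>"
  unfolding polys_on_def using Poly_Mapping.keys_add[of p q] by blast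

lemma polys_on_mult:
  assumes "p \<in> polys_on \<Omega>" "q \<in> polys_on \<Omega>"
  shows "p * q \<in> polys_on \<Omega>"
  unfolding polys_on_def
proof (intro CollectI ballI)
  fix m assume "m \<in> Poly_Mapping.keys (p * q)"
  then obtain a b where "m = a + b" "a \<in> Poly_Mapping.keys p" "b \<in> Poly_Mapping.keys q"
    using keys_mult[of p q] by blast
  then show "Poly_Mapping.keys m \<subseteq> \<Omega>"
    using assms Poly_Mapping.keys_add[of a b] unfolding polys_on_def by blast
qed

lemma polys_on_pconst: "pconst c \<in> polys_on \<Omega>"
  by (simp add: polys_on_def pconst_def)

lemma polys_on_pvar: "i \<in> \<Omega> \<Longrightarrow> pvar i \<in> polys_on \<Omega>"
  by (simp add: polys_on_def pvar_def)

lemma polys_on_one: "1 \<in> polys_on \<Omega>"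
  using polys_on_pconst[of 1] by (simp only: pconst_simps)

lemma denoms_polys_on: "s \<in> denoms \<Omega> \<Longrightarrow> s \<in> polys_on \<Omega>"
  by (induction rule: denoms.induct)
    (auto simp only: power2_eq_square intro: polys_on_one polys_on_add polys_on_mult polys_on_pvar)

lemma subalgebra_B_loc: "subalgebra (B_loc \<Omega>)"
  unfolding subalgebra_def
proof (intro conjI ballI allI)
  show "1 \<in> B_loc \<Omega>"
    unfolding B_loc_def one_frac using polys_on_one denoms.one by blast
next
  fix a b assume "a \<in> B_loc \<Omega>" "b \<in> B_loc \<Omega>"
  then obtain p s q t where ab: "a = fraction p s" "b = fraction q t"
    and p: "p \<in> polys_on \<Omega>" "q \<in> polys_on \<Omega>" and s: "s \<in> denoms \<Omega>" "t \<in> denoms \<Omega>"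
    unfolding B_loc_def by blast
  have s': "s \<in> denoms UNIV" "t \<in> denoms UNIV"
    using s denoms_mono by blast+
  show "a + b \<in> B_loc \<Omega>"
    unfolding ab add_frac[OF s'] B_loc_def
    using polys_on_add[OF polys_on_mult polys_on_mult] denoms_polys_on denoms.mult p s by blast
  show "a * b \<in> B_loc \<Omega>"
    unfolding ab mult_frac[OF s'] B_loc_def
    using polys_on_mult denoms.mult p s by blast
next
  fix c a assume "a \<in> B_loc \<Omega>"
  then obtain p s where a: "a = fraction p s" and p: "p \<in> polys_on \<Omega>" and s: "s \<in> denoms \<Omega>"
    unfolding B_loc_def by blast
  have "s \<in> denoms UNIV"
    using s denoms_mono by blast
  then have "c *\<^sub>R a = fraction (pconst c * p) s"
    unfolding a by (rule scaleR_frac)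
  then show "c *\<^sub>R a \<in> B_loc \<Omega>"
    unfolding B_loc_def using polys_on_mult[OF polys_on_pconst p] s by blast
qed

definition sums_of_squares :: "'a::comm_ring_1 set \<Rightarrow> 'a set" where
  "sums_of_squares D = {(\<Sum>k<n. (g k)\<^sup>2) | g (n::nat). \<forall>k<n. g k \<in> D}"

text \<open>
  Functions on a set \<open>D\<close> are taken to be \<open>undefined\<close> outside \<open>D\<close>, so that equality of such
  functions is equality on \<open>D\<close>.  This convention is used for functionals and for characters.
\<close>

definition psd_functionals :: "'a::{comm_ring_1, real_algebra_1} set \<Rightarrow> ('a \<Rightarrow> real) set" where
  "psd_functionals D = {L \<in> extensional D.
     (\<forall>a\<in>D. \<forall>b\<in>D. L (a + b) = L a + L b) \<and>
     (\<forall>c. \<forall>a\<in>D. L (c *\<^sub>R a) = c * L a) \<and>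
     (\<forall>b\<in>sums_of_squares D. 0 \<le> L b)}"


section \<open>The character space and its topology\<close>

definition char_space :: "'a::{comm_ring_1, real_algebra_1} set \<Rightarrow> ('a \<Rightarrow> real) set" where
  "char_space D = {\<alpha> \<in> extensional D. \<alpha> 1 = 1 \<and>
     (\<forall>a\<in>D. \<forall>b\<in>D. \<alpha> (a + b) = \<alpha> a + \<alpha> b \<and> \<alpha> (a * b) = \<alpha> a * \<alpha> b)}"

definition hat :: "'a::{comm_ring_1, real_algebra_1} set \<Rightarrow> 'a \<Rightarrow> ('a \<Rightarrow> real) \<Rightarrow> real" where
  "hat D a = (\<lambda>\<alpha>\<in>char_space D. \<alpha> a)"

definition char_topology :: "'a::{comm_ring_1, real_algebra_1} set \<Rightarrow> ('a \<Rightarrow> real) topology" where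
  "char_topology D = topology_generated_by {hat D a -` V \<inter> char_space D | a V. a \<in> D \<and> open V}"

definition pos_set :: "'a::{comm_ring_1, real_algebra_1} set \<Rightarrow> 'a \<Rightarrow> ('a \<Rightarrow> real) set" where
  "pos_set D a = {\<alpha> \<in> char_space D. hat D a \<alpha> > 0}"

definition constructibly_borel :: "'a::{comm_ring_1, real_algebra_1} set \<Rightarrow> ('a \<Rightarrow> real) set set" where
  "constructibly_borel D = sigma_sets (char_space D) {pos_set D a | a. a \<in> D}"


section \<open>Radon and constructibly Radon measures\<close>

definition borel_of_topology :: "'b topology \<Rightarrow> 'b measure" where
  "borel_of_topology T = sigma (topspace T) {V. openin T V}"

definition radon_measure :: "'b topology \<Rightarrow> 'b measure \<Rightarrow> bool" where
  "radon_measure T \<mu> \<longleftrightarrow>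
     space \<mu> = topspace T \<and> sets \<mu> = sets (borel_of_topology T) \<and>
     (\<forall>x\<in>topspace T. \<exists>V. openin T V \<and> x \<in> V \<and> emeasure \<mu> V < \<infinity>) \<and>
     (\<forall>A\<in>sets \<mu>. emeasure \<mu> A = (SUP K\<in>{K. compactin T K \<and> K \<subseteq> A}. emeasure \<mu> K))"

text \<open>
  The measurability conjunct says that the push-forward to the Borel \<open>\<sigma>\<close>-algebra is defined
  (\<open>distr\<close> is a total function); for countably generated \<open>D'\<close> the Borel and the
  constructibly Borel sets of \<open>char_space D'\<close> coincide.
\<close>

definition constructibly_radon :: "'a::{comm_ring_1, real_algebra_1} set \<Rightarrow> ('a \<Rightarrow> real) measure \<Rightarrow> bool" where
  "constructibly_radon D \<nu> \<longleftrightarrow>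
     space \<nu> = char_space D \<and> sets \<nu> = constructibly_borel D \<and>
     (\<forall>D'. countably_generated_subalgebra D D' \<longrightarrow>
        (\<lambda>\<alpha>. restrict \<alpha> D') \<in> measurable \<nu> (borel_of_topology (char_topology D')) \<and>
        radon_measure (char_topology D')
          (distr \<nu> (borel_of_topology (char_topology D')) (\<lambda>\<alpha>. restrict \<alpha> D')))"

end

theory Submission
  imports "HOL-Probability.Projective_Limit" Defs
begin

text \<open>
  Character spaces of countably generated algebras are Polish, so all finite measures on them are Radon, and
  the constructibly Radon measures with finite mass are just the finite measures on the constructibly
  Borel sets. Uniqueness: the bounded elements of \<open>B\<close> form an algebra,
  and the indicator of \<open>f > 0\<close> is a bounded limit of polynomials in a bounded multiple of \<open>f\<close>.

  Existence: with \<open>u\<^sub>i = 1 / (1 + x\<^sub>i\<^sup>2)\<close> and \<open>s\<^sub>i = x\<^sub>i u\<^sub>i + 1 / 2\<close>, the elements \<open>u\<^sub>i\<close>, \<open>1 - u\<^sub>i\<close>, \<open>s\<^sub>i\<close>, \<open>1 - s\<^sub>i\<close> are sums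
  of squares, so \<open>L\<close> (normalized by \<open>L 1 = 1\<close>) assigns consistent probabilities to finite patterns of
  bits that behave like independent coin tosses with success probabilities \<open>u\<^sub>i\<close> and \<open>s\<^sub>i\<close>. By Kolmogorov's extension
  theorem and the \<open>L\<^sup>2\<close> law of large numbers, the limiting frequencies are random variables whose
  mixed moments are the values of \<open>L\<close> on products of the \<open>u\<^sub>i\<close> and \<open>s\<^sub>i\<close>. Almost surely they lie on the
  circle \<open>u\<^sup>2 + (s - 1 / 2)\<^sup>2 = u\<close> and off the point \<open>u = 0\<close>, because the geometric series of
  \<open>1 / u = \<Sum>k. (1 - u)\<^sup>k\<close> has expectation at most \<open>L (1 + x\<^sub>i\<^sup>2)\<close>; hence they determine a random point
  \<open>x\<close>, and the same series extends \<open>L f = E [f x]\<close> from the bounded elements to all of \<open>B\<close>.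
\<close>

section \<open>Generators and point evaluations of the localized polynomial algebra\<close>

text \<open>\<open>L\<close> is known to be nonnegative only on sums of squares, not on every
  element that is nonnegative as a function, so a Riesz-type representation would first require a
  positivity theorem for \<open>B\<close>; moreover the space of points is not locally compact when
  \<Omega> is infinite. Bits avoid both obstacles: positivity is needed only for products of factors
  \<open>g\<close> and \<open>1 - g\<close>, and consistency is nothing but
  \<open>g + (1 - g) = 1\<close>. Each variable needs two weights because \<open>u\<close>
  determines only the absolute value of \<open>x\<close>; the second weight carries the sign.
  Moments of the weights see only bounded elements, and mass might escape to infinity, that is, to
  \<open>u = 0\<close>; what prevents this is that the inverse \<open>t\<close> of a denominator
  \<open>w\<close> lies in \<open>B\<close> and is a sum of squares, so \<open>L t\<close> is a
  finite bound. Almost sure statements are made for one variable or one element of \<open>B\<close>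
  at a time, since exceptional sets cannot be united over an uncountable \<Omega>. This suffices
  because the constructibly Borel sets are generated by conditions on single elements.\<close>

lemma poly_mapping_decompose:
  "p = (\<Sum>m\<in>Poly_Mapping.keys p. Poly_Mapping.single m (Poly_Mapping.lookup p m))"
proof (rule poly_mapping_eqI)
  fix k
  have "Poly_Mapping.lookup (\<Sum>m\<in>Poly_Mapping.keys p. Poly_Mapping.single m (Poly_Mapping.lookup p m)) k
      = (\<Sum>m\<in>Poly_Mapping.keys p. if m = k then Poly_Mapping.lookup p k else 0)"
    unfolding lookup_sum by (intro sum.cong) (auto simp: lookup_single when_def)
  also have "\<dots> = Poly_Mapping.lookup p k"
    by (simp add: in_keys_iff del: lookup_not_eq_zero_eq_in_keys)
  finally show "Poly_Mapping.lookup p k = Poly_Mapping.lookup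
      (\<Sum>m\<in>Poly_Mapping.keys p. Poly_Mapping.single m (Poly_Mapping.lookup p m)) k" ..
qed

lemma subalgebraD:
  assumes "subalgebra S"
  shows "1 \<in> S" "a \<in> S \<Longrightarrow> b \<in> S \<Longrightarrow> a + b \<in> S" "a \<in> S \<Longrightarrow> b \<in> S \<Longrightarrow> a * b \<in> S"
    "a \<in> S \<Longrightarrow> c *\<^sub>R a \<in> S"
  using assms by (auto simp: subalgebra_def)

lemma subalgebra_more:
  assumes S: "subalgebra S"
  shows "0 \<in> S" "a \<in> S \<Longrightarrow> - a \<in> S" "a \<in> S \<Longrightarrow> b \<in> S \<Longrightarrow> a - b \<in> S" "a \<in> S \<Longrightarrow> a ^ n \<in> S"
    "c *\<^sub>R 1 \<in> S"
proof -
  show 0: "0 \<in> S"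
    using subalgebraD(4)[OF S subalgebraD(1)[OF S], of 0] by simp
  show minus: "- a \<in> S" if "a \<in> S" for a
    using subalgebraD(4)[OF S that, of "-1"] by simp
  show "a - b \<in> S" if "a \<in> S" "b \<in> S"
    using subalgebraD(2)[OF S that(1) minus[OF that(2)]] by simp
  show "a ^ n \<in> S" if "a \<in> S"
    by (induction n) (auto intro: subalgebraD[OF S] that)
  show "c *\<^sub>R 1 \<in> S"
    by (intro subalgebraD[OF S])
qed

lemma subalgebra_sum:
  assumes "subalgebra S" "\<And>i. i \<in> I \<Longrightarrow> f i \<in> S"
  shows "sum f I \<in> S"
  using assms(2) by (induction I rule: infinite_finite_induct)
    (auto intro: subalgebraD[OF assms(1)] subalgebra_more[OF assms(1)])

lemma subalgebra_prod:
  assumes "subalgebra S" "\<And>i. i \<in> I \<Longrightarrow> f i \<in> S"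
  shows "prod f I \<in> S"
  using assms(2) by (induction I rule: infinite_finite_induct)
    (auto intro: subalgebraD[OF assms(1)])

lemma subalgebra_hull: "subalgebra (subalgebra hull C)"
  by (rule hull_in) (auto simp: subalgebra_def)

section \<open>The generators \<open>x_i\<close> and \<open>u_i\<close> of the localized
  algebra\<close>

definition loc_x :: "'i \<Rightarrow> 'i loc" where
  "loc_x i = fraction (pvar i) 1"

definition loc_u :: "'i \<Rightarrow> 'i loc" where
  "loc_u i = fraction 1 (1 + (pvar i)\<^sup>2)"

lemma generator_UNIV: "1 + (pvar i)\<^sup>2 \<in> denoms UNIV"
  by (rule denoms.generator) simp

lemma loc_x_in: "i \<in> \<Omega> \<Longrightarrow> loc_x i \<in> B_loc \<Omega>"
  unfolding loc_x_def B_loc_def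
  by (rule CollectI, rule exI[of _ "pvar i"], rule exI[of _ 1]) (simp add: polys_on_pvar denoms.one)

lemma loc_u_in: "i \<in> \<Omega> \<Longrightarrow> loc_u i \<in> B_loc \<Omega>"
  unfolding loc_u_def B_loc_def
  by (rule CollectI, rule exI[of _ 1], rule exI[of _ "1 + (pvar i)\<^sup>2"]) (simp add: polys_on_one denoms.generator)

lemma fraction_one_add: "fraction (p + q) 1 = fraction p 1 + fraction q 1"
  by (simp only: add_frac denoms.one mult_1_left mult_1_right)

lemma fraction_one_mult: "fraction (p * q) 1 = fraction p 1 * fraction q 1"
  by (simp only: mult_frac denoms.one mult_1_left mult_1_right)

lemma loc_u_eq: "loc_u i * (1 + (loc_x i)\<^sup>2) = 1"
proof -
  have "1 + (loc_x i)\<^sup>2 = fraction (1 + (pvar i)\<^sup>2) 1"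
    by (simp only: fraction_one_add fraction_one_mult one_frac loc_x_def power2_eq_square)
  then have "loc_u i * (1 + (loc_x i)\<^sup>2) = fraction (1 * (1 + (pvar i)\<^sup>2)) ((1 + (pvar i)\<^sup>2) * 1)"
    by (simp only: loc_u_def mult_frac generator_UNIV denoms.one)
  also have "\<dots> = 1"
    by (simp only: mult_1_left mult_1_right one_frac fraction_eq_iff generator_UNIV denoms.one)
  finally show ?thesis .
qed

lemma fraction_pconst: "fraction (pconst c) 1 = c *\<^sub>R 1"
  by (simp only: one_frac scaleR_frac denoms.one mult_1_left mult_1_right)

lemma single_power: "Poly_Mapping.single (Poly_Mapping.single i n) 1 = pvar i ^ n"
proof (induction n)
  case (Suc n)
  have "Poly_Mapping.single (Poly_Mapping.single i (Suc n)) (1 :: real)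
      = Poly_Mapping.single (Poly_Mapping.single i 1 + Poly_Mapping.single i n) (1 * 1)"
    by (simp add: single_add[symmetric])
  then show ?case
    unfolding mult_single[symmetric] by (simp add: Suc pvar_def)
qed simp

lemma single_prod:
  "finite K \<Longrightarrow> Poly_Mapping.single (\<Sum>i\<in>K. Poly_Mapping.single i (e i)) 1 = (\<Prod>i\<in>K. pvar i ^ e i)"
proof (induction K rule: finite_induct)
  case (insert i K)
  have "Poly_Mapping.single (\<Sum>i\<in>insert i K. Poly_Mapping.single i (e i)) (1 :: real)
      = Poly_Mapping.single (Poly_Mapping.single i (e i) + (\<Sum>i\<in>K. Poly_Mapping.single i (e i))) (1 * 1)"
    using insert by simp
  also have "\<dots> = pvar i ^ e i * (\<Prod>i\<in>K. pvar i ^ e i)"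
    by (simp only: mult_single[symmetric] insert single_power)
  finally show ?case
    using insert by simp
qed simp

text \<open>Fractions with denominator 1 respect sums and products, and a polynomial is a finite sum
  of constants times products of variables.\<close>

lemma polys_on_subalgebra:
  assumes S: "subalgebra S" and x: "\<And>i. i \<in> \<Omega> \<Longrightarrow> loc_x i \<in> S" and p: "p \<in> polys_on \<Omega>"
  shows "fraction p 1 \<in> S"
proof -
  have sum: "fraction (sum h M) 1 = (\<Sum>m\<in>M. fraction (h m) 1)" for h :: "_ \<Rightarrow> 'a rpoly" and M :: "('a \<Rightarrow>\<^sub>0 nat) set"
    by (induction M rule: infinite_finite_induct) (auto simp: fraction_one_add zero_frac)
  have prod: "fraction (prod h M) 1 = (\<Prod>m\<in>M. fraction (h m) 1)" for h :: "_ \<Rightarrow> 'a rpoly" and M :: "'a set"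
    by (induction M rule: infinite_finite_induct) (auto simp: fraction_one_mult one_frac)
  have power: "fraction (pvar i ^ n) 1 = loc_x i ^ n" for i :: 'a and n
    by (induction n) (auto simp: fraction_one_mult one_frac loc_x_def)
  have "fraction (Poly_Mapping.single m c) 1 \<in> S" if m: "m \<in> Poly_Mapping.keys p" for m c
  proof -
    have "Poly_Mapping.single m c = Poly_Mapping.single (0 + m) (c * 1)"
      by simp
    also have "\<dots> = pconst c * Poly_Mapping.single m 1"
      unfolding mult_single[symmetric] by (simp add: pconst_def)
    also have "Poly_Mapping.single m 1 = (\<Prod>i\<in>Poly_Mapping.keys m. pvar i ^ Poly_Mapping.lookup m i)"
      using arg_cong[OF poly_mapping_decompose[of m], of "\<lambda>m. Poly_Mapping.single m (1 :: real)"]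
      by (simp only: single_prod finite_keys)
    finally have "fraction (Poly_Mapping.single m c) 1
        = c *\<^sub>R 1 * (\<Prod>i\<in>Poly_Mapping.keys m. loc_x i ^ Poly_Mapping.lookup m i)"
      by (simp only: fraction_one_mult prod power fraction_pconst)
    moreover have "i \<in> \<Omega>" if "i \<in> Poly_Mapping.keys m" for i
      using p m that by (auto simp: polys_on_def)
    ultimately show ?thesis
      by (metis (no_types, lifting) S x subalgebraD(3) subalgebra_more(4,5) subalgebra_prod)
  qed
  then have "fraction (\<Sum>m\<in>Poly_Mapping.keys p. Poly_Mapping.single m (Poly_Mapping.lookup p m)) 1 \<in> S"
    unfolding sum by (intro subalgebra_sum[OF S])
  then show ?thesis
    by (simp only: poly_mapping_decompose[symmetric])
qed

text \<open>Serves as the induction principle for the algebra: a property that holds at 1 and passes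
  to sums, products and multiples has to be checked only at \<open>loc_x i\<close> and
  \<open>loc_u i\<close>.\<close>

lemma B_loc_subset:
  assumes S: "subalgebra S"
    and x: "\<And>i. i \<in> \<Omega> \<Longrightarrow> loc_x i \<in> S" and u: "\<And>i. i \<in> \<Omega> \<Longrightarrow> loc_u i \<in> S"
  shows "B_loc \<Omega> \<subseteq> S"
proof
  fix f assume "f \<in> B_loc \<Omega>"
  then obtain p s where f: "f = fraction p s" and p: "p \<in> polys_on \<Omega>" and s: "s \<in> denoms \<Omega>"
    unfolding B_loc_def by blast
  have "fraction 1 s \<in> S"
    using s
  proof induction
    case one
    then show ?case using subalgebraD(1)[OF S] by (simp add: one_frac)
  next
    case (generator i)
    then show ?case using u by (simp add: loc_u_def)
  next
    case (mult s t)
    then have "fraction 1 (s * t) = fraction 1 s * fraction 1 t"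
      using denoms_mono[of _ \<Omega> UNIV] by (simp add: mult_frac)
    then show ?case using mult subalgebraD(3)[OF S] by simp
  qed
  moreover have "f = fraction p 1 * fraction 1 s"
    unfolding f using s denoms_mono[of _ \<Omega> UNIV] by (simp add: mult_frac denoms.one)
  ultimately show "f \<in> S"
    using polys_on_subalgebra[OF S x p] subalgebraD(3)[OF S] by simp
qed

section \<open>Point evaluations as characters of the localized algebra\<close>

definition poly_eval :: "('i \<Rightarrow> real) \<Rightarrow> 'i rpoly \<Rightarrow> real" where
  "poly_eval x p = (\<Sum>m\<in>Poly_Mapping.keys p.
     Poly_Mapping.lookup p m * (\<Prod>i\<in>Poly_Mapping.keys m. x i ^ Poly_Mapping.lookup m i))"

lemma poly_eval_superset:
  assumes "finite K" "Poly_Mapping.keys p \<subseteq> K"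
  shows "poly_eval x p = (\<Sum>m\<in>K. Poly_Mapping.lookup p m *
    (\<Prod>i\<in>Poly_Mapping.keys m. x i ^ Poly_Mapping.lookup m i))"
  unfolding poly_eval_def using assms
  by (intro sum.mono_neutral_left) (auto simp: in_keys_iff simp del: lookup_not_eq_zero_eq_in_keys)

lemma poly_eval_add: "poly_eval x (p + q) = poly_eval x p + poly_eval x q"
proof -
  let ?K = "Poly_Mapping.keys p \<union> Poly_Mapping.keys q"
  have "Poly_Mapping.keys (p + q) \<subseteq> ?K"
    by (rule Poly_Mapping.keys_add)
  then show ?thesis
    by (simp add: poly_eval_superset[where K = ?K] lookup_add algebra_simps sum.distrib)
qed

lemma poly_eval_sum: "poly_eval x (sum h M) = (\<Sum>m\<in>M. poly_eval x (h m))"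
proof -
  have "poly_eval x 0 = 0"
    by (simp add: poly_eval_def)
  then show ?thesis
    by (induction M rule: infinite_finite_induct) (auto simp: poly_eval_add)
qed

lemma poly_eval_single:
  "poly_eval x (Poly_Mapping.single m c)
     = c * (\<Prod>i\<in>Poly_Mapping.keys m. x i ^ Poly_Mapping.lookup m i)"
  by (simp add: poly_eval_superset[where K = "{m}"])

lemma monomial_eval_add:
  fixes x :: "'i \<Rightarrow> real"
  shows "(\<Prod>i\<in>Poly_Mapping.keys (m + n). x i ^ Poly_Mapping.lookup (m + n) i)
    = (\<Prod>i\<in>Poly_Mapping.keys m. x i ^ Poly_Mapping.lookup m i)
      * (\<Prod>i\<in>Poly_Mapping.keys n. x i ^ Poly_Mapping.lookup n i)"
proof -
  let ?K = "Poly_Mapping.keys m \<union> Poly_Mapping.keys n"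
  have sup: "(\<Prod>i\<in>Poly_Mapping.keys k. x i ^ Poly_Mapping.lookup k i)
      = (\<Prod>i\<in>?K. x i ^ Poly_Mapping.lookup k i)" if "Poly_Mapping.keys k \<subseteq> ?K" for k
    using that by (intro prod.mono_neutral_left) (auto simp: in_keys_iff simp del: lookup_not_eq_zero_eq_in_keys)
  show ?thesis
    unfolding sup[OF Poly_Mapping.keys_add] sup[OF Un_upper1] sup[OF Un_upper2]
    by (simp add: lookup_add power_add prod.distrib)
qed

lemma poly_eval_mult: "poly_eval x (p * q) = poly_eval x p * poly_eval x q"
proof -
  have "p * q = (\<Sum>m\<in>Poly_Mapping.keys p. Poly_Mapping.single m (Poly_Mapping.lookup p m))
      * (\<Sum>n\<in>Poly_Mapping.keys q. Poly_Mapping.single n (Poly_Mapping.lookup q n))"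
    by (simp only: poly_mapping_decompose[symmetric])
  also have "\<dots> = (\<Sum>m\<in>Poly_Mapping.keys p. \<Sum>n\<in>Poly_Mapping.keys q.
      Poly_Mapping.single (m + n) (Poly_Mapping.lookup p m * Poly_Mapping.lookup q n))"
    by (simp only: sum_product mult_single)
  finally have "poly_eval x (p * q) = (\<Sum>m\<in>Poly_Mapping.keys p. \<Sum>n\<in>Poly_Mapping.keys q.
      poly_eval x (Poly_Mapping.single (m + n) (Poly_Mapping.lookup p m * Poly_Mapping.lookup q n)))"
    by (simp only: poly_eval_sum)
  also have "\<dots> = poly_eval x p * poly_eval x q"
    unfolding poly_eval_def[of x p] poly_eval_def[of x q] sum_product
    by (intro sum.cong refl) (simp add: poly_eval_single monomial_eval_add)
  finally show ?thesis .
qed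

lemma poly_eval_pconst: "poly_eval x (pconst c) = c"
  by (simp add: pconst_def poly_eval_single)

lemma poly_eval_one: "poly_eval x 1 = 1"
  using poly_eval_pconst[of x 1] by (simp only: pconst_simps)

lemma poly_eval_pvar: "poly_eval x (pvar i) = x i"
  by (simp add: pvar_def poly_eval_single)

text \<open>Positive values of the denominators let evaluation at a point pass from polynomials to
  fractions.\<close>

lemma poly_eval_denoms_pos: "s \<in> denoms \<Omega> \<Longrightarrow> poly_eval x s > 0"
  by (induction rule: denoms.induct)
    (auto simp: poly_eval_one poly_eval_add poly_eval_mult poly_eval_pvar power2_eq_square
      intro: add_pos_nonneg)

lift_definition loc_eval :: "('i \<Rightarrow> real) \<Rightarrow> 'i loc \<Rightarrow> real"
  is "\<lambda>x a. poly_eval x (fst a) / poly_eval x (snd a)"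
proof -
  fix x :: "'i \<Rightarrow> real" and a b :: "'i rpoly \<times> 'i rpoly"
  assume "locrel a b"
  then have s: "snd a \<in> denoms UNIV" "snd b \<in> denoms UNIV" and eq: "fst a * snd b = fst b * snd a"
    by (simp_all add: locrel_iff)
  have "poly_eval x (snd a) \<noteq> 0" "poly_eval x (snd b) \<noteq> 0"
    using poly_eval_denoms_pos[OF s(1), of x] poly_eval_denoms_pos[OF s(2), of x] by auto
  moreover have "poly_eval x (fst a) * poly_eval x (snd b) = poly_eval x (fst b) * poly_eval x (snd a)"
    by (simp only: poly_eval_mult[symmetric] eq)
  ultimately show "poly_eval x (fst a) / poly_eval x (snd a) = poly_eval x (fst b) / poly_eval x (snd b)"
    by (simp add: field_simps)
qed

lemma loc_eval_frac: "s \<in> denoms UNIV \<Longrightarrow> loc_eval x (fraction p s) = poly_eval x p / poly_eval x s"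
  by (simp add: fraction_abs loc_eval.abs_eq locrel_refl)

lemma loc_eval_add: "loc_eval x (a + b) = loc_eval x a + loc_eval x b"
proof -
  obtain p s where a: "a = fraction p s" "s \<in> denoms UNIV" by (rule frac_cases)
  obtain q t where b: "b = fraction q t" "t \<in> denoms UNIV" by (rule frac_cases)
  have "poly_eval x s \<noteq> 0" "poly_eval x t \<noteq> 0"
    using poly_eval_denoms_pos[OF a(2), of x] poly_eval_denoms_pos[OF b(2), of x] by auto
  moreover have "loc_eval x (a + b) = (poly_eval x p * poly_eval x t + poly_eval x q * poly_eval x s)
      / (poly_eval x s * poly_eval x t)"
    by (simp only: a b add_frac denoms.mult loc_eval_frac poly_eval_add poly_eval_mult)
  ultimately show ?thesis
    unfolding a(1) b(1) loc_eval_frac[OF a(2)] loc_eval_frac[OF b(2)] by (simp add: field_simps)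
qed

lemma loc_eval_mult: "loc_eval x (a * b) = loc_eval x a * loc_eval x b"
proof -
  obtain p s where a: "a = fraction p s" "s \<in> denoms UNIV" by (rule frac_cases)
  obtain q t where b: "b = fraction q t" "t \<in> denoms UNIV" by (rule frac_cases)
  show ?thesis
    by (simp only: a b mult_frac denoms.mult loc_eval_frac poly_eval_mult times_divide_times_eq)
qed

lemma loc_eval_scaleR: "loc_eval x (c *\<^sub>R a) = c * loc_eval x a"
proof -
  obtain p s where a: "a = fraction p s" "s \<in> denoms UNIV" by (rule frac_cases)
  show ?thesis
    by (simp only: a scaleR_frac loc_eval_frac poly_eval_mult poly_eval_pconst times_divide_eq_right)
qed

lemma loc_eval_one: "loc_eval x 1 = 1"
proof -
  have "loc_eval x (fraction 1 1) = 1"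
    by (simp add: loc_eval_frac[OF denoms.one] poly_eval_one)
  then show ?thesis
    by (subst one_frac)
qed

lemma loc_eval_x: "loc_eval x (loc_x i) = x i"
  by (simp add: loc_x_def loc_eval_frac denoms.one poly_eval_pvar poly_eval_one)

lemma loc_eval_power2: "loc_eval x (a\<^sup>2) = (loc_eval x a)\<^sup>2"
  unfolding power2_eq_square by (rule loc_eval_mult)

lemma loc_eval_u: "loc_eval x (loc_u i) = 1 / (1 + (x i)\<^sup>2)"
proof -
  have "loc_eval x (loc_u i) * (1 + (x i)\<^sup>2) = loc_eval x (loc_u i * (1 + (loc_x i)\<^sup>2))"
    unfolding loc_eval_mult loc_eval_add loc_eval_one loc_eval_power2 loc_eval_x by (rule refl)
  also have "\<dots> = 1"
    unfolding loc_u_eq by (rule loc_eval_one)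
  finally have "loc_eval x (loc_u i) * (1 + (x i)\<^sup>2) = 1" .
  moreover have "1 + (x i)\<^sup>2 > 0"
    by (rule add_pos_nonneg) simp_all
  ultimately show ?thesis
    by (simp add: eq_divide_eq)
qed

lemma loc_eval_char: "restrict (loc_eval x) (B_loc \<Omega>) \<in> char_space (B_loc \<Omega>)"
proof -
  note B = subalgebraD[OF subalgebra_B_loc[of \<Omega>]]
  show ?thesis
    unfolding char_space_def
    by (intro CollectI conjI ballI restrict_extensional)
      (simp_all only: restrict_apply' B loc_eval_add loc_eval_mult loc_eval_one)
qed

section \<open>Characters and finite measures on character spaces\<close>

text \<open>Characters are only required to be ring homomorphisms; this makes them real-linear.
  Nonnegative reals are squares, so \<open>h\<close> is monotone, and it fixes the integers.\<close>

lemma real_ring_hom_id: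
  fixes h :: "real \<Rightarrow> real"
  assumes one: "h 1 = 1" and add: "\<And>x y. h (x + y) = h x + h y" and mult: "\<And>x y. h (x * y) = h x * h y"
  shows "h x = x"
proof -
  have zero: "h 0 = 0"
    using add[of 0 0] by simp
  have minus: "h (- x) = - h x" for x
    using add[of x "- x"] zero by simp
  have nat: "h (real n) = real n" for n
    by (induction n) (auto simp: zero one add)
  have int: "h (of_int k) = of_int k" for k
    by (cases k) (simp_all only: of_int_of_nat_eq nat of_int_minus minus)
  have mono: "h x \<le> h y" if "x \<le> y" for x y
  proof -
    have "h y - h x = h (sqrt (y - x) * sqrt (y - x))"
      using that add[of x "y - x"] by simp
    also have "\<dots> = (h (sqrt (y - x)))\<^sup>2"
      by (simp only: mult power2_eq_square)
    finally show ?thesis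
      by (metis diff_ge_0_iff_ge zero_le_power2)
  qed
  \<comment> \<open>Both \<open>n * x\<close> and its image lie between the same two consecutive
    integers.\<close>
  have "real n * \<bar>h x - x\<bar> \<le> 1" for n
  proof -
    let ?k = "\<lfloor>real n * x\<rfloor>"
    have "h (of_int ?k) \<le> h (real n * x)" "h (real n * x) \<le> h (of_int (?k + 1))"
      by (intro mono; linarith)+
    then have "of_int ?k \<le> real n * h x" "real n * h x \<le> of_int (?k + 1)"
      by (simp_all only: int mult nat)
    then have "\<bar>real n * h x - real n * x\<bar> \<le> 1"
      by linarith
    then show ?thesis
      by (simp add: abs_mult right_diff_distrib[symmetric])
  qed
  then have "\<not> 0 < \<bar>h x - x\<bar>"
    using reals_Archimedean3[of "\<bar>h x - x\<bar>"] by (metis not_less)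
  then show ?thesis
    by simp
qed

context
  fixes D :: "'a::{comm_ring_1, real_algebra_1} set" and \<alpha> :: "'a \<Rightarrow> real"
  assumes D: "subalgebra D" and \<alpha>: "\<alpha> \<in> char_space D"
begin

lemma char_one: "\<alpha> 1 = 1"
  and char_add: "a \<in> D \<Longrightarrow> b \<in> D \<Longrightarrow> \<alpha> (a + b) = \<alpha> a + \<alpha> b"
  and char_mult: "a \<in> D \<Longrightarrow> b \<in> D \<Longrightarrow> \<alpha> (a * b) = \<alpha> a * \<alpha> b"
  using \<alpha> by (auto simp: char_space_def)

lemma char_scaleR:
  assumes a: "a \<in> D"
  shows "\<alpha> (c *\<^sub>R a) = c * \<alpha> a"
proof -
  note S = subalgebraD[OF D]
  have id: "\<alpha> (c *\<^sub>R 1) = c" for c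
  proof (rule real_ring_hom_id)
    show "\<alpha> ((x + y) *\<^sub>R 1) = \<alpha> (x *\<^sub>R 1) + \<alpha> (y *\<^sub>R 1)" for x y
      unfolding scaleR_add_left by (intro char_add S)
    show "\<alpha> ((x * y) *\<^sub>R 1) = \<alpha> (x *\<^sub>R 1) * \<alpha> (y *\<^sub>R 1)" for x y
      by (subst char_mult[symmetric]) (auto intro: S simp: mult.commute)
  qed (simp add: char_one)
  have "\<alpha> (c *\<^sub>R a) = \<alpha> ((c *\<^sub>R 1) * a)"
    by simp
  also have "\<dots> = c * \<alpha> a"
    by (subst char_mult) (auto intro: S a simp: id)
  finally show ?thesis .
qed

lemma char_diff:
  assumes "a \<in> D" "b \<in> D"
  shows "\<alpha> (a - b) = \<alpha> a - \<alpha> b"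
proof -
  have "\<alpha> (a + (-1) *\<^sub>R b) = \<alpha> a + (-1) * \<alpha> b"
    using assms by (subst char_add) (auto simp only: char_scaleR intro: subalgebraD[OF D])
  then show ?thesis
    by simp
qed

lemma char_const: "\<alpha> (c *\<^sub>R 1) = c"
  using char_scaleR[of 1 c] subalgebraD(1)[OF D] by (simp add: char_one)

lemma char_sum: "(\<And>i. i \<in> I \<Longrightarrow> f i \<in> D) \<Longrightarrow> \<alpha> (sum f I) = (\<Sum>i\<in>I. \<alpha> (f i))"
proof (induction I rule: infinite_finite_induct)
  case (insert i I)
  then show ?case
    by (simp add: char_add subalgebra_sum[OF D])
qed (use char_scaleR[of 1 0] subalgebraD(1)[OF D] in auto)

lemma char_power2: "a \<in> D \<Longrightarrow> \<alpha> (a\<^sup>2) = (\<alpha> a)\<^sup>2"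
  by (simp add: power2_eq_square char_mult)

lemma char_restrict:
  assumes "subalgebra D'" "D' \<subseteq> D"
  shows "restrict \<alpha> D' \<in> char_space D'"
  using assms subalgebraD[OF assms(1)] unfolding char_space_def
  by (auto simp: char_one char_add char_mult subset_iff)

end

lemma hat_eq: "\<alpha> \<in> char_space D \<Longrightarrow> hat D a \<alpha> = \<alpha> a"
  by (simp add: hat_def)

lemma pos_set_eq: "pos_set D a = {\<alpha>\<in>char_space D. \<alpha> a > 0}"
  by (auto simp: pos_set_def hat_eq)

lemma space_constructibly_borel:
  assumes "sets \<nu> = constructibly_borel D"
  shows "space \<nu> = char_space D"
proof (rule sets_eq_imp_space_eq[of \<nu> "sigma (char_space D) {pos_set D a | a. a \<in> D}", THEN trans])
  have "{pos_set D a | a. a \<in> D} \<subseteq> Pow (char_space D)"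
    by (auto simp: pos_set_def)
  then show "sets \<nu> = sets (sigma (char_space D) {pos_set D a | a. a \<in> D})"
    by (simp add: assms constructibly_borel_def)
qed (simp add: space_measure_of_conv)

text \<open>The set where \<open>a\<close> exceeds \<open>r\<close> is the positivity set of
  \<open>a - r *\<^sub>R 1\<close>, hence a generator of the \<sigma>-algebra.\<close>

lemma measurable_char_apply:
  assumes D: "subalgebra D" and sets: "sets \<nu> = constructibly_borel D" and a: "a \<in> D"
  shows "(\<lambda>\<alpha>. \<alpha> a) \<in> borel_measurable \<nu>"
proof -
  have space: "space \<nu> = char_space D"
    using sets by (rule space_constructibly_borel)
  show ?thesis
    unfolding borel_measurable_iff_greater
  proof
    fix r
    have "{\<alpha> \<in> space \<nu>. r < \<alpha> a} = pos_set D (a - r *\<^sub>R 1)"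
      using a by (auto simp: space pos_set_eq char_diff[OF D] char_const[OF D] subalgebra_more[OF D])
    also have "\<dots> \<in> sets \<nu>"
    proof -
      have "a - r *\<^sub>R 1 \<in> D"
        by (intro subalgebra_more[OF D] a)
      then show ?thesis
        unfolding sets constructibly_borel_def by (intro sigma_sets.Basic CollectI) (rule exI, rule conjI[OF refl])
    qed
    finally show "{\<alpha> \<in> space \<nu>. r < \<alpha> a} \<in> sets \<nu>" .
  qed
qed

lemma topspace_char_topology:
  assumes "subalgebra D"
  shows "topspace (char_topology D) = char_space D"
proof -
  have "hat D 1 -` UNIV \<inter> char_space D \<in> {hat D a -` V \<inter> char_space D | a V. a \<in> D \<and> open V}"
    using subalgebraD(1)[OF assms] open_UNIV by blast
  then show ?thesis
    unfolding char_topology_def topology_generated_by_topspace by auto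
qed

section \<open>Character spaces of countably generated algebras\<close>

text \<open>
  A countably generated algebra has a Polish character space: the evaluations at the generators
  \<open>c n\<close> embed it into \<open>nat \<Rightarrow> real\<close>, and since every element of the algebra is
  evaluated by a continuous function of these coordinates, the image is closed.
\<close>

locale countably_generated =
  fixes c :: "nat \<Rightarrow> 'a::{comm_ring_1, real_algebra_1}"
begin

definition "A = subalgebra hull (range c)"

definition coords :: "('a \<Rightarrow> real) \<Rightarrow> nat \<Rightarrow> real" where
  "coords \<alpha> n = \<alpha> (c n)"

lemma subalgebra_A: "subalgebra A"
  unfolding A_def by (rule subalgebra_hull)

lemma c_in_A: "c n \<in> A"
  unfolding A_def by (rule hull_inc) simp

text \<open>The membership \<open>a \<in> A\<close> reappears in the conclusion for the sake of the
  induction over the hull: a character is known to be additive and multiplicative only on members of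
  \<open>A\<close>.\<close>

lemma continuous_coordinate_function:
  assumes "a \<in> A"
  shows "a \<in> A \<and> (\<exists>h :: (nat \<Rightarrow> real) \<Rightarrow> real. continuous_on UNIV h \<and> (\<forall>\<alpha>\<in>char_space A. \<alpha> a = h (coords \<alpha>)))"
    (is "?P a")
proof (rule hull_induct[of a subalgebra "range c" ?P])
  show "a \<in> subalgebra hull (range c)"
    using assms by (simp add: A_def)
  show "?P x" if "x \<in> range c" for x
  proof -
    from that obtain n where n: "x = c n" by (rule rangeE)
    have "continuous_on UNIV (\<lambda>y :: nat \<Rightarrow> real. y n)"
      by (rule continuous_on_product_coordinates)
    then show ?thesis
      unfolding n by (intro conjI c_in_A exI[of _ "\<lambda>y. y n"]) (simp_all add: coords_def)
  qed
  note A = subalgebraD[OF subalgebra_A] and char = char_one[OF subalgebra_A] char_add[OF subalgebra_A]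
    char_mult[OF subalgebra_A] char_scaleR[OF subalgebra_A]
  show "subalgebra {x. ?P x}"
    unfolding subalgebra_def
  proof (intro conjI ballI allI)
    show "1 \<in> {x. ?P x}"
      by (auto intro!: A exI[of _ "\<lambda>_. 1"] simp: char)
  next
    fix a b assume "a \<in> {x. ?P x}" "b \<in> {x. ?P x}"
    then obtain g h where a: "a \<in> A" "continuous_on UNIV g" "\<And>\<alpha>. \<alpha> \<in> char_space A \<Longrightarrow> \<alpha> a = g (coords \<alpha>)"
      and b: "b \<in> A" "continuous_on UNIV h" "\<And>\<alpha>. \<alpha> \<in> char_space A \<Longrightarrow> \<alpha> b = h (coords \<alpha>)"
      by blast
    show "a + b \<in> {x. ?P x}"
      by (intro CollectI conjI A a b exI[of _ "\<lambda>y. g y + h y"] continuous_intros)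
        (simp add: char a b)
    show "a * b \<in> {x. ?P x}"
      by (intro CollectI conjI A a b exI[of _ "\<lambda>y. g y * h y"] continuous_intros)
        (simp add: char a b)
  next
    fix r a assume "a \<in> {x. ?P x}"
    then obtain g where a: "a \<in> A" "continuous_on UNIV g" "\<And>\<alpha>. \<alpha> \<in> char_space A \<Longrightarrow> \<alpha> a = g (coords \<alpha>)"
      by blast
    show "r *\<^sub>R a \<in> {x. ?P x}"
      by (intro CollectI conjI A a exI[of _ "\<lambda>y. r * g y"] continuous_intros)
        (simp add: char a)
  qed
qed

text \<open>Determined only on the image of \<open>coords\<close>; elsewhere it is some continuous
  extension.\<close>

definition coord_fun :: "'a \<Rightarrow> (nat \<Rightarrow> real) \<Rightarrow> real" where
  "coord_fun a = (SOME h. continuous_on UNIV h \<and> (\<forall>\<alpha>\<in>char_space A. \<alpha> a = h (coords \<alpha>)))"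

lemma coord_fun:
  assumes "a \<in> A"
  shows "continuous_on UNIV (coord_fun a)" "\<alpha> \<in> char_space A \<Longrightarrow> coord_fun a (coords \<alpha>) = \<alpha> a"
  using someI_ex[OF continuous_coordinate_function[OF assms, THEN conjunct2]] unfolding coord_fun_def[symmetric]
  by auto

text \<open>A point \<open>y\<close> is in the image iff \<open>a |-> coord_fun a y\<close> is a
  character with coordinates \<open>y\<close>. These conditions are equations between continuous
  functions, whatever extensions were chosen off the image.\<close>

lemma closed_coords_image: "closed (coords ` char_space A)"
proof -
  define Z where "Z = {y. coord_fun 1 y = 1} \<inter> (\<Inter>n. {y. coord_fun (c n) y = y n}) \<inter>
    (\<Inter>a\<in>A. \<Inter>b\<in>A. {y. coord_fun (a + b) y = coord_fun a y + coord_fun b y} \<inter>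
      {y. coord_fun (a * b) y = coord_fun a y * coord_fun b y})"
  note A = subalgebraD[OF subalgebra_A] c_in_A
  have "closed Z"
    unfolding Z_def
    by (intro closed_Int closed_INT ballI closed_Collect_eq continuous_on_add continuous_on_mult
        continuous_on_const continuous_on_product_coordinates coord_fun A)
  have "coords \<alpha> \<in> Z" if \<alpha>: "\<alpha> \<in> char_space A" for \<alpha>
    unfolding Z_def
    by (auto simp: A coord_fun(2)[OF _ \<alpha>] char_one[OF subalgebra_A \<alpha>] char_add[OF subalgebra_A \<alpha>]
        char_mult[OF subalgebra_A \<alpha>]) (simp add: coords_def)
  moreover have "y \<in> coords ` char_space A" if "y \<in> Z" for y
  proof
    let ?\<alpha> = "\<lambda>a\<in>A. coord_fun a y"
    show "y = coords ?\<alpha>"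
      using that by (auto simp: coords_def Z_def A)
    show "?\<alpha> \<in> char_space A"
      using that by (auto simp: char_space_def Z_def A)
  qed
  ultimately have "Z = coords ` char_space A"
    by blast
  then show ?thesis
    using \<open>closed Z\<close> by simp
qed

text \<open>Every evaluation factors through a continuous function of the coordinates, so no open
  set is finer than what \<open>coords\<close> can see.\<close>

lemma openin_char_topology:
  assumes "openin (char_topology A) U"
  shows "\<exists>G. open G \<and> U = coords -` G \<inter> char_space A"
proof -
  have "generate_topology_on {hat A a -` V \<inter> char_space A | a V. a \<in> A \<and> open V} U"
    using assms unfolding char_topology_def by (simp add: openin_topology_generated_by_iff)
  then show ?thesis
  proof induction
    case Empty
    show ?case by (rule exI[of _ "{}"]) simp
  next
    case (Int a b)
    then obtain G H where "open G" "a = coords -` G \<inter> char_space A" "open H" "b = coords -` H \<inter> char_space A"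
      by blast
    then show ?case
      by (intro exI[of _ "G \<inter> H"]) auto
  next
    case (UN K)
    then have "\<forall>k\<in>K. \<exists>G. open G \<and> k = coords -` G \<inter> char_space A" by blast
    then obtain G where "\<And>k. k \<in> K \<Longrightarrow> open (G k) \<and> k = coords -` G k \<inter> char_space A" by metis
    then show ?case
      by (intro exI[of _ "\<Union>k\<in>K. G k"]) blast
  next
    case (Basis s)
    then obtain a V where s: "s = hat A a -` V \<inter> char_space A" and a: "a \<in> A" and V: "open V"
      by blast
    have "open (coord_fun a -` V)"
      using coord_fun(1)[OF a] V by (metis open_vimage)
    moreover have "s = coords -` (coord_fun a -` V) \<inter> char_space A"
      unfolding s using coord_fun(2)[OF a] by (auto simp: hat_eq)
    ultimately show ?case by blast
  qed
qed

lemma borel_of_char_topology: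
  "space (borel_of_topology (char_topology A)) = char_space A"
  "sets (borel_of_topology (char_topology A)) = sigma_sets (char_space A) {V. openin (char_topology A) V}"
proof -
  have "{V. openin (char_topology A) V} \<subseteq> Pow (topspace (char_topology A))"
    using openin_subset by blast
  then show "space (borel_of_topology (char_topology A)) = char_space A"
    "sets (borel_of_topology (char_topology A)) = sigma_sets (char_space A) {V. openin (char_topology A) V}"
    unfolding borel_of_topology_def using topspace_char_topology[OF subalgebra_A]
    by (simp_all add: space_measure_of_conv sets_measure_of_conv)
qed

lemma borel_set_coords:
  assumes "U \<in> sets (borel_of_topology (char_topology A))"
  shows "\<exists>G\<in>sets borel. U = coords -` G \<inter> char_space A"
  using assms unfolding borel_of_char_topology
proof induction
  case (Basic a)
  then have "openin (char_topology A) a" by simp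
  then obtain G where "open G" "a = coords -` G \<inter> char_space A"
    using openin_char_topology by blast
  then show ?case by (intro bexI[of _ G]) auto
next
  case Empty
  show ?case by (rule bexI[of _ "{}"]) auto
next
  case (Compl a)
  then obtain G where "G \<in> sets borel" "a = coords -` G \<inter> char_space A" by blast
  then show ?case by (intro bexI[of _ "- G"]) auto
next
  case (Union a)
  then have "\<forall>i. \<exists>G. G \<in> sets borel \<and> a i = coords -` G \<inter> char_space A" by blast
  then obtain G where G: "\<forall>i. G i \<in> sets borel \<and> a i = coords -` G i \<inter> char_space A"
    by (rule choice[THEN exE])
  show ?case
  proof (rule bexI[of _ "\<Union>i. G i"])
    show "(\<Union>i. a i) = coords -` (\<Union>i. G i) \<inter> char_space A"
      using G by blast
    show "(\<Union>i. G i) \<in> sets borel"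
      using G by (intro sets.countable_UN) auto
  qed
qed

lemma measurable_coords: "coords \<in> borel_measurable (borel_of_topology (char_topology A))"
proof (rule measurable_coordinatewise_then_product)
  fix n
  show "(\<lambda>\<alpha>. coords \<alpha> n) \<in> borel_measurable (borel_of_topology (char_topology A))"
  proof (rule borel_measurableI)
    fix V :: "real set" assume "open V"
    then have "openin (char_topology A) (hat A (c n) -` V \<inter> char_space A)"
      unfolding char_topology_def using c_in_A by (intro topology_generated_by_Basis) blast
    moreover have "hat A (c n) -` V \<inter> char_space A = (\<lambda>\<alpha>. coords \<alpha> n) -` V \<inter> char_space A"
      by (auto simp: hat_eq coords_def)
    ultimately show "(\<lambda>\<alpha>. coords \<alpha> n) -` V \<inter> space (borel_of_topology (char_topology A))
        \<in> sets (borel_of_topology (char_topology A))"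
      by (simp add: borel_of_char_topology sigma_sets.Basic)
  qed
qed

text \<open>Countable generation enters here: Borel sets are preimages of Borel sets of sequences,
  and measurability of a map into sequences can be tested on each coordinate.\<close>

lemma measurable_into_char_space:
  assumes r: "r \<in> space \<nu> \<rightarrow> char_space A" and m: "\<And>n. (\<lambda>x. r x (c n)) \<in> borel_measurable \<nu>"
  shows "r \<in> measurable \<nu> (borel_of_topology (char_topology A))"
proof (rule measurableI)
  have coords_r: "(\<lambda>x. coords (r x)) \<in> borel_measurable \<nu>"
    by (rule measurable_coordinatewise_then_product) (simp add: coords_def m)
  fix U assume "U \<in> sets (borel_of_topology (char_topology A))"
  then obtain G where G: "G \<in> sets borel" "U = coords -` G \<inter> char_space A"
    using borel_set_coords by blast
  then have "r -` U \<inter> space \<nu> = (\<lambda>x. coords (r x)) -` G \<inter> space \<nu>"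
    using r by auto
  then show "r -` U \<inter> space \<nu> \<in> sets \<nu>"
    using measurable_sets[OF coords_r G(1)] by simp
qed (use r in \<open>auto simp: borel_of_char_topology\<close>)

lemma compactin_coords_vimage:
  assumes K: "compact K" "K \<subseteq> coords ` char_space A"
  shows "compactin (char_topology A) (coords -` K \<inter> char_space A)"
  unfolding compactin_def topspace_char_topology[OF subalgebra_A]
proof (intro conjI allI impI)
  fix \<U> assume U: "(\<forall>U\<in>\<U>. openin (char_topology A) U) \<and> coords -` K \<inter> char_space A \<subseteq> \<Union>\<U>"
  then have "\<forall>U\<in>\<U>. \<exists>G. open G \<and> U = coords -` G \<inter> char_space A"
    using openin_char_topology by blast
  then obtain G where G: "\<And>U. U \<in> \<U> \<Longrightarrow> open (G U)" "\<And>U. U \<in> \<U> \<Longrightarrow> U = coords -` G U \<inter> char_space A"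
    by metis
  have "K \<subseteq> (\<Union>U\<in>\<U>. G U)"
  proof
    fix y assume "y \<in> K"
    then obtain \<alpha> where \<alpha>: "\<alpha> \<in> char_space A" "y = coords \<alpha>" using K by blast
    then obtain U where "U \<in> \<U>" "\<alpha> \<in> U" using U \<open>y \<in> K\<close> by blast
    then show "y \<in> (\<Union>U\<in>\<U>. G U)" using G(2) \<alpha> by blast
  qed
  then obtain \<F> where F: "\<F> \<subseteq> \<U>" "finite \<F>" "K \<subseteq> (\<Union>U\<in>\<F>. G U)"
    using compactE_image[OF K(1), of \<U> G] G(1) by metis
  have "coords -` K \<inter> char_space A \<subseteq> \<Union>\<F>"
  proof
    fix \<alpha> assume \<alpha>: "\<alpha> \<in> coords -` K \<inter> char_space A"
    then obtain U where "U \<in> \<F>" "coords \<alpha> \<in> G U" using F by blast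
    then show "\<alpha> \<in> \<Union>\<F>" using G(2)[of U] F(1) \<alpha> by blast
  qed
  then show "\<exists>\<F>. finite \<F> \<and> \<F> \<subseteq> \<U> \<and> coords -` K \<inter> char_space A \<subseteq> \<Union>\<F>"
    using F by blast
qed simp

text \<open>Finite Borel measures on the Polish space \<open>nat \<Rightarrow> real\<close> are
  inner regular, and \<open>coords\<close> transports this back.\<close>

lemma radon_distr:
  assumes fin: "finite_measure \<nu>" and r: "r \<in> measurable \<nu> (borel_of_topology (char_topology A))"
  shows "radon_measure (char_topology A) (distr \<nu> (borel_of_topology (char_topology A)) r)"
proof -
  interpret \<nu>: finite_measure \<nu> by fact
  let ?B = "borel_of_topology (char_topology A)"
  have coords_r: "(\<lambda>x. coords (r x)) \<in> borel_measurable \<nu>"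
    using r measurable_coords by (rule measurable_compose)
  define \<mu> where "\<mu> = distr \<nu> ?B r"
  define \<mu>' where "\<mu>' = distr \<nu> borel (\<lambda>x. coords (r x))"
  note top = topspace_char_topology[OF subalgebra_A]
  interpret \<mu>: finite_measure \<mu>
    unfolding \<mu>_def by (rule \<nu>.finite_measure_distr) fact
  interpret \<mu>': finite_measure \<mu>'
    unfolding \<mu>'_def by (rule \<nu>.finite_measure_distr) fact
  have r_space: "r x \<in> char_space A" if "x \<in> space \<nu>" for x
    using measurable_space[OF r that] by (simp add: borel_of_char_topology)
  have eq: "emeasure \<mu> U = emeasure \<mu>' G"
    if "U \<in> sets ?B" "G \<in> sets borel" "U = coords -` G \<inter> char_space A" for U G
  proof -
    have "emeasure \<mu> U = emeasure \<nu> (r -` U \<inter> space \<nu>)"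
      unfolding \<mu>_def using r that by (simp add: emeasure_distr)
    also have "r -` U \<inter> space \<nu> = (\<lambda>x. coords (r x)) -` G \<inter> space \<nu>"
      using that r_space by auto
    also have "emeasure \<nu> \<dots> = emeasure \<mu>' G"
      unfolding \<mu>'_def using coords_r that by (simp add: emeasure_distr)
    finally show ?thesis .
  qed
  have "emeasure \<mu> U = (SUP K\<in>{K. compactin (char_topology A) K \<and> K \<subseteq> U}. emeasure \<mu> K)"
    if U: "U \<in> sets \<mu>" for U
  proof (rule antisym)
    have U': "U \<in> sets ?B" using U by (simp add: \<mu>_def)
    obtain G where G: "G \<in> sets borel" "U = coords -` G \<inter> char_space A"
      using borel_set_coords[OF U'] by blast
    \<comment> \<open>Since the image of \<open>coords\<close> is closed, cutting down to it keeps
      the set Borel, and compact subsets of it have compact preimages.\<close>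
    let ?G = "G \<inter> coords ` char_space A"
    have G': "?G \<in> sets borel" "U = coords -` ?G \<inter> char_space A"
      using G closed_coords_image by auto
    have "emeasure \<mu> U = emeasure \<mu>' ?G"
      by (rule eq[OF U' G'])
    also have "\<dots> = (SUP K\<in>{K. K \<subseteq> ?G \<and> compact K}. emeasure \<mu>' K)"
      using G' by (intro inner_regular) (simp_all add: \<mu>'_def \<mu>'.emeasure_finite[unfolded \<mu>'_def])
    also have "\<dots> \<le> (SUP K\<in>{K. compactin (char_topology A) K \<and> K \<subseteq> U}. emeasure \<mu> K)"
    proof (rule SUP_mono)
      fix K assume "K \<in> {K. K \<subseteq> ?G \<and> compact K}"
      then have K: "compact K" "K \<subseteq> coords ` char_space A" "K \<subseteq> G" by auto
      let ?K = "coords -` K \<inter> char_space A"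
      have "closed K" using K compact_imp_closed by blast
      have "?K \<in> sets ?B"
        using measurable_sets[OF measurable_coords, of K] \<open>closed K\<close> by (simp add: borel_of_char_topology)
      then have "emeasure \<mu>' K = emeasure \<mu> ?K"
        using \<open>closed K\<close> by (intro eq[symmetric]) auto
      moreover have "compactin (char_topology A) ?K" "?K \<subseteq> U"
        using compactin_coords_vimage[OF K(1,2)] K G by auto
      ultimately show "\<exists>K'\<in>{K. compactin (char_topology A) K \<and> K \<subseteq> U}. emeasure \<mu>' K \<le> emeasure \<mu> K'"
        by (intro bexI[of _ ?K]) auto
    qed
    finally show "emeasure \<mu> U \<le> (SUP K\<in>{K. compactin (char_topology A) K \<and> K \<subseteq> U}. emeasure \<mu> K)" .
    show "(SUP K\<in>{K. compactin (char_topology A) K \<and> K \<subseteq> U}. emeasure \<mu> K) \<le> emeasure \<mu> U"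
      using U by (intro SUP_least emeasure_mono) auto
  qed
  moreover have "\<exists>V. openin (char_topology A) V \<and> \<alpha> \<in> V \<and> emeasure \<mu> V < \<infinity>"
    if "\<alpha> \<in> topspace (char_topology A)" for \<alpha>
    using that \<mu>.emeasure_finite[of "topspace (char_topology A)"]
    by (intro exI[of _ "topspace (char_topology A)"]) (auto simp flip: less_top)
  ultimately show ?thesis
    unfolding radon_measure_def \<mu>_def[symmetric]
    by (simp add: top borel_of_char_topology) (simp add: \<mu>_def borel_of_char_topology)
qed

end

lemma finite_measure_constructibly_radon:
  assumes D: "subalgebra D" and sets: "sets \<nu> = constructibly_borel D" and fin: "finite_measure \<nu>"
  shows "constructibly_radon D \<nu>"
  unfolding constructibly_radon_def
proof (intro conjI allI impI)
  show space: "space \<nu> = char_space D"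
    by (rule space_constructibly_borel) fact
  fix D' assume "countably_generated_subalgebra D D'"
  then obtain C where C: "countable C" "C \<subseteq> D" and D': "D' = subalgebra hull C"
    unfolding countably_generated_subalgebra_def by blast
  \<comment> \<open>Adding 1 makes the set of generators nonempty, hence enumerable by
    \<open>nat\<close>, and leaves the hull unchanged.\<close>
  define c where "c = from_nat_into (insert 1 C)"
  have c: "range c = insert 1 C"
    unfolding c_def using C(1) by (intro range_from_nat_into) auto
  interpret countably_generated c .
  have "subalgebra hull (insert 1 C) = subalgebra hull C"
  proof (rule hull_unique)
    show "insert 1 C \<subseteq> subalgebra hull C"
      using hull_subset[of C subalgebra] subalgebraD(1)[OF subalgebra_hull] by blast
    show "subalgebra (subalgebra hull C)"
      by (rule subalgebra_hull)
    show "subalgebra hull C \<subseteq> S" if "insert 1 C \<subseteq> S" "subalgebra S" for S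
      using that by (intro hull_minimal) auto
  qed
  then have A: "A = D'"
    unfolding A_def c D' .
  have "A \<subseteq> D"
    unfolding A D' using C(2) D by (rule hull_minimal)
  have r: "(\<lambda>\<alpha>. restrict \<alpha> D') \<in> measurable \<nu> (borel_of_topology (char_topology A))"
  proof (rule measurable_into_char_space)
    show "(\<lambda>\<alpha>. restrict \<alpha> D') \<in> space \<nu> \<rightarrow> char_space A"
      using char_restrict[OF D _ subalgebra_A \<open>A \<subseteq> D\<close>] unfolding space A by blast
    show "(\<lambda>\<alpha>. restrict \<alpha> D' (c n)) \<in> borel_measurable \<nu>" for n
      using measurable_char_apply[OF D sets, of "c n"] c_in_A[of n] \<open>A \<subseteq> D\<close> by (auto simp: A)
  qed
  show "(\<lambda>\<alpha>. restrict \<alpha> D') \<in> measurable \<nu> (borel_of_topology (char_topology D'))"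
    using r unfolding A .
  show "radon_measure (char_topology D')
      (distr \<nu> (borel_of_topology (char_topology D')) (\<lambda>\<alpha>. restrict \<alpha> D'))"
    using radon_distr[OF fin r] unfolding A .
qed fact

lemma integral_psd_functional:
  assumes D: "subalgebra D" and space: "space \<nu> = char_space D"
    and int: "\<And>f. f \<in> D \<Longrightarrow> integrable \<nu> (hat D f)"
  shows "(\<lambda>f\<in>D. integral\<^sup>L \<nu> (hat D f)) \<in> psd_functionals D"
proof -
  note S = subalgebraD[OF D]
  have "integral\<^sup>L \<nu> (hat D (a + b)) = integral\<^sup>L \<nu> (hat D a) + integral\<^sup>L \<nu> (hat D b)"
    if "a \<in> D" "b \<in> D" for a b
  proof -
    have "integral\<^sup>L \<nu> (hat D (a + b)) = (\<integral>\<alpha>. hat D a \<alpha> + hat D b \<alpha> \<partial>\<nu>)"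
      using that by (intro Bochner_Integration.integral_cong refl) (simp add: space hat_eq char_add[OF D])
    then show ?thesis
      by (simp add: Bochner_Integration.integral_add int that)
  qed
  moreover have "integral\<^sup>L \<nu> (hat D (r *\<^sub>R a)) = r * integral\<^sup>L \<nu> (hat D a)" if "a \<in> D" for r a
  proof -
    have "integral\<^sup>L \<nu> (hat D (r *\<^sub>R a)) = (\<integral>\<alpha>. r * hat D a \<alpha> \<partial>\<nu>)"
      using that by (intro Bochner_Integration.integral_cong refl) (simp add: space hat_eq char_scaleR[OF D])
    then show ?thesis
      by simp
  qed
  moreover have "0 \<le> integral\<^sup>L \<nu> (hat D b)" and "b \<in> D" if sos: "b \<in> sums_of_squares D" for b
  proof -
    obtain g and n :: nat where b: "b = (\<Sum>k<n. (g k)\<^sup>2)" and g: "\<And>k. k < n \<Longrightarrow> g k \<in> D"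
      using sos unfolding sums_of_squares_def by blast
    show "b \<in> D"
      unfolding b using g by (intro subalgebra_sum[OF D] subalgebra_more[OF D]) auto
    have "hat D b \<alpha> \<ge> 0" if \<alpha>: "\<alpha> \<in> char_space D" for \<alpha>
    proof -
      have "\<alpha> b = (\<Sum>k<n. \<alpha> ((g k)\<^sup>2))"
        unfolding b using g by (intro char_sum[OF D \<alpha>] subalgebra_more[OF D]) auto
      also have "\<dots> = (\<Sum>k<n. (\<alpha> (g k))\<^sup>2)"
        using g by (intro sum.cong refl char_power2[OF D \<alpha>]) auto
      finally show ?thesis
        using \<alpha> by (simp add: hat_eq sum_nonneg)
    qed
    then show "0 \<le> integral\<^sup>L \<nu> (hat D b)"
      by (intro Bochner_Integration.integral_nonneg) (simp add: space)
  qed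
  ultimately show ?thesis
    unfolding psd_functionals_def by (simp add: S)
qed

section \<open>Measures determined by the integrals of bounded elements\<close>

text \<open>Weierstrass approximation of \<open>min 1 (max 0 (n * t))\<close>.\<close>

lemma indicator_pos_polynomial_limit:
  obtains q :: "nat \<Rightarrow> real \<Rightarrow> real" where "\<And>n. real_polynomial_function (q n)"
    "\<And>n t. \<bar>t\<bar> \<le> 1 \<Longrightarrow> \<bar>q n t\<bar> \<le> 2" "\<And>t. \<bar>t\<bar> \<le> 1 \<Longrightarrow> (\<lambda>n. q n t) \<longlonglongrightarrow> (if t > 0 then 1 else 0)"
proof -
  define h :: "nat \<Rightarrow> real \<Rightarrow> real" where "h n t = min 1 (max 0 (real n * t))" for n t
  have "\<exists>q. real_polynomial_function q \<and> (\<forall>t\<in>{-1..1}. \<bar>h n t - q t\<bar> < 1 / Suc n)" for n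
  proof -
    have "continuous_on {-1..1} (h n)"
      unfolding h_def by (intro continuous_intros)
    then obtain q where "real_polynomial_function q" "\<And>t. t \<in> {-1..1} \<Longrightarrow> \<bar>h n t - q t\<bar> < 1 / Suc n"
      using Stone_Weierstrass_real_polynomial_function[of "{-1..1}" "h n" "1 / Suc n"] by auto
    then show ?thesis by blast
  qed
  then obtain q where q: "\<And>n. real_polynomial_function (q n)"
    "\<And>n t. t \<in> {-1..1} \<Longrightarrow> \<bar>h n t - q n t\<bar> < 1 / Suc n"
    by metis
  have h01: "0 \<le> h n t" "h n t \<le> 1" for n t
    by (auto simp: h_def)
  show thesis
  proof
    show "real_polynomial_function (q n)" for n by (rule q)
    show "\<bar>q n t\<bar> \<le> 2" if "\<bar>t\<bar> \<le> 1" for n t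
    proof -
      \<comment> \<open>The bound 2 is the maximum 1 of \<open>h\<close> plus an error of at most
        1.\<close>
      have "1 / real (Suc n) \<le> 1" by simp
      moreover have "\<bar>h n t - q n t\<bar> < 1 / Suc n" using that by (intro q) auto
      ultimately show ?thesis using h01[of n t] by linarith
    qed
    show "(\<lambda>n. q n t) \<longlonglongrightarrow> (if t > 0 then 1 else 0)" if t: "\<bar>t\<bar> \<le> 1" for t
    proof -
      have "(\<lambda>n. h n t) \<longlonglongrightarrow> (if t > 0 then 1 else 0)"
      proof (cases "t > 0")
        case True
        obtain N where N: "1 < real N * t" using reals_Archimedean3[OF True] by blast
        have "h n t = 1" if "n \<ge> N" for n
        proof -
          have "real N * t \<le> real n * t" using that True by (intro mult_right_mono) auto
          then show ?thesis using N by (simp add: h_def)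
        qed
        then have "eventually (\<lambda>n. h n t = 1) sequentially"
          by (auto simp: eventually_sequentially)
        then show ?thesis using True by (simp add: tendsto_eventually)
      next
        case False
        then have "h n t = 0" for n by (simp add: h_def mult_nonneg_nonpos)
        then show ?thesis using False by simp
      qed
      moreover have "(\<lambda>n. h n t - q n t) \<longlonglongrightarrow> 0"
      proof (rule Lim_null_comparison)
        show "eventually (\<lambda>n. norm (h n t - q n t) \<le> 1 / Suc n) sequentially"
        proof (intro always_eventually allI)
          fix n
          have "\<bar>h n t - q n t\<bar> < 1 / Suc n" using t by (intro q) auto
          then show "norm (h n t - q n t) \<le> 1 / Suc n" by simp
        qed
        show "(\<lambda>n. 1 / real (Suc n)) \<longlonglongrightarrow> 0"
          by (rule LIMSEQ_Suc[OF lim_1_over_n])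
      qed
      ultimately have "(\<lambda>n. h n t - (h n t - q n t)) \<longlonglongrightarrow> (if t > 0 then 1 else 0) - 0"
        by (rule tendsto_diff)
      then show ?thesis by simp
    qed
  qed
qed

text \<open>The element \<open>b\<close> plays the role of \<open>q\<close> applied to
  \<open>a\<close>; it is built along the inductive definition of polynomial functions. With
  \<open>S\<close> the bounded elements, the result is bounded again.\<close>

lemma real_polynomial_function_compose_char:
  assumes D: "subalgebra D" and S: "subalgebra S" "S \<subseteq> D" and a: "a \<in> S"
    and q: "real_polynomial_function (q :: real \<Rightarrow> real)"
  shows "\<exists>b\<in>S. \<forall>\<alpha>\<in>char_space D. \<alpha> b = q (\<alpha> a)"
  using q
proof induction
  case (linear f)
  have f: "f x = f 1 * x" for x
    using linear_simps(5)[OF linear, of x 1] by simp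
  show ?case
  proof (intro bexI ballI)
    show "f 1 *\<^sub>R a \<in> S" by (intro subalgebraD(4)[OF S(1)] a)
    show "\<alpha> (f 1 *\<^sub>R a) = f (\<alpha> a)" if "\<alpha> \<in> char_space D" for \<alpha>
      using char_scaleR[OF D that, of a "f 1"] a S(2) f[of "\<alpha> a", symmetric] by auto
  qed
next
  case (const c)
  then show ?case
    using S by (intro bexI[of _ "c *\<^sub>R 1"] subalgebra_more) (auto simp: char_const[OF D])
next
  case (add f g)
  then obtain b b' where "b \<in> S" "b' \<in> S" "\<forall>\<alpha>\<in>char_space D. \<alpha> b = f (\<alpha> a)" "\<forall>\<alpha>\<in>char_space D. \<alpha> b' = g (\<alpha> a)"
    by blast
  then show ?case
    using S by (intro bexI[of _ "b + b'"] subalgebraD) (auto simp: char_add[OF D] subset_iff)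
next
  case (mult f g)
  then obtain b b' where "b \<in> S" "b' \<in> S" "\<forall>\<alpha>\<in>char_space D. \<alpha> b = f (\<alpha> a)" "\<forall>\<alpha>\<in>char_space D. \<alpha> b' = g (\<alpha> a)"
    by blast
  then show ?case
    using S by (intro bexI[of _ "b * b'"] subalgebraD) (auto simp: char_mult[OF D] subset_iff)
qed

definition bounded_elements :: "'a::{comm_ring_1, real_algebra_1} set \<Rightarrow> 'a set" where
  "bounded_elements D = {a\<in>D. \<exists>C. \<forall>\<alpha>\<in>char_space D. \<bar>\<alpha> a\<bar> \<le> C}"

lemma subalgebra_bounded_elements:
  assumes D: "subalgebra D"
  shows "subalgebra (bounded_elements D)"
  unfolding subalgebra_def
proof (intro conjI ballI allI)
  note S = subalgebraD[OF D]
  show "1 \<in> bounded_elements D"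
    unfolding bounded_elements_def by (auto simp: S char_one[OF D] intro!: exI[of _ 1])
  fix a b c assume "a \<in> bounded_elements D"
  then obtain C where a: "a \<in> D" "\<And>\<alpha>. \<alpha> \<in> char_space D \<Longrightarrow> \<bar>\<alpha> a\<bar> \<le> C"
    unfolding bounded_elements_def by blast
  show "c *\<^sub>R a \<in> bounded_elements D"
    unfolding bounded_elements_def
    by (auto simp: S a char_scaleR[OF D] abs_mult intro!: exI[of _ "\<bar>c\<bar> * C"] mult_left_mono)
  assume "b \<in> bounded_elements D"
  then obtain C' where b: "b \<in> D" "\<And>\<alpha>. \<alpha> \<in> char_space D \<Longrightarrow> \<bar>\<alpha> b\<bar> \<le> C'"
    unfolding bounded_elements_def by blast
  have "\<bar>\<alpha> (a + b)\<bar> \<le> C + C'" if "\<alpha> \<in> char_space D" for \<alpha>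
    using a(2)[OF that] b(2)[OF that] by (simp add: char_add[OF D that] a b)
  then show "a + b \<in> bounded_elements D"
    unfolding bounded_elements_def using S a b by auto
  have "\<bar>\<alpha> (a * b)\<bar> \<le> C * C'" if "\<alpha> \<in> char_space D" for \<alpha>
    using mult_mono'[OF a(2)[OF that] b(2)[OF that]] by (simp add: char_mult[OF D that] a b abs_mult)
  then show "a * b \<in> bounded_elements D"
    unfolding bounded_elements_def using S a b by auto
qed

text \<open>Finite intersections of positivity sets form a \<pi>-system generating the
  \<sigma>-algebra. The indicator of such an intersection is a product, whose factors are replaced
  by bounded elements one at a time, each by dominated convergence.\<close>

lemma constructible_measure_eqI:
  assumes D: "subalgebra D" and fin: "finite_measure \<mu>" "finite_measure \<nu>"
    and sets: "sets \<mu> = constructibly_borel D" "sets \<nu> = constructibly_borel D"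
    and denominator: "\<And>a. a \<in> D \<Longrightarrow> \<exists>w\<in>D. (\<forall>\<alpha>\<in>char_space D. \<alpha> w > 0) \<and> a * w \<in> bounded_elements D"
    and eq: "\<And>a. a \<in> bounded_elements D \<Longrightarrow> (\<integral>\<alpha>. \<alpha> a \<partial>\<mu>) = (\<integral>\<alpha>. \<alpha> a \<partial>\<nu>)"
  shows "\<mu> = \<nu>"
proof -
  let ?X = "char_space D" and ?A = "bounded_elements D"
  note A = subalgebra_bounded_elements[OF D]
  have AD: "?A \<subseteq> D" by (auto simp: bounded_elements_def)
  have space: "space \<mu> = ?X" "space \<nu> = ?X"
    using sets by (simp_all add: space_constructibly_borel)
  obtain q :: "nat \<Rightarrow> real \<Rightarrow> real" where q: "\<And>n. real_polynomial_function (q n)"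
    "\<And>n t. \<bar>t\<bar> \<le> 1 \<Longrightarrow> \<bar>q n t\<bar> \<le> 2" "\<And>t. \<bar>t\<bar> \<le> 1 \<Longrightarrow> (\<lambda>n. q n t) \<longlonglongrightarrow> (if t > 0 then 1 else 0)"
    by (rule indicator_pos_polynomial_limit, rule that)
  have normalize: "\<exists>a'\<in>?A. pos_set D a' = pos_set D a \<and> (\<forall>\<alpha>\<in>?X. \<bar>\<alpha> a'\<bar> \<le> 1)" if a: "a \<in> D" for a
  proof -
    from denominator[OF a] obtain w where w: "w \<in> D" "\<forall>\<alpha>\<in>?X. \<alpha> w > 0" "a * w \<in> ?A"
      by (elim bexE conjE)
    from w(3) obtain C where "\<forall>\<alpha>\<in>?X. \<bar>\<alpha> (a * w)\<bar> \<le> C"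
      unfolding bounded_elements_def by (elim CollectE conjE exE)
    then have C: "\<bar>\<alpha> (a * w)\<bar> \<le> max 1 C" if "\<alpha> \<in> ?X" for \<alpha>
      using that by (meson max.cobounded2 order_trans)
    \<comment> \<open>Multiplying by the positive \<open>w\<close> and dividing by
      \<open>max 1 C\<close>, which is positive whatever \<open>C\<close> is, keeps the positivity
      set and brings the values into [-1, 1], where the polynomials converge.\<close>
    let ?a = "(1 / max 1 C) *\<^sub>R (a * w)"
    have app: "\<alpha> ?a = (\<alpha> a * \<alpha> w) / max 1 C" if "\<alpha> \<in> ?X" for \<alpha>
      using that a w(1) by (simp add: char_scaleR[OF D] char_mult[OF D] subalgebraD[OF D])
    show ?thesis
    proof (intro bexI[of _ ?a] conjI ballI)
      show "?a \<in> ?A" using w(3) by (rule subalgebraD(4)[OF A])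
      show "pos_set D ?a = pos_set D a"
      proof -
        have "0 < \<alpha> ?a \<longleftrightarrow> 0 < \<alpha> a" if "\<alpha> \<in> ?X" for \<alpha>
        proof -
          have "\<alpha> w > 0" "max 1 C > 0" using w(2) that by auto
          then show ?thesis unfolding app[OF that] by (simp add: zero_less_divide_iff zero_less_mult_iff)
        qed
        then show ?thesis unfolding pos_set_eq by blast
      qed
      show "\<bar>\<alpha> ?a\<bar> \<le> 1" if "\<alpha> \<in> ?X" for \<alpha>
        using C[OF that] that a w(1) by (simp add: app char_mult[OF D] abs_mult divide_le_eq)
    qed
  qed
  define \<Phi> where "\<Phi> F b \<alpha> = indicator (?X \<inter> (\<Inter>a\<in>F. pos_set D a)) \<alpha> * \<alpha> b"
    for F and b :: 'a and \<alpha> :: "'a \<Rightarrow> real"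
  have meas: "(\<lambda>\<alpha>. \<alpha> a) \<in> borel_measurable \<rho>" if "sets \<rho> = constructibly_borel D" "a \<in> D" for a \<rho>
    by (rule measurable_char_apply[OF D that])
  have pos_sets: "pos_set D a \<in> constructibly_borel D" if "a \<in> D" for a
    unfolding constructibly_borel_def using that by (intro sigma_sets.Basic) auto
  have E_sets: "?X \<inter> (\<Inter>a\<in>F. pos_set D a) \<in> sets \<rho>"
    if "finite F" "F \<subseteq> D" "sets \<rho> = constructibly_borel D" for F \<rho>
    using that(1,2)
  proof (induction F rule: finite_induct)
    case empty
    then show ?case using sets.top[of \<rho>] space_constructibly_borel[OF that(3)] by simp
  next
    case (insert a F)
    have "pos_set D a \<inter> (?X \<inter> (\<Inter>a\<in>F. pos_set D a)) \<in> sets \<rho>"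
      using insert pos_sets[of a] unfolding that(3)[symmetric] by (auto intro: sets.Int)
    also have "pos_set D a \<inter> (?X \<inter> (\<Inter>a\<in>F. pos_set D a)) = ?X \<inter> (\<Inter>a\<in>insert a F. pos_set D a)"
      by auto
    finally show ?case .
  qed
  have \<Phi>_meas: "\<Phi> F b \<in> borel_measurable \<rho>"
    if "finite F" "F \<subseteq> D" "sets \<rho> = constructibly_borel D" "b \<in> D" for F \<rho> b
    unfolding \<Phi>_def using E_sets[OF that(1-3)] meas[OF that(3,4)] by simp
  have step: "(\<lambda>n. \<integral>\<alpha>. \<Phi> F (c n * b) \<alpha> \<partial>\<rho>) \<longlonglongrightarrow> (\<integral>\<alpha>. \<Phi> (insert a F) b \<alpha> \<partial>\<rho>)"
    if \<rho>: "finite_measure \<rho>" "sets \<rho> = constructibly_borel D" and F: "finite F" "F \<subseteq> D" "a \<in> D" and b: "b \<in> ?A"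
      and a': "pos_set D a' = pos_set D a" "\<forall>\<alpha>\<in>?X. \<bar>\<alpha> a'\<bar> \<le> 1" "a' \<in> D"
      and c: "\<And>n. c n \<in> ?A" "\<And>n \<alpha>. \<alpha> \<in> ?X \<Longrightarrow> \<alpha> (c n) = q n (\<alpha> a')"
    for \<rho> F a a' b c
  proof -
    have sp: "space \<rho> = ?X" by (rule space_constructibly_borel) fact
    obtain C where C: "\<And>\<alpha>. \<alpha> \<in> ?X \<Longrightarrow> \<bar>\<alpha> b\<bar> \<le> C"
      using b unfolding bounded_elements_def by blast
    have cb: "c n * b \<in> D" "c n \<in> D" "b \<in> D" for n
      using c(1)[of n] b AD subalgebraD(3)[OF D] by auto
    have val: "\<Phi> F (c n * b) \<alpha> = q n (\<alpha> a') * \<Phi> F b \<alpha>" if "\<alpha> \<in> ?X" for n \<alpha>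
      using that by (simp add: \<Phi>_def char_mult[OF D] cb c)
    show ?thesis
    proof (rule integral_dominated_convergence[where w = "\<lambda>_. 2 * C"])
      show "\<Phi> (insert a F) b \<in> borel_measurable \<rho>"
        using F cb by (intro \<Phi>_meas \<rho>) auto
      show "\<Phi> F (c n * b) \<in> borel_measurable \<rho>" for n
        using F cb by (intro \<Phi>_meas \<rho>) auto
      show "integrable \<rho> (\<lambda>_. 2 * C)"
        using \<rho>(1) by (rule finite_measure.integrable_const)
      show "AE \<alpha> in \<rho>. (\<lambda>n. \<Phi> F (c n * b) \<alpha>) \<longlonglongrightarrow> \<Phi> (insert a F) b \<alpha>"
      proof (rule AE_I2)
        fix \<alpha> assume "\<alpha> \<in> space \<rho>"
        then have \<alpha>: "\<alpha> \<in> ?X" by (simp add: sp)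
        have ind: "(if \<alpha> a' > 0 then 1 else 0) = (indicator (pos_set D a) \<alpha> :: real)"
          using \<alpha> unfolding a'(1)[symmetric] by (auto simp: pos_set_eq)
        have "(\<lambda>n. q n (\<alpha> a') * \<Phi> F b \<alpha>) \<longlonglongrightarrow> indicator (pos_set D a) \<alpha> * \<Phi> F b \<alpha>"
          using a'(2) \<alpha> unfolding ind[symmetric] by (intro tendsto_intros q) auto
        moreover have "indicator (pos_set D a) \<alpha> * \<Phi> F b \<alpha> = \<Phi> (insert a F) b \<alpha>"
          by (simp add: \<Phi>_def indicator_def)
        ultimately show "(\<lambda>n. \<Phi> F (c n * b) \<alpha>) \<longlonglongrightarrow> \<Phi> (insert a F) b \<alpha>"
          by (simp add: val \<alpha>)
      qed
      show "AE \<alpha> in \<rho>. norm (\<Phi> F (c n * b) \<alpha>) \<le> 2 * C" for n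
      proof (rule AE_I2)
        fix \<alpha> assume "\<alpha> \<in> space \<rho>"
        then have \<alpha>: "\<alpha> \<in> ?X" by (simp add: sp)
        have "\<bar>\<Phi> F b \<alpha>\<bar> \<le> C"
          using C[OF \<alpha>] by (auto simp: \<Phi>_def indicator_def intro: order_trans[OF abs_ge_zero])
        then have "\<bar>q n (\<alpha> a')\<bar> * \<bar>\<Phi> F b \<alpha>\<bar> \<le> 2 * C"
          using a'(2) \<alpha> by (intro mult_mono q) auto
        then show "norm (\<Phi> F (c n * b) \<alpha>) \<le> 2 * C"
          by (simp add: val \<alpha> abs_mult)
      qed
    qed
  qed
  \<comment> \<open>\<open>b\<close> has to vary: the polynomial that approximates the indicator of
    the new set is absorbed into it.\<close>
  have main: "(\<integral>\<alpha>. \<Phi> F b \<alpha> \<partial>\<mu>) = (\<integral>\<alpha>. \<Phi> F b \<alpha> \<partial>\<nu>)" if "finite F" "F \<subseteq> D" "b \<in> ?A" for F b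
    using that
  proof (induction F arbitrary: b rule: finite_induct)
    case empty
    have "(\<integral>\<alpha>. \<Phi> {} b \<alpha> \<partial>\<rho>) = (\<integral>\<alpha>. \<alpha> b \<partial>\<rho>)" if "space \<rho> = ?X" for \<rho>
      using that by (intro Bochner_Integration.integral_cong refl) (simp add: \<Phi>_def)
    then show ?case using eq empty space by simp
  next
    case (insert a F)
    have a: "a \<in> D" and F: "F \<subseteq> D" using insert by auto
    obtain a' where a': "a' \<in> ?A" "pos_set D a' = pos_set D a" "\<forall>\<alpha>\<in>?X. \<bar>\<alpha> a'\<bar> \<le> 1"
      using normalize[OF a] by blast
    have "\<forall>n. \<exists>c. c \<in> ?A \<and> (\<forall>\<alpha>\<in>?X. \<alpha> c = q n (\<alpha> a'))"
      using real_polynomial_function_compose_char[OF D A AD a'(1) q(1)] by blast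
    then obtain c where c: "\<And>n. c n \<in> ?A" "\<And>n \<alpha>. \<alpha> \<in> ?X \<Longrightarrow> \<alpha> (c n) = q n (\<alpha> a')"
      by metis
    have a'D: "a' \<in> D" using a' AD by auto
    have "(\<integral>\<alpha>. \<Phi> F (c n * b) \<alpha> \<partial>\<mu>) = (\<integral>\<alpha>. \<Phi> F (c n * b) \<alpha> \<partial>\<nu>)" for n
      using insert F by (intro insert.IH subalgebraD[OF A] c)
    then show ?case
      using step[OF fin(1) sets(1) insert(1) F a insert(5) a'(2,3) a'D c]
        step[OF fin(2) sets(2) insert(1) F a insert(5) a'(2,3) a'D c]
      by (simp add: LIMSEQ_unique)
  qed
  \<comment> \<open>The intersection with \<open>?X\<close> makes the empty family contribute the
    whole space.\<close>
  define E where "E = {?X \<inter> (\<Inter>a\<in>F. pos_set D a) | F. finite F \<and> F \<subseteq> D}"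
  have E: "constructibly_borel D = sigma_sets ?X E"
  proof (rule antisym)
    show "constructibly_borel D \<subseteq> sigma_sets ?X E"
      unfolding constructibly_borel_def
    proof (rule sigma_sets_mono, safe)
      fix a assume "a \<in> D"
      moreover have "pos_set D a = ?X \<inter> (\<Inter>a\<in>{a}. pos_set D a)"
        by (auto simp: pos_set_def)
      ultimately have "pos_set D a \<in> E"
        unfolding E_def by (intro CollectI exI[of _ "{a}"]) simp
      then show "pos_set D a \<in> sigma_sets ?X E" by (rule sigma_sets.Basic)
    qed
    have "E \<subseteq> sets \<mu>"
      unfolding E_def using E_sets sets(1) by blast
    then show "sigma_sets ?X E \<subseteq> constructibly_borel D"
      using sets.sigma_sets_subset[of E \<mu>] by (simp add: space sets)
  qed
  show ?thesis
  proof (rule measure_eqI_generator_eq)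
    show "sets \<mu> = sigma_sets ?X E" "sets \<nu> = sigma_sets ?X E"
      using sets E by simp_all
    show "E \<subseteq> Pow ?X" unfolding E_def by auto
    show "Int_stable E"
      unfolding Int_stable_def
    proof (intro ballI)
      fix a b assume "a \<in> E" "b \<in> E"
      then obtain F G where F: "finite F" "F \<subseteq> D" "a = ?X \<inter> (\<Inter>a\<in>F. pos_set D a)"
        and G: "finite G" "G \<subseteq> D" "b = ?X \<inter> (\<Inter>a\<in>G. pos_set D a)"
        unfolding E_def by blast
      show "a \<inter> b \<in> E"
        unfolding E_def using F G by (intro CollectI exI[of _ "F \<union> G"]) auto
    qed
    show "range (\<lambda>_::nat. ?X) \<subseteq> E"
      unfolding E_def by (auto intro!: exI[of _ "{}"])
    show "(\<Union>i::nat. ?X) = ?X" by simp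
    show "emeasure \<mu> ?X \<noteq> \<infinity>"
      using fin(1) by (simp add: finite_measure.emeasure_finite)
    fix X assume "X \<in> E"
    then obtain F where F: "finite F" "F \<subseteq> D" "X = ?X \<inter> (\<Inter>a\<in>F. pos_set D a)"
      unfolding E_def by blast
    have "(\<integral>\<alpha>. \<Phi> F 1 \<alpha> \<partial>\<rho>) = measure \<rho> X" if "sets \<rho> = constructibly_borel D" for \<rho>
    proof -
      have "(\<integral>\<alpha>. \<Phi> F 1 \<alpha> \<partial>\<rho>) = (\<integral>\<alpha>. indicator X \<alpha> \<partial>\<rho>)"
        using space_constructibly_borel[OF that] F(3)
        by (intro Bochner_Integration.integral_cong refl) (simp add: \<Phi>_def char_one[OF D])
      also have "\<dots> = measure \<rho> X"
        using E_sets[OF F(1,2) that] F(3) sets.sets_into_space[of X \<rho>] by (simp add: Int_absorb2)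
      finally show ?thesis .
    qed
    then have "measure \<mu> X = measure \<nu> X"
      using main[OF F(1,2) subalgebraD(1)[OF A]] sets by simp
    then show "emeasure \<mu> X = emeasure \<nu> X"
      using fin by (simp add: finite_measure.emeasure_eq_measure)
  qed
qed

section \<open>Positive semidefinite functionals and de Finetti measures\<close>

text \<open>Frees sums of squares from initial segments of \<open>nat\<close>, so that their sums
  and products can be indexed by disjoint unions and Cartesian products.\<close>

lemma sums_of_squaresI:
  assumes "finite I" "\<And>i. i \<in> I \<Longrightarrow> f i \<in> D"
  shows "(\<Sum>i\<in>I. (f i)\<^sup>2) \<in> sums_of_squares D"
proof -
  obtain h where h: "bij_betw h {0..<card I} I"
    using ex_bij_betw_nat_finite[OF assms(1)] by blast
  have "(\<Sum>i\<in>I. (f i)\<^sup>2) = (\<Sum>k<card I. (f (h k))\<^sup>2)"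
    using sum.reindex_bij_betw[OF h, of "\<lambda>i. (f i)\<^sup>2"] by (simp add: atLeast0LessThan)
  moreover have "\<forall>k<card I. f (h k) \<in> D"
    using assms(2) bij_betwE[OF h] by auto
  ultimately show ?thesis
    unfolding sums_of_squares_def by (intro CollectI exI[of _ "\<lambda>k. f (h k)"] exI[of _ "card I"]) simp
qed

lemma sums_of_squaresE:
  assumes "b \<in> sums_of_squares D"
  obtains g and n :: nat where "b = (\<Sum>k<n. (g k)\<^sup>2)" "\<And>k. k < n \<Longrightarrow> g k \<in> D"
  using assms unfolding sums_of_squares_def by blast

lemma sums_of_squares_square: "a \<in> D \<Longrightarrow> a\<^sup>2 \<in> sums_of_squares D"
  using sums_of_squaresI[of "{0::nat}" "\<lambda>_. a" D] by simp

lemma sums_of_squares_add: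
  assumes "a \<in> sums_of_squares D" "b \<in> sums_of_squares D"
  shows "a + b \<in> sums_of_squares D"
proof -
  obtain g and n :: nat where g: "a = (\<Sum>k<n. (g k)\<^sup>2)" "\<And>k. k < n \<Longrightarrow> g k \<in> D"
    by (rule sums_of_squaresE[OF assms(1)], rule that)
  obtain h and m :: nat where h: "b = (\<Sum>k<m. (h k)\<^sup>2)" "\<And>k. k < m \<Longrightarrow> h k \<in> D"
    by (rule sums_of_squaresE[OF assms(2)], rule that)
  have "a + b = (\<Sum>k\<in>{..<n} <+> {..<m}. (case_sum g h k)\<^sup>2)"
    by (simp add: g h sum.Plus)
  then show ?thesis
    using g(2) h(2) by (auto intro!: sums_of_squaresI)
qed

lemma sums_of_squares_mult:
  assumes D: "subalgebra D" and "a \<in> sums_of_squares D" "b \<in> sums_of_squares D"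
  shows "a * b \<in> sums_of_squares D"
proof -
  obtain g and n :: nat where g: "a = (\<Sum>k<n. (g k)\<^sup>2)" "\<And>k. k < n \<Longrightarrow> g k \<in> D"
    by (rule sums_of_squaresE[OF assms(2)], rule that)
  obtain h and m :: nat where h: "b = (\<Sum>k<m. (h k)\<^sup>2)" "\<And>k. k < m \<Longrightarrow> h k \<in> D"
    by (rule sums_of_squaresE[OF assms(3)], rule that)
  have "a * b = (\<Sum>i<n. \<Sum>j<m. (g i * h j)\<^sup>2)"
    by (simp add: g h sum_product power_mult_distrib)
  also have "\<dots> = (\<Sum>(i, j)\<in>{..<n} \<times> {..<m}. (g i * h j)\<^sup>2)"
    by (simp add: sum.cartesian_product)
  also have "\<dots> = (\<Sum>p\<in>{..<n} \<times> {..<m}. (g (fst p) * h (snd p))\<^sup>2)"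
    by (simp add: case_prod_unfold)
  finally show ?thesis
    using g(2) h(2) by (auto intro!: sums_of_squaresI subalgebraD[OF D])
qed

lemma sums_of_squares_one: "subalgebra D \<Longrightarrow> 1 \<in> sums_of_squares D"
  using sums_of_squares_square[of 1 D] subalgebraD(1)[of D] by simp

lemma sums_of_squares_prod:
  assumes "subalgebra D" "\<And>i. i \<in> I \<Longrightarrow> f i \<in> sums_of_squares D"
  shows "prod f I \<in> sums_of_squares D"
  using assms(2) by (induction I rule: infinite_finite_induct)
    (auto intro: sums_of_squares_mult sums_of_squares_one assms(1))

lemma sums_of_squares_subset:
  assumes "subalgebra D"
  shows "sums_of_squares D \<subseteq> D"
proof
  fix b assume b: "b \<in> sums_of_squares D"
  obtain g and n :: nat where g: "b = (\<Sum>k<n. (g k)\<^sup>2)" "\<And>k. k < n \<Longrightarrow> g k \<in> D"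
    by (rule sums_of_squaresE[OF b], rule that)
  show "b \<in> D"
    unfolding g(1) using g(2) by (intro subalgebra_sum subalgebra_more assms) auto
qed

section \<open>Positive semidefinite functionals and the Cauchy-Schwarz inequality\<close>

locale psd_functional =
  fixes B :: "'a::{comm_ring_1, real_algebra_1} set" and L :: "'a \<Rightarrow> real"
  assumes subalgebra: "subalgebra B" and psd: "L \<in> psd_functionals B"
begin

lemmas B_intros = subalgebraD[OF subalgebra] subalgebra_more[OF subalgebra]

lemma L_add: "a \<in> B \<Longrightarrow> b \<in> B \<Longrightarrow> L (a + b) = L a + L b"
  and L_scaleR: "a \<in> B \<Longrightarrow> L (c *\<^sub>R a) = c * L a"
  and L_nonneg: "a \<in> sums_of_squares B \<Longrightarrow> 0 \<le> L a"
  using psd unfolding psd_functionals_def by auto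

lemma L_zero: "L 0 = 0"
  using L_scaleR[of 1 0] B_intros(1) by simp

lemma L_diff:
  assumes "a \<in> B" "b \<in> B"
  shows "L (a - b) = L a - L b"
proof -
  have "L (a + (-1) *\<^sub>R b) = L a + (-1) * L b"
    using assms by (subst L_add) (auto simp only: L_scaleR intro: B_intros)
  then show ?thesis
    by simp
qed

lemma L_sum: "(\<And>i. i \<in> I \<Longrightarrow> f i \<in> B) \<Longrightarrow> L (sum f I) = (\<Sum>i\<in>I. L (f i))"
proof (induction I rule: infinite_finite_induct)
  case (insert i I)
  then show ?case
    by (simp add: L_add subalgebra_sum[OF subalgebra])
qed (simp_all add: L_zero)

lemma Cauchy_Schwarz:
  assumes a: "a \<in> B" and b: "b \<in> B"
  shows "(L (a * b))\<^sup>2 \<le> L (a\<^sup>2) * L (b\<^sup>2)"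
proof -
  have quad: "0 \<le> t\<^sup>2 * L (a\<^sup>2) - 2 * t * L (a * b) + L (b\<^sup>2)" for t
  proof -
    have "(t *\<^sub>R a - b)\<^sup>2 = t\<^sup>2 *\<^sub>R a\<^sup>2 - (2 * t) *\<^sub>R (a * b) + b\<^sup>2"
      by (simp add: power2_eq_square algebra_simps scaleR_2 flip: scaleR_scaleR)
    moreover have "0 \<le> L ((t *\<^sub>R a - b)\<^sup>2)"
      using a b by (intro L_nonneg sums_of_squares_square B_intros)
    ultimately show ?thesis
      using a b by (simp add: L_add L_diff L_scaleR B_intros)
  qed
  show ?thesis
  proof (cases "L (a\<^sup>2) = 0")
    case True
    have "L (a * b) = 0"
    proof (rule ccontr)
      assume *: "L (a * b) \<noteq> 0"
      \<comment> \<open>Without a quadratic term the expression is affine in \<open>t\<close>, and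
        this \<open>t\<close> gives it the value -1.\<close>
      show False
        using quad[of "(L (b\<^sup>2) + 1) / (2 * L (a * b))"] True * by (simp add: field_simps)
    qed
    then show ?thesis using True by simp
  next
    case False
    then have pos: "L (a\<^sup>2) > 0"
      using L_nonneg[OF sums_of_squares_square[OF a]] by simp
    \<comment> \<open>This \<open>t\<close> minimizes the quadratic polynomial.\<close>
    have "0 \<le> (L (a * b) / L (a\<^sup>2))\<^sup>2 * L (a\<^sup>2) - 2 * (L (a * b) / L (a\<^sup>2)) * L (a * b) + L (b\<^sup>2)"
      by (rule quad)
    also have "\<dots> = L (b\<^sup>2) - (L (a * b))\<^sup>2 / L (a\<^sup>2)"
      using pos by (simp add: power2_eq_square)
    finally show ?thesis
      using pos by (simp add: divide_le_eq mult.commute)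
  qed
qed

end

section \<open>Finite-dimensional distributions of the bits and their projective limit\<close>

text \<open>
  De Finetti's construction: for weights \<open>g j\<close> that are, together with their complements
  \<open>1 - g j\<close>, sums of squares, the functional prescribes a consistent family of distributions of
  bits indexed by \<open>(j, k)\<close>, where each bit in row \<open>j\<close> is \<open>1\<close> with ``probability'' \<open>g j\<close>.
\<close>

locale psd_weights = psd_functional B L
  for B :: "'a::{comm_ring_1, real_algebra_1} set" and L +
  fixes g :: "'j \<Rightarrow> 'a"
  assumes L_one: "L 1 = 1"
    and g_sos: "\<And>j. g j \<in> sums_of_squares B" and g_compl_sos: "\<And>j. 1 - g j \<in> sums_of_squares B"
begin

lemma g_in_B: "g j \<in> B"
  using g_sos sums_of_squares_subset[OF subalgebra] by blast

text \<open>Bits are real numbers so that the projective limit can be formed over the Borel sets of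
  a Polish type; every value other than 1 counts as failure.\<close>

definition bit_weight :: "'j \<times> nat \<Rightarrow> real \<Rightarrow> 'a" where
  "bit_weight e b = (if b = 1 then g (fst e) else 1 - g (fst e))"

definition bits :: "('j \<times> nat) set \<Rightarrow> ('j \<times> nat \<Rightarrow> real) set" where
  "bits K = (\<Pi>\<^sub>E e\<in>K. {0, 1})"

definition bits_prob :: "('j \<times> nat) set \<Rightarrow> ('j \<times> nat \<Rightarrow> real) \<Rightarrow> real" where
  "bits_prob K z = L (\<Prod>e\<in>K. bit_weight e (z e))"

text \<open>The point measure lives on all subsets of \<open>bits K\<close>; pushing it along the
  inclusion places it on the product \<sigma>-algebra that a projective family requires.\<close>

definition bits_measure :: "('j \<times> nat) set \<Rightarrow> ('j \<times> nat \<Rightarrow> real) measure" where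
  "bits_measure K = distr (point_measure (bits K) (\<lambda>z. ennreal (bits_prob K z))) (\<Pi>\<^sub>M e\<in>K. borel) (\<lambda>z. z)"

lemma finite_bits: "finite K \<Longrightarrow> finite (bits K)"
  unfolding bits_def by (intro finite_PiE) auto

lemma bit_weight_sos: "bit_weight e b \<in> sums_of_squares B"
  by (simp add: bit_weight_def g_sos g_compl_sos)

lemma prod_bit_weight_sos: "(\<Prod>e\<in>K. bit_weight e (z e)) \<in> sums_of_squares B"
  by (intro sums_of_squares_prod subalgebra bit_weight_sos)

lemma prod_bit_weight_in_B: "(\<Prod>e\<in>K. bit_weight e (z e)) \<in> B"
  using prod_bit_weight_sos sums_of_squares_subset[OF subalgebra] by blast

lemma bits_prob_nonneg: "0 \<le> bits_prob K z"
  unfolding bits_prob_def by (intro L_nonneg prod_bit_weight_sos)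

lemma sets_bits_measure: "sets (bits_measure K) = sets (\<Pi>\<^sub>M e\<in>K. borel)"
  by (simp add: bits_measure_def)

lemma bits_subset: "bits K \<subseteq> space (\<Pi>\<^sub>M e\<in>K. borel)"
  by (auto simp: bits_def space_PiM)

lemma emeasure_bits_measure:
  assumes K: "finite K" and X: "X \<in> sets (\<Pi>\<^sub>M e\<in>K. borel)"
  shows "emeasure (bits_measure K) X = ennreal (\<Sum>z\<in>X \<inter> bits K. bits_prob K z)"
proof -
  have "emeasure (bits_measure K) X
      = emeasure (point_measure (bits K) (\<lambda>z. ennreal (bits_prob K z))) (X \<inter> bits K)"
    unfolding bits_measure_def using bits_subset X
    by (subst emeasure_distr) (auto simp: space_point_measure)
  also have "\<dots> = (\<Sum>z\<in>X \<inter> bits K. ennreal (bits_prob K z))"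
    using finite_bits[OF K] by (intro emeasure_point_measure_finite) auto
  also have "\<dots> = ennreal (\<Sum>z\<in>X \<inter> bits K. bits_prob K z)"
    by (intro sum_ennreal bits_prob_nonneg)
  finally show ?thesis .
qed

text \<open>Distributivity: the sum is the expansion of a product of factors
  \<open>g + (1 - g)\<close>.\<close>

lemma sum_bit_weights: "finite K \<Longrightarrow> (\<Sum>w\<in>bits K. \<Prod>e\<in>K. bit_weight e (w e)) = 1"
  unfolding bits_def by (subst prod_sum_PiE[symmetric]) (auto simp: bit_weight_def)

text \<open>The patterns on \<open>H\<close> extending \<open>y\<close> are \<open>y\<close> merged
  with arbitrary patterns on \<open>H - J\<close>; by linearity of \<open>L\<close> the factors over
  \<open>H - J\<close> may be summed first, and they sum to 1.\<close>

lemma sum_bits_prob_extensions: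
  assumes H: "finite H" "J \<subseteq> H" and y: "y \<in> bits J"
  shows "(\<Sum>z | z \<in> bits H \<and> restrict z J = y. bits_prob H z) = bits_prob J y"
proof -
  let ?m = "\<lambda>w. merge J (H - J) (y, w)"
  have un: "J \<union> (H - J) = H" "J \<inter> (H - J) = {}" using H by auto
  have fin: "finite J" "finite (H - J)" using H finite_subset by auto
  have "(\<Sum>z | z \<in> bits H \<and> restrict z J = y. bits_prob H z) = (\<Sum>w\<in>bits (H - J). bits_prob H (?m w))"
  proof (rule sum.reindex_bij_witness[of _ ?m "\<lambda>z. restrict z (H - J)"])
    fix z assume "z \<in> {z \<in> bits H. restrict z J = y}"
    then have z: "z \<in> bits H" and y: "y = restrict z J" by auto
    show "?m (restrict z (H - J)) = z"
      using z H unfolding y bits_def by (auto simp: merge_def fun_eq_iff PiE_def extensional_def)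
    show "restrict z (H - J) \<in> bits (H - J)"
      using z unfolding bits_def by auto
    show "bits_prob H (?m (restrict z (H - J))) = bits_prob H z"
      using \<open>?m (restrict z (H - J)) = z\<close> by simp
  next
    fix w assume w: "w \<in> bits (H - J)"
    show "restrict (?m w) (H - J) = w"
      using w un unfolding bits_def by (simp add: restrict_PiE_iff PiE_restrict)
    have "restrict (?m w) J = y"
      using y un unfolding bits_def by (simp add: PiE_restrict)
    moreover have "?m w \<in> bits H"
      using w y un(1) un(2) unfolding bits_def by (auto simp: merge_def PiE_def Pi_def extensional_def)
    ultimately show "?m w \<in> {z \<in> bits H. restrict z J = y}" by simp
  qed
  also have "\<dots> = (\<Sum>w\<in>bits (H - J). L ((\<Prod>e\<in>J. bit_weight e (y e)) * (\<Prod>e\<in>H - J. bit_weight e (w e))))"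
  proof (rule sum.cong[OF refl])
    fix w
    have "(\<Prod>e\<in>H. bit_weight e (?m w e))
        = (\<Prod>e\<in>J. bit_weight e (?m w e)) * (\<Prod>e\<in>H - J. bit_weight e (?m w e))"
      using prod.union_disjoint[OF fin un(2), of "\<lambda>e. bit_weight e (?m w e)"] unfolding un(1) .
    also have "\<dots> = (\<Prod>e\<in>J. bit_weight e (y e)) * (\<Prod>e\<in>H - J. bit_weight e (w e))"
      by (intro arg_cong2[where f = "(*)"] prod.cong refl) (auto simp: merge_def)
    finally show "bits_prob H (?m w) = L ((\<Prod>e\<in>J. bit_weight e (y e)) * (\<Prod>e\<in>H - J. bit_weight e (w e)))"
      by (simp only: bits_prob_def)
  qed
  also have "\<dots> = L (\<Sum>w\<in>bits (H - J). (\<Prod>e\<in>J. bit_weight e (y e)) * (\<Prod>e\<in>H - J. bit_weight e (w e)))"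
    by (intro L_sum[symmetric] B_intros(3) prod_bit_weight_in_B)
  also have "\<dots> = bits_prob J y"
    unfolding sum_distrib_left[symmetric] sum_bit_weights[OF fin(2)] by (simp add: bits_prob_def)
  finally show ?thesis .
qed

lemma bits_measure_consistent:
  assumes H: "finite H" "J \<subseteq> H"
  shows "bits_measure J = distr (bits_measure H) (\<Pi>\<^sub>M e\<in>J. borel) (\<lambda>z. restrict z J)"
proof (rule measure_eqI)
  fix X assume "X \<in> sets (bits_measure J)"
  then have X: "X \<in> sets (\<Pi>\<^sub>M e\<in>J. borel)" by (simp add: sets_bits_measure)
  have J: "finite J" using H finite_subset by blast
  have meas: "(\<lambda>z. restrict z J) \<in> measurable (bits_measure H) (\<Pi>\<^sub>M e\<in>J. borel)"
    using measurable_restrict_subset[OF H(2), of "\<lambda>_. borel"]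
    by (simp add: measurable_cong_sets[OF sets_bits_measure refl])
  let ?Y = "(\<lambda>z. restrict z J) -` X \<inter> space (bits_measure H)"
  have space: "space (bits_measure H) = space (\<Pi>\<^sub>M e\<in>H. borel)"
    by (rule sets_eq_imp_space_eq[OF sets_bits_measure])
  have Y: "?Y \<in> sets (\<Pi>\<^sub>M e\<in>H. borel)"
    using measurable_sets[OF meas X] by (simp add: sets_bits_measure)
  \<comment> \<open>Patterns on \<open>H\<close> are grouped by their restriction to
    \<open>J\<close>.\<close>
  have "(\<Sum>z\<in>?Y \<inter> bits H. bits_prob H z)
      = (\<Sum>y\<in>X \<inter> bits J. \<Sum>z | z \<in> ?Y \<inter> bits H \<and> restrict z J = y. bits_prob H z)"
  proof (rule sum.group[symmetric])
    show "finite (?Y \<inter> bits H)" "finite (X \<inter> bits J)"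
      using finite_bits[OF H(1)] finite_bits[OF J] by auto
    show "(\<lambda>z. restrict z J) ` (?Y \<inter> bits H) \<subseteq> X \<inter> bits J"
      using H(2) by (auto simp: bits_def)
  qed
  also have "\<dots> = (\<Sum>y\<in>X \<inter> bits J. bits_prob J y)"
  proof (rule sum.cong[OF refl])
    fix y assume y: "y \<in> X \<inter> bits J"
    have "{z. z \<in> ?Y \<inter> bits H \<and> restrict z J = y} = {z. z \<in> bits H \<and> restrict z J = y}"
      using y bits_subset[of H] by (auto simp: space)
    then show "(\<Sum>z | z \<in> ?Y \<inter> bits H \<and> restrict z J = y. bits_prob H z) = bits_prob J y"
      using sum_bits_prob_extensions[OF H, of y] y by simp
  qed
  finally show "emeasure (bits_measure J) X
      = emeasure (distr (bits_measure H) (\<Pi>\<^sub>M e\<in>J. borel) (\<lambda>z. restrict z J)) X"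
    by (simp add: emeasure_distr[OF meas X] emeasure_bits_measure[OF J X] emeasure_bits_measure[OF H(1) Y])
qed (simp add: sets_bits_measure)

sublocale bits: polish_projective UNIV bits_measure
proof (intro polish_projective.intro projective_family.intro)
  fix J H :: "('j \<times> nat) set" assume "J \<subseteq> H" "finite H"
  then show "bits_measure J = distr (bits_measure H) (\<Pi>\<^sub>M e\<in>J. borel) (\<lambda>z. restrict z J)"
    by (intro bits_measure_consistent)
next
  fix J :: "('j \<times> nat) set" assume J: "finite J"
  \<comment> \<open>The total mass is \<open>L 1\<close>, so the normalization enters here.\<close>
  have "emeasure (bits_measure J) (space (\<Pi>\<^sub>M e\<in>J. borel)) = ennreal (\<Sum>z\<in>bits J. bits_prob J z)"
    using bits_subset[of J] by (subst emeasure_bits_measure[OF J]) (auto simp: Int_absorb1)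
  also have "(\<Sum>z\<in>bits J. bits_prob J z) = L (\<Sum>z\<in>bits J. \<Prod>e\<in>J. bit_weight e (z e))"
    unfolding bits_prob_def by (intro L_sum[symmetric] prod_bit_weight_in_B)
  also have "\<dots> = 1"
    by (simp add: sum_bit_weights[OF J] L_one)
  finally show "prob_space (bits_measure J)"
    by (intro prob_spaceI) (simp add: sets_eq_imp_space_eq[OF sets_bits_measure])
qed

text \<open>Forces the coordinate into {0, 1} on the whole sample space, so that bounds and
  idempotence hold everywhere instead of almost surely.\<close>

definition bit :: "'j \<Rightarrow> nat \<Rightarrow> ('j \<times> nat \<Rightarrow> real) \<Rightarrow> real" where
  "bit j k \<omega> = (if \<omega> (j, k) = 1 then 1 else 0)"

abbreviation "M \<equiv> bits.lim"

lemma bit_measurable[measurable]: "bit j k \<in> borel_measurable M"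
proof -
  have "(\<lambda>\<omega>. \<omega> (j, k)) \<in> borel_measurable M"
    by (simp add: measurable_cong_sets[OF bits.sets_lim refl])
  then have "(\<lambda>\<omega>. if \<omega> (j, k) = 1 then 1 else 0 :: real) \<in> borel_measurable M"
    by measurable
  then show ?thesis
    by (simp only: bit_def[abs_def])
qed

lemma bit_bounds: "0 \<le> bit j k \<omega>" "bit j k \<omega> \<le> 1"
  by (simp_all add: bit_def)

lemma bit_square: "(bit j k \<omega>)\<^sup>2 = bit j k \<omega>"
  by (simp_all add: bit_def)

text \<open>The product is the indicator of the cylinder where all bits in \<open>K\<close> are 1.
  It contains a single pattern, whose probability is by definition \<open>L\<close> of the product
  of the \<open>g j\<close>.\<close>

lemma expectation_prod_bits:
  assumes K: "finite K"
  shows "(\<integral>\<omega>. (\<Prod>(j, k)\<in>K. bit j k \<omega>) \<partial>M) = L (\<Prod>(j, k)\<in>K. g j)"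
proof -
  let ?X = "\<Pi>\<^sub>E e\<in>K. {1 :: real}"
  let ?one = "\<lambda>e\<in>K. 1 :: real"
  have X: "?X \<in> sets (\<Pi>\<^sub>M e\<in>K. borel)"
    using K by (intro sets_PiM_I_finite) auto
  have "(\<integral>\<omega>. (\<Prod>(j, k)\<in>K. bit j k \<omega>) \<partial>M) = (\<integral>\<omega>. indicator (prod_emb UNIV (\<lambda>_. borel) K ?X) \<omega> \<partial>M)"
  proof (rule Bochner_Integration.integral_cong[OF refl])
    fix \<omega>
    show "(\<Prod>(j, k)\<in>K. bit j k \<omega>) = indicator (prod_emb UNIV (\<lambda>_. borel) K ?X) \<omega>"
    proof (cases "\<forall>e\<in>K. \<omega> e = 1")
      case True
      then have "(\<Prod>(j, k)\<in>K. bit j k \<omega>) = 1"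
        by (intro prod.neutral) (auto simp: bit_def)
      moreover have "restrict \<omega> K = (\<lambda>e\<in>K. 1)"
        using True by auto
      ultimately show ?thesis
        by (simp add: prod_emb_def)
    next
      case False
      then obtain j k where "(j, k) \<in> K" "\<omega> (j, k) \<noteq> 1" by auto
      then have "(\<Prod>(j, k)\<in>K. bit j k \<omega>) = 0"
        using K by (intro prod_zero) (auto simp: bit_def intro!: bexI[of _ "(j, k)"])
      moreover have "restrict \<omega> K \<noteq> (\<lambda>e\<in>K. 1)"
        using \<open>(j, k) \<in> K\<close> \<open>\<omega> (j, k) \<noteq> 1\<close> by (metis restrict_apply')
      ultimately show ?thesis
        by (simp add: prod_emb_def)
    qed
  qed
  also have "\<dots> = measure M (prod_emb UNIV (\<lambda>_. borel) K ?X)"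
    using sets.sets_into_space[OF measurable_prod_emb[OF subset_UNIV X]] bits.space_lim
    by (simp add: Int_absorb2)
  also have "\<dots> = measure (bits_measure K) ?X"
    using K X by (intro bits.measure_lim_emb) auto
  also have "\<dots> = (\<Sum>z\<in>?X \<inter> bits K. bits_prob K z)"
    unfolding measure_def emeasure_bits_measure[OF K X]
    by (intro enn2real_ennreal sum_nonneg bits_prob_nonneg)
  also have "?X \<inter> bits K = {?one}"
  proof -
    have "z = ?one" if "z \<in> ?X \<inter> bits K" for z
      using that by (auto simp: bits_def PiE_def extensional_def fun_eq_iff)
    moreover have "?one \<in> ?X \<inter> bits K"
      by (auto simp: bits_def space_PiM)
    ultimately show ?thesis by blast
  qed
  also have "(\<Sum>z\<in>{?one}. bits_prob K z) = L (\<Prod>(j, k)\<in>K. g j)"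
    unfolding bits_prob_def
    by (simp add: case_prod_unfold bit_weight_def cong: prod.cong)
  finally show ?thesis .
qed

lemma integrable_bounded:
  assumes "F \<in> borel_measurable M" "\<And>\<omega>. \<bar>F \<omega>\<bar> \<le> C"
  shows "integrable M (F :: _ \<Rightarrow> real)"
  using assms by (intro bits.P.integrable_const_bound[where B = C]) auto

section \<open>Averages over windows and the law of large numbers\<close>

text \<open>The averages are taken over disjoint windows that move to infinity, so that each average of
  large index is ``independent'' of any given finite set of bits.\<close>

definition window :: "nat \<Rightarrow> nat set" where
  "window n = {16 ^ n..<2 * 16 ^ n}"

lemma window_simps: "finite (window n)" "card (window n) = 16 ^ n"
  by (simp_all add: window_def)

lemma window_disjoint:
  assumes "k \<in> window n" "l \<in> window (Suc n)"
  shows "k \<noteq> l"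
  using assms by (auto simp: window_def)

definition avg :: "'j \<Rightarrow> nat \<Rightarrow> ('j \<times> nat \<Rightarrow> real) \<Rightarrow> real" where
  "avg j n \<omega> = (\<Sum>k\<in>window n. bit j k \<omega>) / 16 ^ n"

lemma avg_measurable[measurable]: "avg j n \<in> borel_measurable M"
  unfolding avg_def[abs_def] by measurable

lemma avg_bounds: "0 \<le> avg j n \<omega>" "avg j n \<omega> \<le> 1"
proof -
  show "0 \<le> avg j n \<omega>"
    unfolding avg_def by (intro divide_nonneg_nonneg sum_nonneg bit_bounds) simp
  have "(\<Sum>k\<in>window n. bit j k \<omega>) \<le> (\<Sum>k\<in>window n. 1)"
    by (intro sum_mono bit_bounds)
  then show "avg j n \<omega> \<le> 1"
    by (simp add: avg_def window_simps)
qed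

text \<open>Bits are idempotent, so equal positions contribute a first moment of \<open>g j\<close>
  and distinct positions a second moment.\<close>

lemma expectation_bit_product:
  "(\<integral>\<omega>. bit j k \<omega> * bit j l \<omega> \<partial>M) = (if k = l then L (g j) else L ((g j)\<^sup>2))"
proof (cases "k = l")
  case True
  then have "(\<integral>\<omega>. bit j k \<omega> * bit j l \<omega> \<partial>M) = (\<integral>\<omega>. (\<Prod>(j, k)\<in>{(j, k)}. bit j k \<omega>) \<partial>M)"
    by (intro Bochner_Integration.integral_cong refl) (simp add: bit_square flip: power2_eq_square)
  also have "\<dots> = L (g j)"
    by (subst expectation_prod_bits) auto
  finally show ?thesis using True by simp
next
  case False
  then have "(\<integral>\<omega>. bit j k \<omega> * bit j l \<omega> \<partial>M) = (\<integral>\<omega>. (\<Prod>(j, k)\<in>{(j, k), (j, l)}. bit j k \<omega>) \<partial>M)"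
    by (intro Bochner_Integration.integral_cong refl) simp
  also have "\<dots> = L ((g j)\<^sup>2)"
    using False by (subst expectation_prod_bits) (auto simp: power2_eq_square)
  finally show ?thesis using False by simp
qed

lemma expectation_avg_product:
  "(\<integral>\<omega>. avg j m \<omega> * avg j n \<omega> \<partial>M)
     = (\<Sum>k\<in>window m. \<Sum>l\<in>window n. if k = l then L (g j) else L ((g j)\<^sup>2)) / (16 ^ m * 16 ^ n)"
proof -
  have int: "integrable M (\<lambda>\<omega>. bit j k \<omega> * bit j l \<omega>)" for k l
    by (rule integrable_bounded[where C = 1]) (simp_all add: abs_mult bit_bounds mult_le_one)
  have "(\<integral>\<omega>. avg j m \<omega> * avg j n \<omega> \<partial>M)
      = (\<integral>\<omega>. (\<Sum>k\<in>window m. \<Sum>l\<in>window n. bit j k \<omega> * bit j l \<omega>) / (16 ^ m * 16 ^ n) \<partial>M)"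
    by (simp add: avg_def sum_product)
  also have "\<dots> = (\<integral>\<omega>. (\<Sum>k\<in>window m. \<Sum>l\<in>window n. bit j k \<omega> * bit j l \<omega>) \<partial>M) / (16 ^ m * 16 ^ n)"
    by simp
  also have "(\<integral>\<omega>. (\<Sum>k\<in>window m. \<Sum>l\<in>window n. bit j k \<omega> * bit j l \<omega>) \<partial>M)
      = (\<Sum>k\<in>window m. \<Sum>l\<in>window n. \<integral>\<omega>. bit j k \<omega> * bit j l \<omega> \<partial>M)"
    using int by (simp add: Bochner_Integration.integral_sum)
  finally show ?thesis
    by (simp only: expectation_bit_product)
qed

text \<open>The second moment of an average is \<open>L ((g j)\<^sup>2)\<close> plus a diagonal term
  of the order of 1 over the window size; the mixed moment has no diagonal because the windows are
  disjoint. The main terms cancel.\<close>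

lemma expectation_avg_diff:
  "(\<integral>\<omega>. (avg j n \<omega> - avg j (Suc n) \<omega>)\<^sup>2 \<partial>M) \<le> 2 / 16 ^ n"
proof -
  let ?p = "L (g j)" and ?r = "L ((g j)\<^sup>2)"
  have sq: "(\<integral>\<omega>. avg j m \<omega> * avg j m \<omega> \<partial>M) = ?r + (?p - ?r) / 16 ^ m" for m
  proof -
    have "(\<Sum>k\<in>window m. \<Sum>l\<in>window m. if k = l then ?p else ?r)
        = (\<Sum>k\<in>window m. \<Sum>l\<in>window m. ?r + (if k = l then ?p - ?r else 0))"
      by (intro sum.cong refl) simp
    also have "\<dots> = 16 ^ m * (16 ^ m * ?r + (?p - ?r))"
      by (simp add: sum.distrib window_simps)
    finally show ?thesis
      unfolding expectation_avg_product by (simp add: field_simps)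
  qed
  have cross: "(\<integral>\<omega>. avg j n \<omega> * avg j (Suc n) \<omega> \<partial>M) = ?r"
  proof -
    have "(\<Sum>k\<in>window n. \<Sum>l\<in>window (Suc n). if k = l then ?p else ?r)
        = (\<Sum>k\<in>window n. \<Sum>l\<in>window (Suc n). ?r)"
      by (intro sum.cong refl) (use window_disjoint in auto)
    then show ?thesis
      unfolding expectation_avg_product by (simp add: window_simps)
  qed
  have int: "integrable M (\<lambda>\<omega>. avg j m \<omega> * avg j l \<omega>)" for m l
    by (rule integrable_bounded[where C = 1]) (simp_all add: abs_mult avg_bounds mult_le_one)
  have "(\<integral>\<omega>. (avg j n \<omega> - avg j (Suc n) \<omega>)\<^sup>2 \<partial>M)
      = (\<integral>\<omega>. avg j n \<omega> * avg j n \<omega> + avg j (Suc n) \<omega> * avg j (Suc n) \<omega> - 2 * (avg j n \<omega> * avg j (Suc n) \<omega>) \<partial>M)"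
    by (simp add: power2_eq_square algebra_simps)
  also have "\<dots> = (?r + (?p - ?r) / 16 ^ n) + (?r + (?p - ?r) / 16 ^ Suc n) - 2 * ?r"
    using int by (simp only: Bochner_Integration.integral_add Bochner_Integration.integral_diff
        integral_mult_right_zero Bochner_Integration.integrable_add integrable_mult_right sq cross)
  also have "\<dots> = (?p - ?r) * (17 / 16) / 16 ^ n"
    by (simp add: field_simps)
  also have "\<dots> \<le> 2 / 16 ^ n"
  proof (rule divide_right_mono)
    \<comment> \<open>Positivity of the square and of \<open>1 - g j\<close> gives
      \<open>?p - ?r \<le> 1\<close>, and \<open>17 / 16\<close> is rounded up to 2.\<close>
    have "0 \<le> ?r"
      by (intro L_nonneg sums_of_squares_square g_in_B)
    moreover have "0 \<le> L (1 - g j)"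
      by (intro L_nonneg g_compl_sos)
    then have "?p \<le> 1"
      using L_diff[of 1 "g j"] g_in_B L_one B_intros(1) by simp
    ultimately show "(?p - ?r) * (17 / 16) \<le> 2" by simp
  qed simp
  finally show ?thesis .
qed

text \<open>Turns the mean-square rate \<open>1 / 16 ^ n\<close> into a summable rate for the
  absolute value. Windows growing geometrically make it a geometric rate, with ratio the square root
  of \<open>1 / 16\<close>.\<close>

lemma expectation_abs_avg_diff:
  "(\<integral>\<omega>. \<bar>avg j n \<omega> - avg j (Suc n) \<omega>\<bar> \<partial>M) \<le> 2 * (1 / 4) ^ n"
proof -
  let ?X = "\<lambda>\<omega>. avg j n \<omega> - avg j (Suc n) \<omega>"
  have bound: "\<bar>?X \<omega>\<bar> \<le> 1" for \<omega>
    using avg_bounds[of j n \<omega>] avg_bounds[of j "Suc n" \<omega>] by (auto simp: abs_le_iff)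
  have int: "integrable M (\<lambda>\<omega>. \<bar>?X \<omega>\<bar>)" "integrable M (\<lambda>\<omega>. (?X \<omega>)\<^sup>2)"
    using bound by (auto intro!: integrable_bounded[where C = 1] simp: power2_le_iff_abs_le abs_square_le_1)
  \<comment> \<open>AM-GM with weight \<open>4 ^ n\<close>\<close>
  have "\<bar>x\<bar> \<le> (x\<^sup>2 * 4 ^ n + (1 / 4) ^ n) / 2" for x :: real
  proof -
    have "0 \<le> (\<bar>x\<bar> * 2 ^ n - (1 / 2) ^ n)\<^sup>2" by simp
    also have "\<dots> = x\<^sup>2 * (2 ^ n)\<^sup>2 + ((1 / 2) ^ n)\<^sup>2 - 2 * \<bar>x\<bar> * (2 ^ n * (1 / 2) ^ n)"
      by (simp add: power2_diff power_mult_distrib algebra_simps)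
    also have "(2 ^ n :: real)\<^sup>2 = 4 ^ n"
      by (metis power2_eq_square power_mult_distrib mult_2 numeral_Bit0)
    also have "((1 / 2 :: real) ^ n)\<^sup>2 = (1 / 4) ^ n"
      by (simp add: power2_eq_square flip: power_mult_distrib)
    also have "(2 ^ n :: real) * (1 / 2) ^ n = 1"
      by (simp flip: power_mult_distrib)
    finally show ?thesis by simp
  qed
  then have "(\<integral>\<omega>. \<bar>?X \<omega>\<bar> \<partial>M) \<le> (\<integral>\<omega>. ((?X \<omega>)\<^sup>2 * 4 ^ n + (1 / 4) ^ n) / 2 \<partial>M)"
    using int by (intro Bochner_Integration.integral_mono) auto
  also have "\<dots> = ((\<integral>\<omega>. (?X \<omega>)\<^sup>2 \<partial>M) * 4 ^ n + (1 / 4) ^ n) / 2"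
    using int by (simp add: bits.P.prob_space del: bits.space_lim)
  also have "\<dots> \<le> (2 / 16 ^ n * 4 ^ n + (1 / 4) ^ n) / 2"
    using expectation_avg_diff[of j n] by (intro divide_right_mono add_right_mono mult_right_mono) auto
  also have "(2 / 16 ^ n * 4 ^ n :: real) = 2 * (1 / 4) ^ n"
    by (simp add: power_divide power_mult_distrib[symmetric] divide_simps)
  also have "(2 * (1 / 4) ^ n + (1 / 4) ^ n) / 2 \<le> 2 * (1 / 4 :: real) ^ n"
  proof -
    have "(2 * x + x) / 2 \<le> 2 * x" if "0 \<le> x" for x :: real
      using that by simp
    then show ?thesis by simp
  qed
  finally show ?thesis .
qed

text \<open>\<open>lim\<close> is arbitrary where the averages diverge; clamping makes the bounds 0
  and 1 hold everywhere.\<close>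

definition weight :: "'j \<Rightarrow> ('j \<times> nat \<Rightarrow> real) \<Rightarrow> real" where
  "weight j \<omega> = max 0 (min 1 (lim (\<lambda>n. avg j n \<omega>)))"

lemma weight_measurable[measurable]: "weight j \<in> borel_measurable M"
  unfolding weight_def[abs_def] by measurable

lemma weight_bounds: "0 \<le> weight j \<omega>" "weight j \<omega> \<le> 1"
  by (auto simp: weight_def)

text \<open>The increments have a finite sum of expected absolute values, so they are almost surely
  absolutely summable, and the averages converge by telescoping.\<close>

lemma avg_tendsto_weight: "AE \<omega> in M. (\<lambda>n. avg j n \<omega>) \<longlonglongrightarrow> weight j \<omega>"
proof -
  let ?X = "\<lambda>n \<omega>. \<bar>avg j n \<omega> - avg j (Suc n) \<omega>\<bar>"
  have int: "integrable M (?X n)" for n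
    using avg_bounds[of j n] avg_bounds[of j "Suc n"]
    by (intro integrable_bounded[where C = 1]) (auto simp: abs_le_iff diff_le_eq add_increasing2)
  have "(\<integral>\<^sup>+\<omega>. suminf (\<lambda>n. ennreal (?X n \<omega>)) \<partial>M) = suminf (\<lambda>n. \<integral>\<^sup>+\<omega>. ennreal (?X n \<omega>) \<partial>M)"
    by (rule nn_integral_suminf) measurable
  also have "\<dots> = suminf (\<lambda>n. ennreal (\<integral>\<omega>. ?X n \<omega> \<partial>M))"
    using int by (simp add: nn_integral_eq_integral)
  also have "\<dots> \<le> suminf (\<lambda>n. ennreal (2 * (1 / 4) ^ n))"
    by (intro suminf_le allI ennreal_leI expectation_abs_avg_diff) auto
  also have "\<dots> < \<infinity>"
  proof -
    have "summable (\<lambda>n. 2 * (1 / 4 :: real) ^ n)"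
      by (intro summable_mult summable_geometric) simp
    then show ?thesis
      by (subst suminf_ennreal2) auto
  qed
  finally have "AE \<omega> in M. suminf (\<lambda>n. ennreal (?X n \<omega>)) \<noteq> \<infinity>"
    by (intro nn_integral_PInf_AE) (auto simp: less_top)
  then show ?thesis
  proof eventually_elim
    fix \<omega> assume "suminf (\<lambda>n. ennreal (?X n \<omega>)) \<noteq> \<infinity>"
    then have "summable (\<lambda>n. ?X n \<omega>)"
      by (intro summable_suminf_not_top) auto
    then have "summable (\<lambda>n. avg j n \<omega> - avg j (Suc n) \<omega>)"
      by (rule summable_rabs_cancel)
    then have "convergent (\<lambda>n. \<Sum>i<n. avg j i \<omega> - avg j (Suc i) \<omega>)"
      by (simp add: summable_iff_convergent)
    moreover have "(\<lambda>n. \<Sum>i<n. avg j i \<omega> - avg j (Suc i) \<omega>) = (\<lambda>n. avg j 0 \<omega> - avg j n \<omega>)"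
      by (rule ext) (rule sum_lessThan_telescope')
    ultimately have "convergent (\<lambda>n. avg j 0 \<omega> - avg j n \<omega>)"
      by (simp only:)
    then have "convergent (\<lambda>n. avg j 0 \<omega> - (avg j 0 \<omega> - avg j n \<omega>))"
      by (rule convergent_diff[OF convergent_const])
    then have lim: "(\<lambda>n. avg j n \<omega>) \<longlonglongrightarrow> lim (\<lambda>n. avg j n \<omega>)"
      by (simp add: convergent_LIMSEQ_iff)
    have "0 \<le> lim (\<lambda>n. avg j n \<omega>)"
      by (rule LIMSEQ_le_const[OF lim]) (simp add: avg_bounds)
    moreover have "lim (\<lambda>n. avg j n \<omega>) \<le> 1"
      by (rule LIMSEQ_le_const2[OF lim]) (simp add: avg_bounds)
    ultimately have "lim (\<lambda>n. avg j n \<omega>) = weight j \<omega>"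
      by (simp add: weight_def)
    then show "(\<lambda>n. avg j n \<omega>) \<longlonglongrightarrow> weight j \<omega>"
      using lim by simp
  qed
qed

lemma prod_list_weight_bounds:
  "0 \<le> (\<Prod>j\<leftarrow>js. weight j \<omega>)" "(\<Prod>j\<leftarrow>js. weight j \<omega>) \<le> 1"
  by (induction js) (auto simp: weight_bounds intro: mult_nonneg_nonneg mult_le_one)

lemma prod_list_weight_measurable[measurable]:
  "(\<lambda>\<omega>. \<Prod>j\<leftarrow>js. weight j \<omega>) \<in> borel_measurable M"
  by (induction js) auto

text \<open>A weight is the limit of averages of bits outside \<open>K\<close>, so it can be traded
  for a fresh bit; this enlarges \<open>K\<close>, which must therefore vary in the induction.
  Repeated entries of \<open>js\<close> receive different bits, so powers of a weight yield powers
  of \<open>g j\<close> although bits are idempotent.\<close>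

lemma expectation_weights_bits:
  assumes "finite K"
  shows "(\<integral>\<omega>. (\<Prod>j\<leftarrow>js. weight j \<omega>) * (\<Prod>(j, k)\<in>K. bit j k \<omega>) \<partial>M)
    = L ((\<Prod>j\<leftarrow>js. g j) * (\<Prod>(j, k)\<in>K. g j))"
  using assms
proof (induction js arbitrary: K)
  case Nil
  then show ?case by (simp add: expectation_prod_bits)
next
  case (Cons j js)
  define Y where "Y \<omega> = (\<Prod>j\<leftarrow>js. weight j \<omega>) * (\<Prod>(j, k)\<in>K. bit j k \<omega>)" for \<omega>
  let ?c = "L ((\<Prod>j\<leftarrow>j # js. g j) * (\<Prod>(j, k)\<in>K. g j))"
  have [measurable]: "Y \<in> borel_measurable M"
    unfolding Y_def[abs_def] case_prod_unfold by measurable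
  have Y: "\<bar>Y \<omega>\<bar> \<le> 1" for \<omega>
  proof -
    have "0 \<le> (\<Prod>(j, k)\<in>K. bit j k \<omega>)" "(\<Prod>(j, k)\<in>K. bit j k \<omega>) \<le> 1"
      by (auto simp: bit_bounds intro!: prod_nonneg prod_le_1)
    then show ?thesis
      unfolding Y_def abs_mult using prod_list_weight_bounds[of \<omega> js] by (simp add: mult_le_one)
  qed
  \<comment> \<open>Windows of index at least \<open>N\<close> start at \<open>16 ^ n > n\<close>
    and thus lie beyond all positions in \<open>K\<close>. From there on the averaged expectations
    are constant, so their limit is known.\<close>
  obtain N where N: "\<And>e. e \<in> K \<Longrightarrow> snd e < N"
    using finite_imageI[OF Cons.prems, of snd] finite_nat_set_iff_bounded by auto
  have eq: "(\<integral>\<omega>. avg j n \<omega> * Y \<omega> \<partial>M) = ?c" if "n \<ge> N" for n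
  proof -
    have fresh: "(j, k) \<notin> K" if "k \<in> window n" for k
    proof
      assume "(j, k) \<in> K"
      then have "k < n" using N[of "(j, k)"] \<open>n \<ge> N\<close> by simp
      also have "n < 16 ^ n" by (rule less_exp[THEN order.strict_trans2]) (simp add: power_mono)
      finally show False using that by (simp add: window_def)
    qed
    have bitY: "(\<integral>\<omega>. bit j k \<omega> * Y \<omega> \<partial>M) = ?c" if "k \<in> window n" for k
    proof -
      have "(\<integral>\<omega>. bit j k \<omega> * Y \<omega> \<partial>M)
          = (\<integral>\<omega>. (\<Prod>j\<leftarrow>js. weight j \<omega>) * (\<Prod>(j, k)\<in>insert (j, k) K. bit j k \<omega>) \<partial>M)"
        using fresh[OF that] Cons.prems by (simp add: Y_def mult_ac)
      also have "\<dots> = L ((\<Prod>j\<leftarrow>js. g j) * (\<Prod>(j, k)\<in>insert (j, k) K. g j))"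
        using Cons.prems by (intro Cons.IH) simp
      also have "\<dots> = ?c"
        using fresh[OF that] Cons.prems by (simp add: mult_ac)
      finally show ?thesis .
    qed
    have int: "integrable M (\<lambda>\<omega>. bit j k \<omega> * Y \<omega>)" for k
      using Y by (intro integrable_bounded[where C = 1]) (auto simp: abs_mult bit_bounds intro!: mult_le_one)
    have "(\<integral>\<omega>. avg j n \<omega> * Y \<omega> \<partial>M) = (\<integral>\<omega>. (\<Sum>k\<in>window n. bit j k \<omega> * Y \<omega>) / 16 ^ n \<partial>M)"
      by (simp add: avg_def sum_distrib_right)
    also have "\<dots> = (\<Sum>k\<in>window n. \<integral>\<omega>. bit j k \<omega> * Y \<omega> \<partial>M) / 16 ^ n"
      using int by (simp add: Bochner_Integration.integral_sum)
    also have "\<dots> = ?c"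
      by (simp add: bitY window_simps)
    finally show ?thesis .
  qed
  have "(\<lambda>n. \<integral>\<omega>. avg j n \<omega> * Y \<omega> \<partial>M) \<longlonglongrightarrow> (\<integral>\<omega>. weight j \<omega> * Y \<omega> \<partial>M)"
  proof (rule integral_dominated_convergence[where w = "\<lambda>_. 1"])
    show "AE \<omega> in M. (\<lambda>n. avg j n \<omega> * Y \<omega>) \<longlonglongrightarrow> weight j \<omega> * Y \<omega>"
      using avg_tendsto_weight[of j] by eventually_elim (intro tendsto_intros)
    show "AE \<omega> in M. norm (avg j n \<omega> * Y \<omega>) \<le> 1" for n
      using Y avg_bounds by (intro AE_I2) (simp add: abs_mult mult_le_one)
  qed simp_all
  moreover have "(\<lambda>n. \<integral>\<omega>. avg j n \<omega> * Y \<omega> \<partial>M) \<longlonglongrightarrow> ?c"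
    using eq by (intro tendsto_eventually) (auto simp: eventually_sequentially)
  ultimately have "(\<integral>\<omega>. weight j \<omega> * Y \<omega> \<partial>M) = ?c"
    by (rule LIMSEQ_unique)
  then show ?case
    by (simp add: Y_def mult_ac)
qed

lemma expectation_prod_weights: "(\<integral>\<omega>. (\<Prod>j\<leftarrow>js. weight j \<omega>) \<partial>M) = L (\<Prod>j\<leftarrow>js. g j)"
  using expectation_weights_bits[of "{}" js] by simp

section \<open>Functions of the weights and the elements of \<open>B\<close> they stand for\<close>

lemma prod_list_g_in_B: "(\<Prod>j\<leftarrow>js. g j) \<in> B"
  by (induction js) (auto intro: B_intros g_in_B)

text \<open>Testing against all monomials in the weights, not only against 1, makes the relation
  survive multiplication by a weight.\<close>

definition represents :: "(('j \<times> nat \<Rightarrow> real) \<Rightarrow> real) \<Rightarrow> 'a \<Rightarrow> bool" where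
  "represents H b \<longleftrightarrow> H \<in> borel_measurable M \<and> (\<exists>C. \<forall>\<omega>. \<bar>H \<omega>\<bar> \<le> C) \<and> b \<in> B \<and>
     (\<forall>js. (\<integral>\<omega>. H \<omega> * (\<Prod>j\<leftarrow>js. weight j \<omega>) \<partial>M) = L (b * (\<Prod>j\<leftarrow>js. g j)))"

text \<open>Pairs of a polynomial in the \<open>weight j\<close> and the same polynomial in the \<open>g j\<close>; defining
  them as multipliers makes the closure under products immediate.\<close>

definition corresponds :: "(('j \<times> nat \<Rightarrow> real) \<Rightarrow> real) \<Rightarrow> 'a \<Rightarrow> bool" where
  "corresponds F a \<longleftrightarrow> F \<in> borel_measurable M \<and> (\<exists>C. \<forall>\<omega>. \<bar>F \<omega>\<bar> \<le> C) \<and> a \<in> B \<and>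
     (\<forall>H b. represents H b \<longrightarrow> represents (\<lambda>\<omega>. H \<omega> * F \<omega>) (b * a))"

lemma bounded_mult:
  assumes "\<exists>C. \<forall>\<omega>. \<bar>F \<omega>\<bar> \<le> C" "\<exists>C. \<forall>\<omega>. \<bar>G \<omega>\<bar> \<le> C"
  shows "\<exists>C. \<forall>\<omega>. \<bar>F \<omega> * G \<omega> :: real\<bar> \<le> C"
proof -
  obtain C C' where "\<And>\<omega>. \<bar>F \<omega>\<bar> \<le> C" "\<And>\<omega>. \<bar>G \<omega>\<bar> \<le> C'" using assms by blast
  then have "\<bar>F \<omega> * G \<omega>\<bar> \<le> C * C'" for \<omega>
    unfolding abs_mult by (intro mult_mono') auto
  then show ?thesis by blast
qed

lemma bounded_add:
  assumes "\<exists>C. \<forall>\<omega>. \<bar>F \<omega>\<bar> \<le> C" "\<exists>C. \<forall>\<omega>. \<bar>G \<omega>\<bar> \<le> C"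
  shows "\<exists>C. \<forall>\<omega>. \<bar>F \<omega> + G \<omega> :: real\<bar> \<le> C"
proof -
  obtain C C' where "\<And>\<omega>. \<bar>F \<omega>\<bar> \<le> C" "\<And>\<omega>. \<bar>G \<omega>\<bar> \<le> C'" using assms by blast
  then have "\<bar>F \<omega> + G \<omega>\<bar> \<le> C + C'" for \<omega>
    by (meson abs_triangle_ineq add_mono order_trans)
  then show ?thesis by blast
qed

lemma representsD:
  assumes "represents H b"
  shows "H \<in> borel_measurable M" "\<exists>C. \<forall>\<omega>. \<bar>H \<omega>\<bar> \<le> C" "b \<in> B"
    "(\<integral>\<omega>. H \<omega> * (\<Prod>j\<leftarrow>js. weight j \<omega>) \<partial>M) = L (b * (\<Prod>j\<leftarrow>js. g j))"
    "integrable M (\<lambda>\<omega>. H \<omega> * (\<Prod>j\<leftarrow>js. weight j \<omega>))"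
proof -
  show *: "H \<in> borel_measurable M" "\<exists>C. \<forall>\<omega>. \<bar>H \<omega>\<bar> \<le> C" "b \<in> B"
    "(\<integral>\<omega>. H \<omega> * (\<Prod>j\<leftarrow>js. weight j \<omega>) \<partial>M) = L (b * (\<Prod>j\<leftarrow>js. g j))"
    using assms by (auto simp: represents_def)
  have "\<exists>C. \<forall>\<omega>. \<bar>\<Prod>j\<leftarrow>js. weight j \<omega>\<bar> \<le> C"
    using prod_list_weight_bounds by (intro exI[of _ 1]) auto
  from bounded_mult[OF *(2) this] obtain C where "\<And>\<omega>. \<bar>H \<omega> * (\<Prod>j\<leftarrow>js. weight j \<omega>)\<bar> \<le> C"
    by blast
  then show "integrable M (\<lambda>\<omega>. H \<omega> * (\<Prod>j\<leftarrow>js. weight j \<omega>))"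
    using *(1) by (intro integrable_bounded[where C = C]) auto
qed

lemma correspondsD:
  assumes "corresponds F a"
  shows "F \<in> borel_measurable M" "\<exists>C. \<forall>\<omega>. \<bar>F \<omega>\<bar> \<le> C" "a \<in> B"
    "represents H b \<Longrightarrow> represents (\<lambda>\<omega>. H \<omega> * F \<omega>) (b * a)"
  using assms by (auto simp: corresponds_def)

lemma represents_one: "represents (\<lambda>_. 1) 1"
  unfolding represents_def by (auto simp: expectation_prod_weights B_intros intro!: exI[of _ 1])

lemma represents_add:
  assumes "represents H b" "represents H' b'"
  shows "represents (\<lambda>\<omega>. H \<omega> + H' \<omega>) (b + b')"
  unfolding represents_def
proof (intro conjI allI)
  note 1 = representsD[OF assms(1)] and 2 = representsD[OF assms(2)]
  show "(\<lambda>\<omega>. H \<omega> + H' \<omega>) \<in> borel_measurable M" "b + b' \<in> B"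
    using 1 2 by (auto intro: B_intros)
  show "\<exists>C. \<forall>\<omega>. \<bar>H \<omega> + H' \<omega>\<bar> \<le> C"
    by (rule bounded_add[OF 1(2) 2(2)])
  show "(\<integral>\<omega>. (H \<omega> + H' \<omega>) * (\<Prod>j\<leftarrow>js. weight j \<omega>) \<partial>M) = L ((b + b') * (\<Prod>j\<leftarrow>js. g j))" for js
    using 1(3) 2(3) 1(4,5)[of js] 2(4,5)[of js]
    by (simp add: distrib_right Bochner_Integration.integral_add L_add B_intros prod_list_g_in_B)
qed

lemma represents_scaleR:
  assumes "represents H b"
  shows "represents (\<lambda>\<omega>. H \<omega> * c) (b * c *\<^sub>R 1)"
  unfolding represents_def
proof (intro conjI allI)
  note 1 = representsD[OF assms(1)]
  show "(\<lambda>\<omega>. H \<omega> * c) \<in> borel_measurable M" "b * c *\<^sub>R 1 \<in> B"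
    using 1 by (auto intro: B_intros)
  show "\<exists>C. \<forall>\<omega>. \<bar>H \<omega> * c\<bar> \<le> C"
    by (rule bounded_mult[OF 1(2)]) auto
  show "(\<integral>\<omega>. (H \<omega> * c) * (\<Prod>j\<leftarrow>js. weight j \<omega>) \<partial>M) = L (b * c *\<^sub>R 1 * (\<Prod>j\<leftarrow>js. g j))" for js
  proof -
    have "(\<integral>\<omega>. (H \<omega> * c) * (\<Prod>j\<leftarrow>js. weight j \<omega>) \<partial>M) = (\<integral>\<omega>. c * (H \<omega> * (\<Prod>j\<leftarrow>js. weight j \<omega>)) \<partial>M)"
      by (simp add: mult_ac)
    also have "\<dots> = c * L (b * (\<Prod>j\<leftarrow>js. g j))"
      by (simp add: 1(4))
    also have "\<dots> = L (b * c *\<^sub>R 1 * (\<Prod>j\<leftarrow>js. g j))"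
      using 1(3) by (simp add: L_scaleR B_intros prod_list_g_in_B)
    finally show ?thesis .
  qed
qed

lemma corresponds_const: "corresponds (\<lambda>_. c) (c *\<^sub>R 1)"
  unfolding corresponds_def by (auto simp del: mult_scaleR_right intro!: B_intros represents_scaleR)

text \<open>The extra factor is moved into the test monomial: \<open>js\<close> becomes
  \<open>j # js\<close>.\<close>

lemma corresponds_weight: "corresponds (weight j) (g j)"
  unfolding corresponds_def
proof (intro conjI allI impI weight_measurable g_in_B)
  show *: "\<exists>C. \<forall>\<omega>. \<bar>weight j \<omega>\<bar> \<le> C"
    by (intro exI[of _ 1]) (simp add: weight_bounds)
  fix H b assume "represents H b"
  note 1 = representsD[OF this]
  show "represents (\<lambda>\<omega>. H \<omega> * weight j \<omega>) (b * g j)"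
    unfolding represents_def
    using 1(1,3) 1(4)[of "j # _"] bounded_mult[OF 1(2) *] by (auto intro: B_intros g_in_B simp: mult.assoc)
qed

lemma corresponds_add:
  assumes "corresponds F a" "corresponds G b"
  shows "corresponds (\<lambda>\<omega>. F \<omega> + G \<omega>) (a + b)"
  unfolding corresponds_def
proof (intro conjI allI impI)
  note 1 = correspondsD[OF assms(1)] and 2 = correspondsD[OF assms(2)]
  show "(\<lambda>\<omega>. F \<omega> + G \<omega>) \<in> borel_measurable M" "a + b \<in> B"
    using 1(1,3) 2(1,3) by (auto intro: B_intros)
  show "\<exists>C. \<forall>\<omega>. \<bar>F \<omega> + G \<omega>\<bar> \<le> C"
    by (rule bounded_add[OF 1(2) 2(2)])
  show "represents (\<lambda>\<omega>. H \<omega> * (F \<omega> + G \<omega>)) (c * (a + b))" if "represents H c" for H c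
    unfolding distrib_left by (intro represents_add 1 2 that)
qed

lemma corresponds_mult:
  assumes "corresponds F a" "corresponds G b"
  shows "corresponds (\<lambda>\<omega>. F \<omega> * G \<omega>) (a * b)"
  unfolding corresponds_def
proof (intro conjI allI impI)
  note 1 = correspondsD[OF assms(1)] and 2 = correspondsD[OF assms(2)]
  show "(\<lambda>\<omega>. F \<omega> * G \<omega>) \<in> borel_measurable M" "a * b \<in> B"
    using 1(1,3) 2(1,3) by (auto intro: B_intros)
  show "\<exists>C. \<forall>\<omega>. \<bar>F \<omega> * G \<omega>\<bar> \<le> C"
    by (rule bounded_mult[OF 1(2) 2(2)])
  show "represents (\<lambda>\<omega>. H \<omega> * (F \<omega> * G \<omega>)) (c * (a * b))" if "represents H c" for H c
    unfolding mult.assoc[symmetric] by (intro 1 2 that)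
qed

lemma corresponds_diff:
  assumes "corresponds F a" "corresponds G b"
  shows "corresponds (\<lambda>\<omega>. F \<omega> - G \<omega>) (a - b)"
  using corresponds_add[OF assms(1) corresponds_mult[OF corresponds_const[of "-1"] assms(2)]] by simp

lemma corresponds_one: "corresponds (\<lambda>_. 1) 1"
  using corresponds_const[of 1] by simp

lemma corresponds_power:
  assumes "corresponds F a"
  shows "corresponds (\<lambda>\<omega>. F \<omega> ^ n) (a ^ n)"
  by (induction n) (auto intro: corresponds_mult assms corresponds_one)

lemma corresponds_sum:
  assumes "\<And>i. i \<in> I \<Longrightarrow> corresponds (F i) (a i)"
  shows "corresponds (\<lambda>\<omega>. \<Sum>i\<in>I. F i \<omega>) (\<Sum>i\<in>I. a i)"
  using assms corresponds_const[of 0]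
  by (induction I rule: infinite_finite_induct) (auto intro: corresponds_add)

lemma corresponds_expectation:
  assumes "corresponds F a"
  shows "integrable M F" "(\<integral>\<omega>. F \<omega> \<partial>M) = L a"
proof -
  have "represents (\<lambda>\<omega>. 1 * F \<omega>) (1 * a)"
    by (rule correspondsD(4)[OF assms represents_one])
  from representsD(4,5)[OF this, of "[]"] show "integrable M F" "(\<integral>\<omega>. F \<omega> \<partial>M) = L a"
    by simp_all
qed

section \<open>Division by a bounded element through the geometric series\<close>

text \<open>
  If \<open>w = 1 / t\<close> corresponds to \<open>W\<close>, then \<open>f\<close> is the limit of \<open>f w (1 + (1 - w) + \<dots> + (1 - w)\<^sup>N)\<close>
  under \<open>L\<close>, and \<open>F / W\<close> is the limit of the corresponding functions.
\<close>

context
  fixes W w t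
  assumes W: "corresponds W w" and W01: "\<And>\<omega>. 0 \<le> W \<omega>" "\<And>\<omega>. W \<omega> \<le> 1"
    and t: "t \<in> sums_of_squares B" and wt: "w * t = 1"
begin

text \<open>The even number of terms makes the remainder \<open>(1 - w) ^ (2 * n)\<close> a square,
  so that \<open>L\<close> is nonnegative on its product with \<open>t\<close>.\<close>

definition geometric :: "nat \<Rightarrow> ('j \<times> nat \<Rightarrow> real) \<Rightarrow> real" where
  "geometric n \<omega> = (\<Sum>k<2 * n. (1 - W \<omega>) ^ k)"

lemma corresponds_geometric: "corresponds (geometric n) (\<Sum>k<2 * n. (1 - w) ^ k)"
  unfolding geometric_def[abs_def]
  by (intro corresponds_sum corresponds_power corresponds_diff corresponds_one W)

lemma w_geometric: "w * (\<Sum>k<2 * n. (1 - w) ^ k) = 1 - (1 - w) ^ (2 * n)"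
  using one_diff_power_eq[of "1 - w" "2 * n"] by simp

lemma W_geometric: "W \<omega> * geometric n \<omega> = 1 - (1 - W \<omega>) ^ (2 * n)"
  using one_diff_power_eq[of "1 - W \<omega>" "2 * n"] by (simp add: geometric_def)

lemma w_t_in_B: "w \<in> B" "t \<in> B"
  using correspondsD(3)[OF W] t sums_of_squares_subset[OF subalgebra] by auto

lemma remainder_in_B: "f \<in> B \<Longrightarrow> f * (1 - w) ^ n \<in> B"
  by (intro B_intros w_t_in_B)

lemma expectation_geometric:
  assumes f: "f \<in> B" and F: "corresponds F (f * w)"
  shows "(\<integral>\<omega>. F \<omega> * geometric n \<omega> \<partial>M) = L f - L (f * (1 - w) ^ (2 * n))"
proof -
  have "(\<integral>\<omega>. F \<omega> * geometric n \<omega> \<partial>M) = L (f * w * (\<Sum>k<2 * n. (1 - w) ^ k))"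
    by (intro corresponds_expectation corresponds_mult F corresponds_geometric)
  also have "f * w * (\<Sum>k<2 * n. (1 - w) ^ k) = f - f * (1 - w) ^ (2 * n)"
    by (simp only: mult.assoc w_geometric) (simp add: algebra_simps)
  finally show ?thesis
    using f by (simp add: L_diff remainder_in_B)
qed

text \<open>The case \<open>f = t\<close>, where \<open>f * w = 1\<close> corresponds to the
  constant function 1.\<close>

lemma expectation_geometric_t: "(\<integral>\<omega>. geometric n \<omega> \<partial>M) = L t - L (t * (1 - w) ^ (2 * n))"
proof -
  have "t * w = 1" using wt by (simp add: mult.commute)
  then show ?thesis
    using expectation_geometric[of t "\<lambda>_. 1" n] corresponds_one w_t_in_B by simp
qed

text \<open>On the event \<open>W = 0\<close> the geometric sum equals \<open>2 * n\<close>, while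
  its expectation never exceeds \<open>L t\<close>.\<close>

lemma AE_W_pos: "AE \<omega> in M. 0 < W \<omega>"
proof -
  have [measurable]: "W \<in> borel_measurable M" by (rule correspondsD(1)[OF W])
  let ?Z = "{\<omega> \<in> space M. W \<omega> = 0}"
  have Z: "?Z \<in> sets M" by measurable
  have bound: "real (2 * n) * measure M ?Z \<le> L t" for n
  proof -
    have "real (2 * n) * measure M ?Z = (\<integral>\<omega>. real (2 * n) * indicator ?Z \<omega> \<partial>M)"
      using Z by (simp add: bits.P.emeasure_eq_measure del: bits.space_lim)
    also have "\<dots> \<le> (\<integral>\<omega>. geometric n \<omega> \<partial>M)"
    proof (rule Bochner_Integration.integral_mono)
      show "integrable M (\<lambda>\<omega>. real (2 * n) * indicator ?Z \<omega>)"
        using Z by (intro integrable_mult_right integrable_real_indicator)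
          (auto simp: bits.P.emeasure_eq_measure simp del: bits.space_lim)
      show "integrable M (geometric n)"
        by (rule corresponds_expectation[OF corresponds_geometric])
      show "real (2 * n) * indicator ?Z \<omega> \<le> geometric n \<omega>" for \<omega>
        using W01[of \<omega>] by (auto simp: geometric_def indicator_def intro!: sum_nonneg)
    qed
    also have "\<dots> = L t - L (t * (1 - w) ^ (2 * n))"
      by (rule expectation_geometric_t)
    also have "\<dots> \<le> L t"
    proof -
      have "(1 - w) ^ (2 * n) = ((1 - w) ^ n)\<^sup>2"
        by (simp add: power_mult mult.commute flip: power_mult)
      then have "0 \<le> L (t * (1 - w) ^ (2 * n))"
        by (auto intro!: L_nonneg sums_of_squares_mult subalgebra t sums_of_squares_square B_intros w_t_in_B)
      then show ?thesis by simp
    qed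
    finally show ?thesis .
  qed
  have "measure M ?Z \<le> 0"
  proof (rule ccontr)
    assume "\<not> measure M ?Z \<le> 0"
    then obtain n where "L t < real n * measure M ?Z"
      using reals_Archimedean3[of "measure M ?Z"] by auto
    also have "\<dots> \<le> real (2 * n) * measure M ?Z"
      by (intro mult_right_mono) auto
    finally show False using bound[of n] by simp
  qed
  then have "measure M ?Z = 0"
    using measure_nonneg[of M ?Z] by linarith
  then have "emeasure M ?Z = 0"
    by (simp add: bits.P.emeasure_eq_measure del: bits.space_lim)
  then have "AE \<omega> in M. W \<omega> \<noteq> 0"
    using Z by (subst AE_iff_measurable[of ?Z]) auto
  then show ?thesis
    by eventually_elim (use W01 in \<open>simp add: less_le\<close>)
qed

text \<open>Cauchy-Schwarz splits off \<open>f\<close>, which may be unbounded. The square of the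
  remaining factor corresponds to \<open>(1 - W) ^ (4 * n)\<close>, which tends to 0 boundedly since
  \<open>W > 0\<close> almost surely.\<close>

lemma remainder_tendsto_0:
  assumes f: "f \<in> B"
  shows "(\<lambda>n. L (f * (1 - w) ^ (2 * n))) \<longlonglongrightarrow> 0"
proof -
  have [measurable]: "W \<in> borel_measurable M" by (rule correspondsD(1)[OF W])
  have "(\<lambda>n. \<integral>\<omega>. (1 - W \<omega>) ^ (4 * n) \<partial>M) \<longlonglongrightarrow> (\<integral>\<omega>. 0 \<partial>M)"
  proof (rule integral_dominated_convergence[where w = "\<lambda>_. 1"])
    show "AE \<omega> in M. (\<lambda>n. (1 - W \<omega>) ^ (4 * n)) \<longlonglongrightarrow> 0"
      using AE_W_pos
    proof eventually_elim
      fix \<omega> assume "0 < W \<omega>"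
      then have "\<bar>(1 - W \<omega>) ^ 4\<bar> < 1"
        using W01[of \<omega>] by (simp add: power_less_one_iff power_abs)
      then have "(\<lambda>n. ((1 - W \<omega>) ^ 4) ^ n) \<longlonglongrightarrow> 0"
        by (intro LIMSEQ_power_zero) simp
      then show "(\<lambda>n. (1 - W \<omega>) ^ (4 * n)) \<longlonglongrightarrow> 0"
        by (simp add: power_mult)
    qed
    show "AE \<omega> in M. norm ((1 - W \<omega>) ^ (4 * n)) \<le> 1" for n
      using W01 by (intro AE_I2) (simp add: power_le_one)
  qed simp_all
  moreover have "(\<integral>\<omega>. (1 - W \<omega>) ^ (4 * n) \<partial>M) = L (((1 - w) ^ (2 * n))\<^sup>2)" for n
  proof -
    have "(\<integral>\<omega>. (1 - W \<omega>) ^ (4 * n) \<partial>M) = L ((1 - w) ^ (4 * n))"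
      by (intro corresponds_expectation corresponds_power corresponds_diff corresponds_one W)
    then show ?thesis by (simp add: mult.commute flip: power_mult)
  qed
  ultimately have "(\<lambda>n. sqrt (L (f\<^sup>2) * L (((1 - w) ^ (2 * n))\<^sup>2))) \<longlonglongrightarrow> sqrt (L (f\<^sup>2) * 0)"
    by (intro tendsto_intros) simp
  then have lim: "(\<lambda>n. sqrt (L (f\<^sup>2) * L (((1 - w) ^ (2 * n))\<^sup>2))) \<longlonglongrightarrow> 0"
    by simp
  show ?thesis
  proof (rule Lim_null_comparison[OF always_eventually[OF allI] lim])
    fix n
    have "(L (f * (1 - w) ^ (2 * n)))\<^sup>2 \<le> L (f\<^sup>2) * L (((1 - w) ^ (2 * n))\<^sup>2)"
      by (intro Cauchy_Schwarz f B_intros w_t_in_B)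
    then show "norm (L (f * (1 - w) ^ (2 * n))) \<le> sqrt (L (f\<^sup>2) * L (((1 - w) ^ (2 * n))\<^sup>2))"
      by (simp add: real_le_rsqrt)
  qed
qed

lemma geometric_tendsto:
  assumes "0 < W \<omega>"
  shows "(\<lambda>n. geometric n \<omega>) \<longlonglongrightarrow> 1 / W \<omega>"
proof -
  have "\<bar>1 - W \<omega>\<bar> < 1"
    using assms W01(2)[of \<omega>] by simp
  then have "\<bar>(1 - W \<omega>)\<^sup>2\<bar> < 1"
    using abs_square_less_1[of "1 - W \<omega>"] by simp
  then have "(\<lambda>n. (1 - ((1 - W \<omega>)\<^sup>2) ^ n) / W \<omega>) \<longlonglongrightarrow> (1 - 0) / W \<omega>"
    using assms by (intro tendsto_divide tendsto_diff tendsto_const LIMSEQ_power_zero) auto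
  moreover have "geometric n \<omega> = (1 - ((1 - W \<omega>)\<^sup>2) ^ n) / W \<omega>" for n
    using W_geometric[of \<omega> n] assms by (simp add: eq_divide_eq mult.commute flip: power_mult)
  ultimately show ?thesis by simp
qed

lemma geometric_bounds: "0 \<le> geometric n \<omega>" "0 < W \<omega> \<Longrightarrow> geometric n \<omega> \<le> 1 / W \<omega>"
proof -
  show "0 \<le> geometric n \<omega>"
    unfolding geometric_def using W01 by (intro sum_nonneg) simp
  show "geometric n \<omega> \<le> 1 / W \<omega>" if "0 < W \<omega>"
    using W_geometric[of \<omega> n] that W01(2)[of \<omega>] by (simp add: pos_le_divide_eq mult.commute)
qed

text \<open>Monotone convergence of the geometric sums, whose expectations tend to
  \<open>L t\<close> because the remainder vanishes.\<close>

lemma integrable_inverse_W: "integrable M (\<lambda>\<omega>. 1 / W \<omega>)"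
proof (rule integrable_monotone_convergence)
  have [measurable]: "W \<in> borel_measurable M" by (rule correspondsD(1)[OF W])
  show "integrable M (geometric n)" for n
    by (rule corresponds_expectation[OF corresponds_geometric])
  show "AE \<omega> in M. mono (\<lambda>n. geometric n \<omega>)"
    unfolding geometric_def mono_def using W01 by (intro AE_I2 allI impI sum_mono2) auto
  show "AE \<omega> in M. (\<lambda>n. geometric n \<omega>) \<longlonglongrightarrow> 1 / W \<omega>"
    using AE_W_pos by eventually_elim (rule geometric_tendsto)
  have "(\<lambda>n. L t - L (t * (1 - w) ^ (2 * n))) \<longlonglongrightarrow> L t - 0"
    by (intro tendsto_intros remainder_tendsto_0 w_t_in_B)
  then show "(\<lambda>n. \<integral>\<omega>. geometric n \<omega> \<partial>M) \<longlonglongrightarrow> L t" by (simp add: expectation_geometric_t)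
  show "(\<lambda>\<omega>. 1 / W \<omega>) \<in> borel_measurable M" by measurable
qed

text \<open>The functions \<open>F * geometric n\<close> have the integrable majorant
  \<open>C / W\<close>, and their expectations are \<open>L f\<close> up to the vanishing
  remainder.\<close>

lemma expectation_quotient:
  assumes f: "f \<in> B" and F: "corresponds F (f * w)"
  shows "integrable M (\<lambda>\<omega>. F \<omega> / W \<omega>)" "(\<integral>\<omega>. F \<omega> / W \<omega> \<partial>M) = L f"
proof -
  have [measurable]: "W \<in> borel_measurable M" "F \<in> borel_measurable M"
    "geometric n \<in> borel_measurable M" for n
    by (rule correspondsD[OF W] correspondsD[OF F] correspondsD[OF corresponds_geometric])+
  obtain C where C: "\<And>\<omega>. \<bar>F \<omega>\<bar> \<le> C" using correspondsD(2)[OF F] by blast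
  have lim: "AE \<omega> in M. (\<lambda>n. F \<omega> * geometric n \<omega>) \<longlonglongrightarrow> F \<omega> / W \<omega>"
    using AE_W_pos
  proof eventually_elim
    fix \<omega> assume "0 < W \<omega>"
    then show "(\<lambda>n. F \<omega> * geometric n \<omega>) \<longlonglongrightarrow> F \<omega> / W \<omega>"
      using tendsto_mult[OF tendsto_const[of "F \<omega>"] geometric_tendsto[of \<omega>]] by simp
  qed
  have dom: "AE \<omega> in M. norm (F \<omega> * geometric n \<omega>) \<le> C * (1 / W \<omega>)" for n
    using AE_W_pos
  proof eventually_elim
    fix \<omega> assume "0 < W \<omega>"
    then show "norm (F \<omega> * geometric n \<omega>) \<le> C * (1 / W \<omega>)"
      unfolding real_norm_def abs_mult using geometric_bounds(1)[of n \<omega>] geometric_bounds(2)[of \<omega> n] C[of \<omega>] by (intro mult_mono) auto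
  qed
  have int: "integrable M (\<lambda>\<omega>. C * (1 / W \<omega>))"
    by (intro integrable_mult_right integrable_inverse_W)
  show "integrable M (\<lambda>\<omega>. F \<omega> / W \<omega>)"
    by (rule integrable_dominated_convergence[OF _ _ int lim dom]) measurable
  have "(\<lambda>n. \<integral>\<omega>. F \<omega> * geometric n \<omega> \<partial>M) \<longlonglongrightarrow> (\<integral>\<omega>. F \<omega> / W \<omega> \<partial>M)"
    by (rule integral_dominated_convergence[OF _ _ int lim dom]) measurable
  moreover have "(\<lambda>n. \<integral>\<omega>. F \<omega> * geometric n \<omega> \<partial>M) \<longlonglongrightarrow> L f - 0"
    unfolding expectation_geometric[OF f F] by (intro tendsto_intros remainder_tendsto_0 f)
  ultimately show "(\<integral>\<omega>. F \<omega> / W \<omega> \<partial>M) = L f"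
    using LIMSEQ_unique by fastforce
qed

end

end

section \<open>Measures representing functionals on the localized algebra\<close>

text \<open>All four identities come from \<open>x * (x * u) = 1 - u\<close>. The last two express
  that \<open>1 / 2 + x / (1 + x^2)\<close> and its complement are \<open>(1 + x)^2\<close> and
  \<open>(1 - x)^2\<close> divided by \<open>2 * (1 + x^2)\<close>; they are sums of squares because
  \<open>u\<close> is one.\<close>

lemma loc_u_sums:
  fixes i :: 'i
  defines "u \<equiv> loc_u i" and "x \<equiv> loc_x i"
  shows "u = u\<^sup>2 + (x * u)\<^sup>2" "1 - u = (x * u)\<^sup>2 + (x * (x * u))\<^sup>2"
    "x * u + (1 / 2) *\<^sub>R 1 = (sqrt (1 / 2) *\<^sub>R (1 + x))\<^sup>2 * u"
    "1 - (x * u + (1 / 2) *\<^sub>R 1) = (sqrt (1 / 2) *\<^sub>R (1 - x))\<^sup>2 * u"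
proof -
  have xxu: "x * (x * u) = 1 - u"
    using loc_u_eq[of i] by (simp add: u_def x_def algebra_simps power2_eq_square)
  have "u\<^sup>2 + (x * u)\<^sup>2 = u * u + (x * (x * u)) * u"
    by (simp add: power2_eq_square mult_ac)
  also have "\<dots> = u"
    unfolding xxu by (simp add: algebra_simps)
  finally show "u = u\<^sup>2 + (x * u)\<^sup>2" ..
  have "(x * u)\<^sup>2 + (x * (x * u))\<^sup>2 = (x * (x * u)) * u + (x * (x * u)) * (x * (x * u))"
    by (simp add: power2_eq_square mult_ac)
  also have "\<dots> = 1 - u"
    unfolding xxu by (simp add: algebra_simps)
  finally show "1 - u = (x * u)\<^sup>2 + (x * (x * u))\<^sup>2" ..
  have sq: "(sqrt (1 / 2) *\<^sub>R y)\<^sup>2 = (1 / 2) *\<^sub>R (y * y)" for y :: "'i loc"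
    by (simp add: power2_eq_square)
  have "(1 + x) * (1 + x) * u = 2 *\<^sub>R (x * u) + 1"
  proof -
    have "(1 + x) * (1 + x) * u = u + 2 *\<^sub>R (x * u) + x * (x * u)"
      by (simp add: algebra_simps scaleR_2)
    then show ?thesis unfolding xxu by simp
  qed
  then show "x * u + (1 / 2) *\<^sub>R 1 = (sqrt (1 / 2) *\<^sub>R (1 + x))\<^sup>2 * u"
    unfolding sq mult_scaleR_left by (simp only: scaleR_add_right scaleR_scaleR) simp
  have "(1 - x) * (1 - x) * u = 1 - 2 *\<^sub>R (x * u)"
  proof -
    have "(1 - x) * (1 - x) * u = u - 2 *\<^sub>R (x * u) + x * (x * u)"
      by (simp add: algebra_simps scaleR_2)
    then show ?thesis unfolding xxu by simp
  qed
  then have eq: "(sqrt (1 / 2) *\<^sub>R (1 - x))\<^sup>2 * u = (1 / 2) *\<^sub>R 1 - x * u"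
    unfolding sq mult_scaleR_left by (simp only: scaleR_diff_right scaleR_scaleR) simp
  have half: "(1 :: 'i loc) = (1 / 2) *\<^sub>R 1 + (1 / 2) *\<^sub>R 1"
    by (simp only: scaleR_add_left[symmetric]) simp
  have "1 - (x * u + (1 / 2) *\<^sub>R 1) = (1 / 2) *\<^sub>R 1 + (1 / 2) *\<^sub>R 1 - (x * u + (1 / 2) *\<^sub>R 1)"
    by (simp only: half[symmetric])
  then show "1 - (x * u + (1 / 2) *\<^sub>R 1) = (sqrt (1 / 2) *\<^sub>R (1 - x))\<^sup>2 * u"
    unfolding eq by (simp only: add_diff_cancel_right)
qed

text \<open>The shift by \<open>1 / 2\<close> moves \<open>x / (1 + x\<^sup>2)\<close> into \<open>[0, 1]\<close>; the value \<open>1\<close> outside \<open>\<Omega>\<close> is a dummy.\<close>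

definition loc_weight :: "'i set \<Rightarrow> 'i \<times> bool \<Rightarrow> 'i loc" where
  "loc_weight \<Omega> j = (if fst j \<in> \<Omega>
     then (if snd j then loc_x (fst j) * loc_u (fst j) + (1 / 2) *\<^sub>R 1 else loc_u (fst j)) else 1)"

lemma loc_u_sos: "i \<in> \<Omega> \<Longrightarrow> loc_u i \<in> sums_of_squares (B_loc \<Omega>)"
  by (subst loc_u_sums(1))
    (intro sums_of_squares_add sums_of_squares_square subalgebraD[OF subalgebra_B_loc] loc_u_in loc_x_in)

lemma loc_weight_sos: "loc_weight \<Omega> j \<in> sums_of_squares (B_loc \<Omega>)"
proof (cases "fst j \<in> \<Omega>")
  case True
  have "(sqrt (1 / 2) *\<^sub>R (1 + loc_x (fst j)))\<^sup>2 * loc_u (fst j) \<in> sums_of_squares (B_loc \<Omega>)"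
    using True by (intro sums_of_squares_mult sums_of_squares_square subalgebra_B_loc
        subalgebraD[OF subalgebra_B_loc] loc_u_sos loc_x_in)
  then show ?thesis
    using True loc_u_sos[of "fst j" \<Omega>] by (simp only: loc_weight_def loc_u_sums(3)) simp
next
  case False
  then show ?thesis
    by (simp add: loc_weight_def sums_of_squares_one subalgebra_B_loc)
qed

lemma loc_weight_compl_sos: "1 - loc_weight \<Omega> j \<in> sums_of_squares (B_loc \<Omega>)"
proof (cases "fst j \<in> \<Omega>")
  case True
  have "(sqrt (1 / 2) *\<^sub>R (1 - loc_x (fst j)))\<^sup>2 * loc_u (fst j) \<in> sums_of_squares (B_loc \<Omega>)"
    using True by (intro sums_of_squares_mult sums_of_squares_square subalgebra_B_loc
        subalgebraD[OF subalgebra_B_loc] subalgebra_more[OF subalgebra_B_loc] loc_u_sos loc_x_in)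
  moreover have "1 - loc_u (fst j) \<in> sums_of_squares (B_loc \<Omega>)"
    unfolding loc_u_sums(2) using True
    by (intro sums_of_squares_add sums_of_squares_square subalgebraD[OF subalgebra_B_loc] loc_u_in loc_x_in)
  ultimately show ?thesis
    using True loc_u_sums(4)[of "fst j"] by (cases "snd j") (simp_all only: loc_weight_def if_True if_False)
next
  case False
  then have "1 - loc_weight \<Omega> j = 0\<^sup>2"
    by (simp add: loc_weight_def)
  then show ?thesis
    by (simp only:) (intro sums_of_squares_square subalgebra_more[OF subalgebra_B_loc])
qed

section \<open>The random point and its law\<close>

locale normalized_functional =
  fixes \<Omega> :: "'i set" and L :: "'i loc \<Rightarrow> real"
  assumes psd_L: "L \<in> psd_functionals (B_loc \<Omega>)" and L_1: "L 1 = 1"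
begin

sublocale psd_weights "B_loc \<Omega>" L "loc_weight \<Omega>"
  by unfold_locales (simp_all add: subalgebra_B_loc psd_L L_1 loc_weight_sos loc_weight_compl_sos)

definition U :: "'i \<Rightarrow> (('i \<times> bool) \<times> nat \<Rightarrow> real) \<Rightarrow> real" where
  "U i = weight (i, False)"

definition V :: "'i \<Rightarrow> (('i \<times> bool) \<times> nat \<Rightarrow> real) \<Rightarrow> real" where
  "V i \<omega> = weight (i, True) \<omega> - 1 / 2"

text \<open>\<open>U i\<close> and \<open>V i\<close> stand for \<open>u\<close> and
  \<open>x * u\<close>, so the quotient stands for \<open>x\<close>. It is 0 by convention where
  \<open>U i\<close> vanishes, which for each single \<open>i \<in> \<Omega>\<close> is a null
  event.\<close>

definition X :: "(('i \<times> bool) \<times> nat \<Rightarrow> real) \<Rightarrow> 'i \<Rightarrow> real" where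
  "X \<omega> i = V i \<omega> / U i \<omega>"

lemma U_bounds: "0 \<le> U i \<omega>" "U i \<omega> \<le> 1"
  by (simp_all add: U_def weight_bounds)

lemma corresponds_U: "i \<in> \<Omega> \<Longrightarrow> corresponds (U i) (loc_u i)"
  using corresponds_weight[of "(i, False)"] by (simp add: U_def loc_weight_def)

lemma corresponds_V:
  assumes "i \<in> \<Omega>"
  shows "corresponds (V i) (loc_x i * loc_u i)"
proof -
  have "corresponds (\<lambda>\<omega>. weight (i, True) \<omega> - 1 / 2) (loc_weight \<Omega> (i, True) - (1 / 2) *\<^sub>R 1)"
    by (intro corresponds_diff corresponds_weight corresponds_const)
  then show ?thesis
    using assms by (simp add: V_def[abs_def] loc_weight_def)
qed

text \<open>The square of the defect of the relation corresponds to 0 in the algebra; it is a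
  nonnegative function with expectation 0.\<close>

lemma AE_circle:
  assumes i: "i \<in> \<Omega>"
  shows "AE \<omega> in M. (U i \<omega>)\<^sup>2 + (V i \<omega>)\<^sup>2 = U i \<omega>"
proof -
  let ?R = "\<lambda>\<omega>. (U i \<omega>)\<^sup>2 + (V i \<omega>)\<^sup>2 - U i \<omega>"
  have "corresponds (\<lambda>\<omega>. (?R \<omega>)\<^sup>2) (((loc_u i)\<^sup>2 + (loc_x i * loc_u i)\<^sup>2 - loc_u i)\<^sup>2)"
    by (intro corresponds_power corresponds_diff corresponds_add corresponds_U corresponds_V i)
  moreover have "(loc_u i)\<^sup>2 + (loc_x i * loc_u i)\<^sup>2 - loc_u i = 0"
    using loc_u_sums(1)[of i] by simp
  ultimately have "corresponds (\<lambda>\<omega>. (?R \<omega>)\<^sup>2) 0"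
    by simp
  from corresponds_expectation[OF this] have "integrable M (\<lambda>\<omega>. (?R \<omega>)\<^sup>2)" "(\<integral>\<omega>. (?R \<omega>)\<^sup>2 \<partial>M) = 0"
    by (simp_all add: L_zero)
  then have "AE \<omega> in M. (?R \<omega>)\<^sup>2 = 0"
    by (subst (asm) integral_nonneg_eq_0_iff_AE) auto
  then show ?thesis
    by eventually_elim simp
qed

lemma AE_U_pos:
  assumes i: "i \<in> \<Omega>"
  shows "AE \<omega> in M. 0 < U i \<omega>"
proof (rule AE_W_pos[OF corresponds_U[OF i] U_bounds])
  have "1\<^sup>2 + (loc_x i)\<^sup>2 \<in> sums_of_squares (B_loc \<Omega>)"
    by (intro sums_of_squares_add sums_of_squares_square subalgebraD[OF subalgebra_B_loc] loc_x_in i)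
  then show "1 + (loc_x i)\<^sup>2 \<in> sums_of_squares (B_loc \<Omega>)"
    by simp
qed (rule loc_u_eq)

text \<open>\<open>V / U\<close> is the slope of the line from the origin to a point of the circle;
  it parametrizes the circle without the origin by
  \<open>x |-> (1 / (1 + x^2), x / (1 + x^2))\<close>.\<close>

lemma loc_eval_X_u:
  assumes "(U i \<omega>)\<^sup>2 + (V i \<omega>)\<^sup>2 = U i \<omega>" "0 < U i \<omega>"
  shows "loc_eval (X \<omega>) (loc_u i) = U i \<omega>" "loc_eval (X \<omega>) (loc_x i * loc_u i) = V i \<omega>"
proof -
  have "1 + (X \<omega> i)\<^sup>2 = ((U i \<omega>)\<^sup>2 + (V i \<omega>)\<^sup>2) / (U i \<omega>)\<^sup>2"
    using assms(2) by (simp add: X_def field_simps)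
  also have "\<dots> = 1 / U i \<omega>"
    unfolding assms(1) using assms(2) by (simp add: power2_eq_square)
  finally show u: "loc_eval (X \<omega>) (loc_u i) = U i \<omega>"
    by (simp add: loc_eval_u)
  show "loc_eval (X \<omega>) (loc_x i * loc_u i) = V i \<omega>"
    unfolding loc_eval_mult u loc_eval_x using assms(2) by (simp add: X_def)
qed

text \<open>The random variable belonging to \<open>f\<close> is \<open>F / W\<close>, with \<open>w = 1 / t\<close> the inverse of a denominator.\<close>

definition bounded_fraction :: "'i loc \<Rightarrow> 'i loc \<Rightarrow> 'i loc \<Rightarrow>
    ((('i \<times> bool) \<times> nat \<Rightarrow> real) \<Rightarrow> real) \<Rightarrow> ((('i \<times> bool) \<times> nat \<Rightarrow> real) \<Rightarrow> real) \<Rightarrow> bool" where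
  "bounded_fraction f w t W F \<longleftrightarrow> t \<in> sums_of_squares (B_loc \<Omega>) \<and> w * t = 1 \<and>
     corresponds W w \<and> (\<forall>\<omega>. 0 \<le> W \<omega> \<and> W \<omega> \<le> 1) \<and> corresponds F (f * w) \<and>
     (AE \<omega> in M. loc_eval (X \<omega>) w = W \<omega> \<and> loc_eval (X \<omega>) (f * w) = F \<omega>)"

lemma bounded_fraction_bounded:
  assumes "corresponds F f" "AE \<omega> in M. loc_eval (X \<omega>) f = F \<omega>"
  shows "bounded_fraction f 1 1 (\<lambda>_. 1) F"
  using assms unfolding bounded_fraction_def
  by (auto simp: sums_of_squares_one subalgebra_B_loc corresponds_one loc_eval_one)

lemma bounded_fraction_x:
  assumes i: "i \<in> \<Omega>"
  shows "bounded_fraction (loc_x i) (loc_u i) (1 + (loc_x i)\<^sup>2) (U i) (V i)"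
  unfolding bounded_fraction_def
proof (intro conjI allI)
  have "1\<^sup>2 + (loc_x i)\<^sup>2 \<in> sums_of_squares (B_loc \<Omega>)"
    by (intro sums_of_squares_add sums_of_squares_square subalgebraD[OF subalgebra_B_loc] loc_x_in i)
  then show "1 + (loc_x i)\<^sup>2 \<in> sums_of_squares (B_loc \<Omega>)"
    by simp
  show "AE \<omega> in M. loc_eval (X \<omega>) (loc_u i) = U i \<omega> \<and> loc_eval (X \<omega>) (loc_x i * loc_u i) = V i \<omega>"
    using AE_circle[OF i] AE_U_pos[OF i] by eventually_elim (simp add: loc_eval_X_u)
qed (simp_all add: loc_u_eq corresponds_U corresponds_V i U_bounds)

text \<open>\<open>w * w'\<close> is a common denominator; its inverse \<open>t * t'\<close> is
  again a sum of squares, and two exceptional null sets are united.\<close>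

lemma bounded_fraction_add:
  assumes "bounded_fraction f w t W F" "bounded_fraction f' w' t' W' F'"
  shows "bounded_fraction (f + f') (w * w') (t * t') (\<lambda>\<omega>. W \<omega> * W' \<omega>) (\<lambda>\<omega>. F \<omega> * W' \<omega> + F' \<omega> * W \<omega>)"
proof -
  have eq: "(f + f') * (w * w') = (f * w) * w' + (f' * w') * w"
    by (simp add: algebra_simps)
  have "AE \<omega> in M. loc_eval (X \<omega>) (w * w') = W \<omega> * W' \<omega> \<and>
      loc_eval (X \<omega>) ((f * w) * w' + (f' * w') * w) = F \<omega> * W' \<omega> + F' \<omega> * W \<omega>"
    using assms[unfolded bounded_fraction_def, THEN conjunct2, THEN conjunct2, THEN conjunct2, THEN conjunct2, THEN conjunct2]
    by eventually_elim (metis loc_eval_add loc_eval_mult)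
  moreover have "(w * w') * (t * t') = (w * t) * (w' * t')"
    by (simp add: mult_ac)
  ultimately show ?thesis
    using assms unfolding bounded_fraction_def eq
    by (auto intro!: sums_of_squares_mult subalgebra_B_loc corresponds_mult corresponds_add mult_le_one)
qed

lemma bounded_fraction_mult:
  assumes "bounded_fraction f w t W F" "bounded_fraction f' w' t' W' F'"
  shows "bounded_fraction (f * f') (w * w') (t * t') (\<lambda>\<omega>. W \<omega> * W' \<omega>) (\<lambda>\<omega>. F \<omega> * F' \<omega>)"
proof -
  have eq: "(f * f') * (w * w') = (f * w) * (f' * w')"
    by (simp add: algebra_simps)
  have "AE \<omega> in M. loc_eval (X \<omega>) (w * w') = W \<omega> * W' \<omega> \<and>
      loc_eval (X \<omega>) ((f * w) * (f' * w')) = F \<omega> * F' \<omega>"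
    using assms[unfolded bounded_fraction_def, THEN conjunct2, THEN conjunct2, THEN conjunct2, THEN conjunct2, THEN conjunct2]
    by eventually_elim (metis loc_eval_mult)
  moreover have "(w * w') * (t * t') = (w * t) * (w' * t')"
    by (simp add: mult_ac)
  ultimately show ?thesis
    using assms unfolding bounded_fraction_def eq
    by (auto intro!: sums_of_squares_mult subalgebra_B_loc corresponds_mult mult_le_one)
qed

lemma bounded_fraction_const: "bounded_fraction (c *\<^sub>R 1) 1 1 (\<lambda>_. 1) (\<lambda>_. c)"
  by (intro bounded_fraction_bounded corresponds_const) (simp add: loc_eval_scaleR loc_eval_one)

lemma bounded_fraction_exists:
  assumes "f \<in> B_loc \<Omega>"
  shows "\<exists>w t W F. bounded_fraction f w t W F"
proof -
  have "B_loc \<Omega> \<subseteq> {f. \<exists>w t W F. bounded_fraction f w t W F}"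
  proof (rule B_loc_subset)
    show "subalgebra {f. \<exists>w t W F. bounded_fraction f w t W F}"
      unfolding subalgebra_def
    proof (intro conjI ballI allI)
      show "1 \<in> {f. \<exists>w t W F. bounded_fraction f w t W F}"
        using bounded_fraction_const[of 1] by auto
      fix f assume f: "f \<in> {f. \<exists>w t W F. bounded_fraction f w t W F}"
      show "c *\<^sub>R f \<in> {f. \<exists>w t W F. bounded_fraction f w t W F}" for c
      proof -
        obtain w t W F where "bounded_fraction f w t W F" using f by blast
        from bounded_fraction_mult[OF bounded_fraction_const[of c] this] show ?thesis by auto
      qed
      fix f' assume f': "f' \<in> {f. \<exists>w t W F. bounded_fraction f w t W F}"
      show "f + f' \<in> {f. \<exists>w t W F. bounded_fraction f w t W F}"
        using f f' bounded_fraction_add by blast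
      show "f * f' \<in> {f. \<exists>w t W F. bounded_fraction f w t W F}"
        using f f' bounded_fraction_mult by blast
    qed
    fix i assume i: "i \<in> \<Omega>"
    show "loc_x i \<in> {f. \<exists>w t W F. bounded_fraction f w t W F}"
      using bounded_fraction_x[OF i] by blast
    \<comment> \<open>\<open>loc_u i\<close> is already bounded, so 1 serves as its
      denominator.\<close>
    have "AE \<omega> in M. loc_eval (X \<omega>) (loc_u i) = U i \<omega>"
      using AE_circle[OF i] AE_U_pos[OF i] by eventually_elim (simp add: loc_eval_X_u)
    then show "loc_u i \<in> {f. \<exists>w t W F. bounded_fraction f w t W F}"
      using bounded_fraction_bounded[OF corresponds_U[OF i]] by blast
  qed
  then show ?thesis using assms by blast
qed

lemma X_measurable[measurable]: "(\<lambda>\<omega>. X \<omega> i) \<in> borel_measurable M"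
  unfolding X_def U_def V_def by measurable

lemma loc_eval_X_measurable:
  assumes "f \<in> B_loc \<Omega>"
  shows "(\<lambda>\<omega>. loc_eval (X \<omega>) f) \<in> borel_measurable M"
proof -
  have "B_loc \<Omega> \<subseteq> {f. (\<lambda>\<omega>. loc_eval (X \<omega>) f) \<in> borel_measurable M}"
    by (rule B_loc_subset)
      (auto simp: subalgebra_def loc_eval_one loc_eval_add loc_eval_mult loc_eval_scaleR loc_eval_x loc_eval_u)
  then show ?thesis using assms by blast
qed

text \<open>Almost surely \<open>W > 0\<close>, so the value of \<open>f\<close> at the random point
  is \<open>F / W\<close>, whose expectation the geometric series has computed.\<close>

lemma expectation_loc_eval_X:
  assumes f: "f \<in> B_loc \<Omega>"
  shows "integrable M (\<lambda>\<omega>. loc_eval (X \<omega>) f)" "(\<integral>\<omega>. loc_eval (X \<omega>) f \<partial>M) = L f"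
proof -
  obtain w t W F where bf: "bounded_fraction f w t W F"
    using bounded_fraction_exists[OF f] by blast
  have W: "corresponds W w" "\<And>\<omega>. 0 \<le> W \<omega>" "\<And>\<omega>. W \<omega> \<le> 1" "t \<in> sums_of_squares (B_loc \<Omega>)" "w * t = 1"
    and F: "corresponds F (f * w)"
    and AE: "AE \<omega> in M. loc_eval (X \<omega>) w = W \<omega> \<and> loc_eval (X \<omega>) (f * w) = F \<omega>"
    using bf unfolding bounded_fraction_def by auto
  have [measurable]: "W \<in> borel_measurable M" "F \<in> borel_measurable M"
    "(\<lambda>\<omega>. loc_eval (X \<omega>) f) \<in> borel_measurable M"
    using correspondsD(1)[OF W(1)] correspondsD(1)[OF F] loc_eval_X_measurable[OF f] by auto
  have eq: "AE \<omega> in M. loc_eval (X \<omega>) f = F \<omega> / W \<omega>"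
    using AE AE_W_pos[OF W] by eventually_elim (auto simp: loc_eval_mult eq_divide_eq)
  note q = expectation_quotient[OF W f F]
  have "integrable M (\<lambda>\<omega>. loc_eval (X \<omega>) f) \<longleftrightarrow> integrable M (\<lambda>\<omega>. F \<omega> / W \<omega>)"
    using eq by (intro integrable_cong_AE) measurable
  then show "integrable M (\<lambda>\<omega>. loc_eval (X \<omega>) f)" using q by simp
  have "(\<integral>\<omega>. loc_eval (X \<omega>) f \<partial>M) = (\<integral>\<omega>. F \<omega> / W \<omega> \<partial>M)"
    using eq by (intro integral_cong_AE) measurable
  then show "(\<integral>\<omega>. loc_eval (X \<omega>) f \<partial>M) = L f" using q by simp
qed

text \<open>The measure is the law of evaluation at the random point. Measurability is tested on
  positivity sets, each of which involves one element of the algebra, so an uncountable \<Omega>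
  causes no difficulty.\<close>

lemma representing_measure:
  "\<exists>\<nu>. finite_measure \<nu> \<and> sets \<nu> = constructibly_borel (B_loc \<Omega>) \<and>
     (\<forall>f\<in>B_loc \<Omega>. integrable \<nu> (\<lambda>\<alpha>. \<alpha> f) \<and> (\<integral>\<alpha>. \<alpha> f \<partial>\<nu>) = L f)"
proof -
  let ?B = "B_loc \<Omega>"
  let ?N = "sigma (char_space ?B) {pos_set ?B a | a. a \<in> ?B}"
  define T where "T \<omega> = restrict (loc_eval (X \<omega>)) ?B" for \<omega>
  have pos: "{pos_set ?B a | a. a \<in> ?B} \<subseteq> Pow (char_space ?B)"
    by (auto simp: pos_set_def)
  have sets_N: "sets ?N = constructibly_borel ?B"
    using pos by (simp add: constructibly_borel_def)
  have T: "T \<in> measurable M ?N"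
  proof (rule measurable_measure_of[OF pos])
    show "T \<in> space M \<rightarrow> char_space ?B"
      by (simp add: T_def loc_eval_char)
    fix S assume "S \<in> {pos_set ?B a | a. a \<in> ?B}"
    then obtain a where S: "S = pos_set ?B a" and a: "a \<in> ?B" by blast
    have "T -` S \<inter> space M = {\<omega> \<in> space M. 0 < loc_eval (X \<omega>) a}"
      using a by (auto simp: S pos_set_eq T_def loc_eval_char)
    also have "\<dots> \<in> sets M"
      using loc_eval_X_measurable[OF a] by measurable
    finally show "T -` S \<inter> space M \<in> sets M" .
  qed
  show ?thesis
  proof (intro exI[of _ "distr M ?N T"] conjI ballI)
    show "finite_measure (distr M ?N T)"
      by (rule bits.P.finite_measure_distr[OF T])
    show "sets (distr M ?N T) = constructibly_borel ?B"
      by (simp add: sets_N)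
    fix f assume f: "f \<in> ?B"
    have m: "(\<lambda>\<alpha>. \<alpha> f) \<in> borel_measurable ?N"
      by (rule measurable_char_apply[OF subalgebra_B_loc sets_N f])
    show "integrable (distr M ?N T) (\<lambda>\<alpha>. \<alpha> f)"
      using f expectation_loc_eval_X(1)[OF f] by (simp add: integrable_distr_eq[OF T m] T_def)
    show "(\<integral>\<alpha>. \<alpha> f \<partial>distr M ?N T) = L f"
      using f expectation_loc_eval_X(2)[OF f] by (simp add: integral_distr[OF T m] T_def)
  qed
qed

end

text \<open>Scaling by \<open>L 1\<close> removes the normalization.\<close>

lemma loc_representing_measure:
  assumes L: "L \<in> psd_functionals (B_loc \<Omega>)"
  shows "\<exists>\<nu>. finite_measure \<nu> \<and> sets \<nu> = constructibly_borel (B_loc \<Omega>) \<and>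
    (\<forall>f\<in>B_loc \<Omega>. integrable \<nu> (\<lambda>\<alpha>. \<alpha> f) \<and> (\<integral>\<alpha>. \<alpha> f \<partial>\<nu>) = L f)"
proof -
  let ?B = "B_loc \<Omega>"
  interpret psd_functional ?B L
    by unfold_locales (simp_all add: subalgebra_B_loc L)
  define c where "c = L 1"
  have c: "c \<ge> 0"
    unfolding c_def by (intro L_nonneg sums_of_squares_one subalgebra_B_loc)
  show ?thesis
  proof (cases "c = 0")
    case True
    let ?N = "null_measure (sigma (char_space ?B) {pos_set ?B a | a. a \<in> ?B})"
    have sets: "sets ?N = constructibly_borel ?B"
      by (subst sets_null_measure, subst sets_measure_of) (auto simp: pos_set_def constructibly_borel_def)
    \<comment> \<open>If \<open>L 1 = 0\<close>, Cauchy-Schwarz against 1 forces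
      \<open>L = 0\<close>, which the zero measure represents.\<close>
    have "L f = 0" if f: "f \<in> ?B" for f
      using Cauchy_Schwarz[OF f B_intros(1)] True by (simp add: c_def)
    then show ?thesis
      using sets measurable_char_apply[OF subalgebra_B_loc sets]
      by (intro exI[of _ ?N]) (auto intro: finite_measureI)
  next
    case False
    then have pos: "c > 0" using c by simp
    \<comment> \<open>The restriction keeps the quotient extensional, as membership in
      \<open>psd_functionals\<close> demands.\<close>
    define L' where "L' = (\<lambda>f\<in>?B. L f / c)"
    interpret L': normalized_functional \<Omega> L'
    proof
      show "L' 1 = 1"
        using False B_intros(1) by (simp add: L'_def c_def)
      show "L' \<in> psd_functionals ?B"
        using pos sums_of_squares_subset[OF subalgebra_B_loc]
        by (auto simp: psd_functionals_def L'_def L_add L_scaleR L_nonneg B_intros add_divide_distrib subset_iff)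
    qed
    obtain \<nu> where \<nu>: "finite_measure \<nu>" "sets \<nu> = constructibly_borel ?B"
      "\<And>f. f \<in> ?B \<Longrightarrow> integrable \<nu> (\<lambda>\<alpha>. \<alpha> f)" "\<And>f. f \<in> ?B \<Longrightarrow> (\<integral>\<alpha>. \<alpha> f \<partial>\<nu>) = L' f"
      using L'.representing_measure by blast
    let ?\<mu> = "density \<nu> (\<lambda>_. ennreal c)"
    note m = measurable_char_apply[OF subalgebra_B_loc \<nu>(2)]
    have "emeasure ?\<mu> (space ?\<mu>) \<noteq> \<infinity>"
      using finite_measure.emeasure_finite[OF \<nu>(1)]
      by (simp add: emeasure_density ennreal_mult_eq_top_iff)
    then have "finite_measure ?\<mu>"
      by (rule finite_measureI)
    moreover have "integrable ?\<mu> (\<lambda>\<alpha>. \<alpha> f) \<and> (\<integral>\<alpha>. \<alpha> f \<partial>?\<mu>) = L f" if f: "f \<in> ?B" for f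
      using m[OF f] pos \<nu>(3,4)[OF f] f
      by (simp add: integrable_density integral_density L'_def)
    ultimately show ?thesis
      using \<nu>(2) by (intro exI[of _ ?\<mu>]) simp
  qed
qed

text \<open>Products of the \<open>u_i\<close> are positive at every character and tame every
  element; this supplies the bounded multiples for uniqueness.\<close>

lemma loc_bounded_denominator:
  assumes "f \<in> B_loc \<Omega>"
  shows "\<exists>w\<in>B_loc \<Omega>. (\<forall>\<alpha>\<in>char_space (B_loc \<Omega>). \<alpha> w > 0) \<and> f * w \<in> bounded_elements (B_loc \<Omega>)"
proof -
  let ?B = "B_loc \<Omega>"
  let ?A = "bounded_elements ?B"
  \<comment> \<open>\<open>w\<close> itself must be bounded, so that the cross terms
    \<open>(f * w) * w'\<close> of a sum are.\<close>
  let ?P = "\<lambda>f w. w \<in> ?A \<and> (\<forall>\<alpha>\<in>char_space ?B. \<alpha> w > 0) \<and> f * w \<in> ?A"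
  note D = subalgebra_B_loc[of \<Omega>]
  note A = subalgebraD[OF subalgebra_bounded_elements[OF D]]
  have AB: "?A \<subseteq> ?B" by (auto simp: bounded_elements_def)
  have mult: "\<alpha> (w * w') > 0" if "?P f w" "?P f' w'" "\<alpha> \<in> char_space ?B" for f w f' w' \<alpha>
    using that AB by (auto simp: char_mult[OF D] subset_iff)
  have u: "\<alpha> (loc_u i) > 0 \<and> \<alpha> (loc_u i) \<le> 1 \<and> \<bar>\<alpha> (loc_x i * loc_u i)\<bar> \<le> 1"
    if i: "i \<in> \<Omega>" and \<alpha>: "\<alpha> \<in> char_space ?B" for i \<alpha>
  proof -
    note B = subalgebraD[OF D] loc_x_in[OF i] loc_u_in[OF i] subalgebra_more(4)[OF D]
    note ch = char_mult[OF D \<alpha>] char_add[OF D \<alpha>] char_one[OF D \<alpha>] char_power2[OF D \<alpha>]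
    have eq: "\<alpha> (loc_u i) * (1 + (\<alpha> (loc_x i))\<^sup>2) = 1"
      using arg_cong[OF loc_u_eq[of i], of \<alpha>] by (simp add: ch B)
    have pos: "1 + (\<alpha> (loc_x i))\<^sup>2 > 0"
      by (rule add_pos_nonneg) simp_all
    have val: "\<alpha> (loc_u i) = 1 / (1 + (\<alpha> (loc_x i))\<^sup>2)"
      using eq pos by (simp add: eq_divide_eq)
    \<comment> \<open>This bounds \<open>x * u\<close> by 1 in absolute value; it follows from
      \<open>(\<bar>x\<bar> - 1)\<^sup>2 \<ge> 0\<close>.\<close>
    have "\<bar>\<alpha> (loc_x i)\<bar> \<le> 1 + (\<alpha> (loc_x i))\<^sup>2"
    proof -
      have "0 \<le> (\<bar>\<alpha> (loc_x i)\<bar> - 1)\<^sup>2" by simp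
      then have "2 * \<bar>\<alpha> (loc_x i)\<bar> \<le> 1 + (\<alpha> (loc_x i))\<^sup>2"
        by (simp add: power2_diff)
      then show ?thesis using abs_ge_zero[of "\<alpha> (loc_x i)"] by linarith
    qed
    then show ?thesis
      using pos by (simp add: ch B val abs_mult divide_le_eq)
  qed
  have "?B \<subseteq> {f. \<exists>w. ?P f w}"
  proof (rule B_loc_subset)
    show "subalgebra {f. \<exists>w. ?P f w}"
      unfolding subalgebra_def
    proof (intro conjI ballI allI)
      show "1 \<in> {f. \<exists>w. ?P f w}"
        by (intro CollectI exI[of _ 1]) (simp add: A char_one[OF D])
      fix f c assume "f \<in> {f. \<exists>w. ?P f w}"
      then obtain w where w: "?P f w" by blast
      then show "c *\<^sub>R f \<in> {f. \<exists>w. ?P f w}"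
        by (intro CollectI exI[of _ w]) (simp add: A)
      fix f' assume "f' \<in> {f. \<exists>w. ?P f w}"
      then obtain w' where w': "?P f' w'" by blast
      have "(f + f') * (w * w') = (f * w) * w' + (f' * w') * w"
        by (simp add: algebra_simps)
      moreover have "(f * w) * w' + (f' * w') * w \<in> ?A"
        using w w' by (simp add: A)
      ultimately have "?P (f + f') (w * w')"
        using w w' mult[OF w w'] by (simp add: A)
      have "f * f' * (w * w') = (f * w) * (f' * w')"
        by (simp add: algebra_simps)
      moreover have "(f * w) * (f' * w') \<in> ?A"
        using w w' A(3)[of "f * w" "f' * w'"] by simp
      ultimately have "f * f' * (w * w') \<in> ?A"
        by (simp only:)
      then have "?P (f * f') (w * w')"
        using w w' mult[OF w w'] by (simp add: A)
      then show "f * f' \<in> {f. \<exists>w. ?P f w}" by blast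
      show "f + f' \<in> {f. \<exists>w. ?P f w}" using \<open>?P (f + f') (w * w')\<close> by blast
    qed
    fix i assume i: "i \<in> \<Omega>"
    have "\<bar>\<alpha> (loc_u i)\<bar> \<le> 1" if "\<alpha> \<in> char_space ?B" for \<alpha>
      using u[OF i that] by simp
    then have ub: "loc_u i \<in> ?A" "loc_x i * loc_u i \<in> ?A"
      using u[OF i] loc_u_in[OF i] loc_x_in[OF i] subalgebraD(3)[OF D]
      unfolding bounded_elements_def by (blast intro: exI[of _ 1])+
    then show "loc_x i \<in> {f. \<exists>w. ?P f w}"
      using u[OF i] by (intro CollectI exI[of _ "loc_u i"]) simp
    show "loc_u i \<in> {f. \<exists>w. ?P f w}"
      using ub by (intro CollectI exI[of _ 1]) (simp add: A char_one[OF D])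
  qed
  then show ?thesis
    using assms AB by blast
qed

theorem proposition3p8:
  fixes \<Omega> :: "'i set"
  defines "B \<equiv> B_loc \<Omega>"
  shows "bij_betw (\<lambda>\<nu>. \<lambda>f\<in>B. integral\<^sup>L \<nu> (hat B f))
    {\<nu>. constructibly_radon B \<nu> \<and> (\<forall>f\<in>B. integrable \<nu> (hat B f))}
    (psd_functionals B)"
    (is "bij_betw ?\<Phi> ?N _")
proof -
  have B: "subalgebra B" unfolding B_def by (rule subalgebra_B_loc)
  have space: "space \<nu> = char_space B" and sets: "sets \<nu> = constructibly_borel B" if "constructibly_radon B \<nu>" for \<nu>
    using that by (auto simp: constructibly_radon_def)
  have hat: "(\<integral>\<alpha>. \<alpha> f \<partial>\<nu>) = integral\<^sup>L \<nu> (hat B f)" "integrable \<nu> (\<lambda>\<alpha>. \<alpha> f) \<longleftrightarrow> integrable \<nu> (hat B f)"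
    if "space \<nu> = char_space B" for \<nu> f
    using that by (auto simp: hat_eq intro!: Bochner_Integration.integral_cong Bochner_Integration.integrable_cong)
  \<comment> \<open>Integrability of the evaluation at 1 says that the total mass is finite.\<close>
  have finite: "finite_measure \<nu>" if "\<nu> \<in> ?N" for \<nu>
  proof (rule finite_measureI)
    have "integrable \<nu> (\<lambda>\<alpha>. \<alpha> 1)"
      using that subalgebraD(1)[OF B] space[of \<nu>] hat(2)[of \<nu> 1] by auto
    moreover have "integrable \<nu> (\<lambda>\<alpha>. \<alpha> 1) \<longleftrightarrow> integrable \<nu> (\<lambda>_. 1 :: real)"
      using that space[of \<nu>] char_one[OF B] by (intro Bochner_Integration.integrable_cong refl) auto
    ultimately show "emeasure \<nu> (space \<nu>) \<noteq> \<infinity>"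
      by (auto simp: integrable_iff_bounded)
  qed
  show ?thesis
  proof (rule bij_betw_imageI)
    show "inj_on ?\<Phi> ?N"
    proof (rule inj_onI)
      fix \<mu> \<nu> assume \<mu>: "\<mu> \<in> ?N" and \<nu>: "\<nu> \<in> ?N" and eq: "?\<Phi> \<mu> = ?\<Phi> \<nu>"
      show "\<mu> = \<nu>"
      proof (rule constructible_measure_eqI[OF B finite[OF \<mu>] finite[OF \<nu>]])
        show "sets \<mu> = constructibly_borel B" "sets \<nu> = constructibly_borel B"
          using \<mu> \<nu> sets by auto
        show "\<exists>w\<in>B. (\<forall>\<alpha>\<in>char_space B. \<alpha> w > 0) \<and> a * w \<in> bounded_elements B" if "a \<in> B" for a
          using that unfolding B_def by (rule loc_bounded_denominator)
        show "(\<integral>\<alpha>. \<alpha> a \<partial>\<mu>) = (\<integral>\<alpha>. \<alpha> a \<partial>\<nu>)" if "a \<in> bounded_elements B" for a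
        proof -
          have "a \<in> B" using that by (simp add: bounded_elements_def)
          then have "integral\<^sup>L \<mu> (hat B a) = integral\<^sup>L \<nu> (hat B a)"
            using fun_cong[OF eq, of a] by simp
          then show ?thesis
            using \<mu> \<nu> space hat(1) by simp
        qed
      qed
    qed
    show "?\<Phi> ` ?N = psd_functionals B"
    proof (intro equalityI image_subsetI subsetI)
      fix \<nu> assume "\<nu> \<in> ?N"
      then show "?\<Phi> \<nu> \<in> psd_functionals B"
        using integral_psd_functional[OF B space] by auto
    next
      fix L assume L: "L \<in> psd_functionals B"
      then obtain \<nu> where \<nu>: "finite_measure \<nu>" "sets \<nu> = constructibly_borel B"
        "\<And>f. f \<in> B \<Longrightarrow> integrable \<nu> (\<lambda>\<alpha>. \<alpha> f) \<and> (\<integral>\<alpha>. \<alpha> f \<partial>\<nu>) = L f"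
        unfolding B_def using loc_representing_measure[of L \<Omega>] by blast
      have radon: "constructibly_radon B \<nu>"
        by (rule finite_measure_constructibly_radon[OF B \<nu>(2,1)])
      note h = hat[OF space[OF radon]]
      \<comment> \<open>Outside \<open>B\<close> both sides are \<open>undefined\<close>.\<close>
      have "?\<Phi> \<nu> f = L f" for f
        using \<nu>(3)[of f] h(1) L by (cases "f \<in> B") (auto simp: psd_functionals_def extensional_def)
      moreover have "\<nu> \<in> ?N"
        using radon \<nu>(3) h(2) by auto
      ultimately show "L \<in> ?\<Phi> ` ?N"
        by (intro image_eqI[of _ _ \<nu>]) auto
    qed
  qed
qed

end
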